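(* $\mathcal{PMV}(4,2)=\Big\{v=(v_{ij})_{1\le i<j\le 4}\in\mathbb R_{\ge0}^{6}\ :\ v_{ij}v_{kl}\le v_{ik}v_{jl}+v_{il}v_{jk}\ \text{for all } \{i,j\}\sqcup\{k,l\}=\{1,2,3,4\}\Big\}.$ Equivalently, $\mathcal{PMV}(4,2)$ is the set of nonnegative $v\in\mathbb R^6$ satisfying $v_{12}v_{34}+v_{13}v_{24}-v_{14}v_{23}\ge0$, $v_{12}v_{34}-v_{13}v_{24}+v_{14}v_{23}\ge0$, $-v_{12}v_{34}+v_{13}v_{24}+v_{14}v_{23}\ge0$.
   Context: $\mathcal K_2$ denotes the set of nonempty compact convex subsets of $\mathbb R^2$. The mixed area of $K,L\in\mathcal K_2$ is $\mathrm V(K,L)=\tfrac12\big(\mathrm{Vol}_2(K+L)-\mathrm{Vol}_2(K)-\mathrm{Vol}_2(L)\big)$ (Minkowski sum, Lebesgue area). Coordinates of $\mathbb R^{\binom n2}$ are indexed by unordered pairs $\{i,j\}\subset[n]=\{1,\dots,n\}$, written $v_{ij}=v_{ji}$. The pure mixed area configuration space is $\mathcal{PMV}(n,2)=\{(\mathrm V(K_i,K_j))_{\{i,j\}\subset[n]}\in\mathbb R^{\binom n2} : K_1,\dots,K_n\in\mathcal K_2\}$. *)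

theory Defs
  imports "HOL-Analysis.Analysis"
begin

definition K2 :: "(real^2) set set" where
  "K2 = {K. K \<noteq> {} \<and> compact K \<and> convex K}"

definition minkowski_sum :: "(real^2) set \<Rightarrow> (real^2) set \<Rightarrow> (real^2) set" where
  "minkowski_sum K L = {x + y | x y. x \<in> K \<and> y \<in> L}"

definition area :: "(real^2) set \<Rightarrow> real" where
  "area K = measure lebesgue K"

definition mixed_area :: "(real^2) set \<Rightarrow> (real^2) set \<Rightarrow> real" where
  "mixed_area K L = (area (minkowski_sum K L) - area K - area L) / 2"

text \<open>Unordered pairs {i,j} of [n] = {1..n}; these index the coordinates of R^(n choose 2).\<close>
definition pairs :: "nat \<Rightarrow> nat set set" where
  "pairs n = {S. \<exists>i j. 1 \<le> i \<and> i < j \<and> j \<le> n \<and> S = {i, j}}"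

text \<open>A vector of R^(n choose 2) is a function on unordered pairs, vanishing outside pairs n.\<close>
definition PMV2 :: "nat \<Rightarrow> (nat set \<Rightarrow> real) set" where
  "PMV2 n = {v. \<exists>K :: nat \<Rightarrow> (real^2) set. (\<forall>i\<in>{1..n}. K i \<in> K2) \<and>
      v = (\<lambda>S. if S \<in> pairs n then mixed_area (K (Min S)) (K (Max S)) else 0)}"

end

theory Submission
  imports Defs
begin

text \<open>
  Write \<open>V\<close> for the mixed area. The area of \<open>K + M\<close> is a valuation in \<open>K\<close>; this alone gives
  monotonicity of \<open>V\<close> (cut off a halfplane at a time) and, together with homogeneity of the area
  under scaling, its bilinearity. By monotonicity and bilinearity the inequality
  \<open>V(A,B) V(C,D) \<le> V(A,C) V(B,D) + V(A,D) V(B,C)\<close> for all \<open>A\<close> says that a translate of \<open>V(C,D) B\<close>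
  is contained in \<open>V(B,D) C + V(B,C) D\<close>. Such a containment is tested by triples of support
  directions summing to \<open>0\<close>, that is, by circumscribed triangles of one shape, which after an affine
  map is the standard triangle \<open>T\<close>. If \<open>B\<close>, \<open>C\<close>, \<open>D\<close> are inscribed in \<open>T\<close>, the claim becomes the
  triangle inequality \<open>V(C,D) \<le> V(B,C) + V(B,D)\<close>. There \<open>B\<close> shrinks to a triangle with one vertex
  on each side of \<open>T\<close>, and \<open>D\<close> grows to \<open>T\<close> with three corners cut off parallel to the sides of \<open>B\<close>;
  what is left is an inequality in the nine real parameters.

  Conversely, if \<open>v\<^sub>1\<^sub>2 > 0\<close> take segments in the two coordinate directions as \<open>K\<^sub>1\<close> and \<open>K\<^sub>2\<close>. They
  prescribe the bounding boxes of \<open>K\<^sub>3\<close> and \<open>K\<^sub>4\<close>; with \<open>K\<^sub>4\<close> the diagonal of its box, moving \<open>K\<^sub>3\<close>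
  from the diagonal to the full box sweeps exactly the allowed range of \<open>V(K\<^sub>3,K\<^sub>4)\<close>.
\<close>

section \<open>Valuation property and monotonicity\<close>

text \<open>The obstacle is that the mixed area is given only through areas of sums, where neither
  monotonicity nor bilinearity is visible. Asking for a containment removes \<open>A\<close>: a
  statement about four bodies becomes one about support values of three. Triples of directions
  suffice because a point of a convex hull in the plane lies in the hull of three of the points.
  Each term of the resulting inequality has degree one in each of \<open>B\<close>,
  \<open>C\<close>, \<open>D\<close>, so their circumscribed triangles may be scaled to the same
  \<open>tri\<close>, and the coefficients disappear. For the triangle inequality two estimates run
  in opposite directions: shrinking \<open>B\<close> bounds its mixed areas from below, growing
  \<open>D\<close> bounds \<open>dmv C D\<close> from above. Both compare with
  \<open>dmv tri tri = 1\<close>, the common value for all bodies inscribed in \<open>tri\<close>,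
  and both measure the loss at the same three corners.\<close>

lemma body_nonempty: "K \<in> K2 \<Longrightarrow> K \<noteq> {}"
  and body_compact: "K \<in> K2 \<Longrightarrow> compact K"
  and body_convex: "K \<in> K2 \<Longrightarrow> convex K"
  and bodyI: "K \<noteq> {} \<Longrightarrow> compact K \<Longrightarrow> convex K \<Longrightarrow> K \<in> K2"
  by (auto simp: K2_def)

lemma body_closed: "K \<in> K2 \<Longrightarrow> closed K"
  by (simp add: body_compact compact_imp_closed)

lemma body_plus:
  assumes "K \<in> K2" "L \<in> K2"
  shows "K + L \<in> K2"
proof (rule bodyI)
  show "K + L \<noteq> {}"
    using body_nonempty[OF assms(1)] body_nonempty[OF assms(2)] by (auto simp: set_plus_def)
  have "K + L = {x + y | x y. x \<in> K \<and> y \<in> L}"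
    by (auto simp: set_plus_def)
  then show "compact (K + L)"
    using compact_sums[OF body_compact[OF assms(1)] body_compact[OF assms(2)]] by simp
  show "convex (K + L)"
    using assms by (simp add: convex_set_plus body_convex)
qed

lemma body_linear_image: "linear f \<Longrightarrow> K \<in> K2 \<Longrightarrow> f ` K \<in> K2" for f :: "real^2 \<Rightarrow> real^2"
  by (auto simp: K2_def intro: compact_continuous_image linear_continuous_on convex_linear_image simp: linear_conv_bounded_linear)

lemma body_singleton [simp]: "{a} \<in> K2"
  by (simp add: K2_def)

lemma body_segment [simp]: "closed_segment a b \<in> K2"
  by (simp add: K2_def)

lemma body_hull: "finite S \<Longrightarrow> S \<noteq> {} \<Longrightarrow> convex hull S \<in> K2"
  by (simp add: K2_def finite_imp_compact_convex_hull)

lemma body_Int_closed: "K \<in> K2 \<Longrightarrow> closed S \<Longrightarrow> convex S \<Longrightarrow> K \<inter> S \<noteq> {} \<Longrightarrow> K \<inter> S \<in> K2"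
  by (simp add: K2_def compact_Int_closed convex_Int)

lemma body_lmeasurable: "K \<in> K2 \<Longrightarrow> K \<in> lmeasurable"
  by (simp add: body_compact lmeasurable_compact)

lemma area_singleton [simp]: "area {a} = 0"
  by (simp add: area_def)

lemma singleton_plus: "{a} + K = (+) a ` K" for K :: "'a::plus set"
  by (auto simp: set_plus_def)

lemma area_translate [simp]: "area ({a} + K) = area K"
  by (simp add: area_def singleton_plus measure_translation)

lemma area_mono: "K \<subseteq> L \<Longrightarrow> K \<in> lmeasurable \<Longrightarrow> L \<in> lmeasurable \<Longrightarrow> area K \<le> area L"
  by (auto simp: area_def fmeasurableD intro: measure_mono_fmeasurable)

lemma area_linear_image:
  "linear f \<Longrightarrow> K \<in> lmeasurable \<Longrightarrow> area (f ` K) = \<bar>det (matrix f)\<bar> * area K"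
  for f :: "real^2 \<Rightarrow> real^2"
  by (simp add: area_def measure_linear_image)

lemma area_hyperplane:
  fixes a :: "real^2"
  assumes "a \<noteq> 0" "K \<subseteq> {x. a \<bullet> x = b}"
  shows "area K = 0"
  unfolding area_def using assms
  by (intro negligible_imp_measure0 negligible_subset[OF negligible_hyperplane[of a b]]) auto

text \<open>Twice the mixed area. The inequality is quadratic on both sides, so the halves cancel
  and return only when coordinates are read off.\<close>

definition dmv :: "(real^2) set \<Rightarrow> (real^2) set \<Rightarrow> real" where
  "dmv K L = area (K + L) - area K - area L"

lemma mixed_area_dmv: "mixed_area K L = dmv K L / 2"
proof -
  have "minkowski_sum K L = K + L"
    by (auto simp: minkowski_sum_def set_plus_def)
  then show ?thesis by (simp add: mixed_area_def dmv_def)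
qed

lemma dmv_commute: "dmv K L = dmv L K"
  by (simp add: dmv_def add.commute)

lemma dmv_translate_left [simp]: "dmv ({a} + K) L = dmv K L"
  by (simp add: dmv_def add.assoc)

lemma dmv_translate_right [simp]: "dmv K ({a} + L) = dmv K L"
  by (metis dmv_commute dmv_translate_left)

lemma dmv_singleton [simp]: "dmv {a} K = 0" "dmv K {a} = 0"
proof -
  show "dmv {a} K = 0" by (simp add: dmv_def)
  then show "dmv K {a} = 0" by (simp add: dmv_commute)
qed

lemma linear_image_plus:
  assumes f: "linear f"
  shows "f ` (K + L) = f ` K + f ` L"
proof
  show "f ` (K + L) \<subseteq> f ` K + f ` L"
  proof
    fix z assume "z \<in> f ` (K + L)"
    then obtain x y where "x \<in> K" "y \<in> L" "z = f (x + y)"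
      by (auto simp: set_plus_def)
    then show "z \<in> f ` K + f ` L" using f by (auto simp: linear_add)
  qed
  show "f ` K + f ` L \<subseteq> f ` (K + L)"
  proof
    fix z assume "z \<in> f ` K + f ` L"
    then obtain x y where "x \<in> K" "y \<in> L" "z = f (x + y)"
      using f by (auto simp: set_plus_def linear_add)
    then show "z \<in> f ` (K + L)" by (blast intro: set_plus_intro)
  qed
qed

lemma dmv_linear_image:
  fixes f :: "real^2 \<Rightarrow> real^2"
  assumes "linear f" "K \<in> K2" "L \<in> K2"
  shows "dmv (f ` K) (f ` L) = \<bar>det (matrix f)\<bar> * dmv K L"
  using assms
  by (simp add: dmv_def area_linear_image body_lmeasurable body_plus algebra_simps
      flip: linear_image_plus)

text \<open>Write a point of the right-hand side as \<open>k + m = l + m'\<close>. The segment from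
  \<open>k\<close> to \<open>l\<close> is connected and covered by the closed sets \<open>K\<close>
  and \<open>L\<close>, so it has a point \<open>y\<close> in both; the same weights applied to
  \<open>m\<close> and \<open>m'\<close> give a point of \<open>M\<close>, and the sum is still the
  given point.\<close>

lemma Int_plus_distrib:
  fixes K L M :: "'a::real_normed_vector set"
  assumes "closed K" "closed L" "convex (K \<union> L)" "convex M"
  shows "(K \<inter> L) + M = (K + M) \<inter> (L + M)"
proof
  show "(K \<inter> L) + M \<subseteq> (K + M) \<inter> (L + M)"
    by (auto simp: set_plus_def)
  show "(K + M) \<inter> (L + M) \<subseteq> (K \<inter> L) + M"
  proof
    fix x assume "x \<in> (K + M) \<inter> (L + M)"
    then obtain k m l m' where k: "k \<in> K" and l: "l \<in> L" and m: "m \<in> M" "m' \<in> M"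
      and x: "x = k + m" "x = l + m'"
      by (auto simp: set_plus_def)
    have seg: "closed_segment k l \<subseteq> K \<union> L"
      using assms(3) k l by (meson UnI1 UnI2 closed_segment_subset)
    have "closed_segment k l \<inter> (K \<inter> L) \<noteq> {}"
    proof (rule ccontr)
      assume "\<not> ?thesis"
      then have "K \<inter> L \<inter> closed_segment k l = {}" by blast
      with connected_segment[of k l] seg assms(1,2) k l show False
        unfolding connected_closed by (metis disjoint_iff ends_in_segment)
    qed
    then obtain y where y: "y \<in> K" "y \<in> L" and "y \<in> closed_segment k l"
      by blast
    then obtain u where u: "0 \<le> u" "u \<le> 1" "y = (1 - u) *\<^sub>R k + u *\<^sub>R l"
      by (auto simp: in_segment)
    have "x = (1 - u) *\<^sub>R x + u *\<^sub>R x"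
      by (simp flip: scaleR_left_distrib)
    also have "\<dots> = (1 - u) *\<^sub>R (k + m) + u *\<^sub>R (l + m')"
      using x by simp
    also have "\<dots> = y + ((1 - u) *\<^sub>R m + u *\<^sub>R m')"
      using u by (simp add: algebra_simps)
    finally have "x = y + ((1 - u) *\<^sub>R m + u *\<^sub>R m')" .
    moreover have "(1 - u) *\<^sub>R m + u *\<^sub>R m' \<in> M"
      using assms(4) m u by (simp add: convexD)
    ultimately show "x \<in> (K \<inter> L) + M"
      using y by (auto simp: set_plus_def)
  qed
qed

lemma dmv_valuation:
  assumes K: "K \<in> K2" and L: "L \<in> K2" and KL: "convex (K \<union> L)" and M: "M \<in> K2"
  shows "dmv (K \<union> L) M + dmv (K \<inter> L) M = dmv K M + dmv L M"
proof -
  have "area (K \<union> L) = area K + area L - area (K \<inter> L)"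
    using K L by (simp add: area_def measure_Un3 body_lmeasurable)
  moreover have "area ((K \<union> L) + M) = area (K + M) + area (L + M) - area ((K \<inter> L) + M)"
    using K L M KL
    by (simp add: area_def measure_Un3 body_lmeasurable body_plus Un_set_plus Int_plus_distrib
        body_closed body_convex)
  ultimately show ?thesis by (simp add: dmv_def)
qed

lemma halfspace_cut_nonempty:
  fixes K :: "(real^2) set"
  assumes "convex K" "K \<inter> {x. n \<bullet> x \<le> c} \<noteq> {}" "K \<inter> {x. n \<bullet> x \<ge> c} \<noteq> {}"
  shows "K \<inter> {x. n \<bullet> x = c} \<noteq> {}"
proof -
  obtain x y where "x \<in> K" "y \<in> K" "n \<bullet> x \<le> c" "c \<le> n \<bullet> y"
    using assms by auto
  with connected_ivt_hyperplane[OF convex_connected[OF assms(1)], of x y n c] show ?thesis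
    by auto
qed

lemma dmv_cut:
  assumes K: "K \<in> K2" and L: "L \<in> K2"
    and "K \<inter> {x. n \<bullet> x \<le> c} \<noteq> {}" "K \<inter> {x. n \<bullet> x \<ge> c} \<noteq> {}"
  shows "dmv K L + dmv (K \<inter> {x. n \<bullet> x = c}) L
       = dmv (K \<inter> {x. n \<bullet> x \<le> c}) L + dmv (K \<inter> {x. n \<bullet> x \<ge> c}) L"
proof -
  have "K \<inter> {x. n \<bullet> x \<le> c} \<union> K \<inter> {x. n \<bullet> x \<ge> c} = K"
    "(K \<inter> {x. n \<bullet> x \<le> c}) \<inter> (K \<inter> {x. n \<bullet> x \<ge> c}) = K \<inter> {x. n \<bullet> x = c}"
    by auto
  moreover have "K \<inter> {x. n \<bullet> x \<le> c} \<in> K2" "K \<inter> {x. n \<bullet> x \<ge> c} \<in> K2"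
    using assms by (auto intro!: body_Int_closed simp: closed_halfspace_le closed_halfspace_ge
        convex_halfspace_le convex_halfspace_ge)
  ultimately show ?thesis
    using dmv_valuation[of "K \<inter> {x. n \<bullet> x \<le> c}" "K \<inter> {x. n \<bullet> x \<ge> c}" L] body_convex[OF K] L
    by simp
qed

text \<open>
  For \<open>N\<close> the part of \<open>K\<close> cut off and \<open>s\<close> the cut, \<open>N + L\<close> contains the essentially disjoint sets
  \<open>s + L\<close> and \<open>m + N\<close>, where \<open>m \<in> L\<close> is extreme in direction \<open>n\<close>; hence \<open>dmv s L \<le> dmv N L\<close>.
\<close>
lemma dmv_halfspace_le:
  assumes K: "K \<in> K2" and L: "L \<in> K2" and n: "n \<noteq> 0" and ne: "K \<inter> {x. n \<bullet> x \<le> c} \<noteq> {}"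
  shows "dmv (K \<inter> {x. n \<bullet> x \<le> c}) L \<le> dmv K L"
proof (cases "K \<inter> {x. n \<bullet> x \<ge> c} = {}")
  case True
  then have "K \<inter> {x. n \<bullet> x \<le> c} = K" by auto
  then show ?thesis by simp
next
  case False
  define N where "N = K \<inter> {x. n \<bullet> x \<ge> c}"
  define s where "s = K \<inter> {x. n \<bullet> x = c}"
  have s0: "s \<noteq> {}"
    unfolding s_def using halfspace_cut_nonempty body_convex K ne False by blast
  have N: "N \<in> K2" and s: "s \<in> K2"
    using False K s0 unfolding N_def s_def
    by (auto intro!: body_Int_closed simp: closed_halfspace_ge convex_halfspace_ge
        closed_hyperplane convex_hyperplane)
  obtain m where m: "m \<in> L" "\<And>y. y \<in> L \<Longrightarrow> n \<bullet> y \<le> n \<bullet> m"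
    using continuous_attains_sup[of L "\<lambda>x. n \<bullet> x"] body_compact[OF L] body_nonempty[OF L]
    by (auto simp: continuous_on_inner)
  have "area ((s + L) \<inter> ({m} + N)) = 0"
  proof (rule area_hyperplane[OF n])
    show "(s + L) \<inter> ({m} + N) \<subseteq> {x. n \<bullet> x = c + n \<bullet> m}"
    proof
      fix x assume "x \<in> (s + L) \<inter> ({m} + N)"
      then obtain u v w where "u \<in> s" "v \<in> L" "w \<in> N" "x = u + v" "x = m + w"
        by (auto simp: set_plus_def)
      then show "x \<in> {x. n \<bullet> x = c + n \<bullet> m}"
        using m(2)[of v] inner_add_right[of n u v] inner_add_right[of n m w]
        by (auto simp: s_def N_def)
    qed
  qed
  then have "area (s + L) + area N = area ((s + L) \<union> ({m} + N))"
    using s N L unfolding area_def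
    by (subst measure_Un3) (auto simp: body_lmeasurable body_plus area_translate[unfolded area_def])
  also have "\<dots> \<le> area (N + L)"
  proof (rule area_mono)
    have "s \<subseteq> N" by (auto simp: s_def N_def)
    moreover have "{m} + N \<subseteq> N + L"
      using m(1) by (metis add.commute empty_subsetI insert_subset order_refl set_plus_mono2)
    ultimately show "(s + L) \<union> ({m} + N) \<subseteq> N + L"
      by (simp add: set_plus_mono2)
    show "s + L \<union> ({m} + N) \<in> lmeasurable" "N + L \<in> lmeasurable"
      using s N L by (auto simp: body_lmeasurable body_plus)
  qed
  finally have "area (s + L) + area N \<le> area (N + L)" .
  moreover have "area s = 0"
    by (rule area_hyperplane[OF n, of _ c]) (auto simp: s_def)
  ultimately have "dmv s L \<le> dmv N L"
    by (simp add: dmv_def)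
  then show ?thesis
    using dmv_cut[OF K L ne False] by (simp add: N_def s_def)
qed

section \<open>Decreasing approximation by halfplane cuts\<close>

lemma body_eq_INT_halfspaces:
  fixes K :: "(real^2) set"
  assumes K: "K \<in> K2"
  obtains a b where "\<And>n::nat. a n \<noteq> 0" "K = (\<Inter>n. {x. a n \<bullet> x \<le> b n})"
proof -
  \<comment> \<open>The complement of \<open>K\<close> is the union of all open halfplanes that miss
    \<open>K\<close>, and by Lindeloef countably many of them suffice. Nonzero normals are recorded
    because \<open>dmv_halfspace_le\<close> treats proper halfplanes.\<close>
  define \<F> where "\<F> = {{x. a \<bullet> x > b} | a b. a \<noteq> (0::real^2) \<and> K \<subseteq> {x. a \<bullet> x \<le> b}}"
  have "\<And>S. S \<in> \<F> \<Longrightarrow> open S"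
    by (auto simp: \<F>_def open_halfspace_gt)
  then obtain \<G> where G: "\<G> \<subseteq> \<F>" "countable \<G>" "\<Union>\<G> = \<Union>\<F>"
    using Lindelof by metis
  have un: "\<Union>\<F> = - K"
  proof
    show "\<Union>\<F> \<subseteq> - K" by (fastforce simp: \<F>_def)
    show "- K \<subseteq> \<Union>\<F>"
    proof
      fix z assume "z \<in> - K"
      then obtain a b where ab: "a \<bullet> z < b" "\<And>x. x \<in> K \<Longrightarrow> a \<bullet> x > b"
        using separating_hyperplane_closed_point[of K z] K by (auto simp: body_closed body_convex)
      moreover obtain k where "k \<in> K" using K body_nonempty by blast
      ultimately have "a \<noteq> 0" by force
      then have "{x. (- a) \<bullet> x > - b} \<in> \<F>"
        unfolding \<F>_def using ab(2) by (fastforce intro: less_imp_le)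
      then show "z \<in> \<Union>\<F>" using ab(1) by force
    qed
  qed
  have "K \<noteq> UNIV"
    using K body_compact compact_imp_bounded not_bounded_UNIV by metis
  then have "\<G> \<noteq> {}" using un G by auto
  define g where "g = from_nat_into \<G>"
  have rg: "range g = \<G>"
    unfolding g_def using G(2) \<open>\<G> \<noteq> {}\<close> by (simp add: range_from_nat_into)
  have "\<forall>n. \<exists>a b. g n = {x. a \<bullet> x > b} \<and> a \<noteq> 0"
    using rg G(1) unfolding \<F>_def by blast
  then obtain a b where ab: "\<And>n. g n = {x. a n \<bullet> x > b n}" "\<And>n. a n \<noteq> 0"
    by metis
  have "K = - \<Union>(range g)" using un G(3) rg by auto
  also have "\<dots> = (\<Inter>n. {x. a n \<bullet> x \<le> b n})"
    by (simp add: ab(1) set_eq_iff not_less)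
  finally show thesis using that ab(2) by blast
qed

text \<open>For a fixed point \<open>x\<close> of the left side, the points \<open>k\<close> of
  \<open>K n\<close> with \<open>x - k\<close> in \<open>L n\<close> form nonempty compact sets that
  decrease with \<open>n\<close>; a common point splits \<open>x\<close> at all levels at
  once.\<close>

lemma INT_plus_decseq:
  fixes K L :: "nat \<Rightarrow> (real^2) set"
  assumes K: "\<And>n. K n \<in> K2" "decseq K" and L: "\<And>n. L n \<in> K2" "decseq L"
  shows "(\<Inter>n. K n + L n) = (\<Inter>n. K n) + (\<Inter>n. L n)"
proof
  show "(\<Inter>n. K n) + (\<Inter>n. L n) \<subseteq> (\<Inter>n. K n + L n)"
    by (auto simp: set_plus_def)
  show "(\<Inter>n. K n + L n) \<subseteq> (\<Inter>n. K n) + (\<Inter>n. L n)"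
  proof
    fix x assume x: "x \<in> (\<Inter>n. K n + L n)"
    define E where "E n = K n \<inter> (\<lambda>l. x - l) ` L n" for n
    have "\<Inter>(range E) \<noteq> {}"
    proof (rule compact_nest)
      show "compact (E n)" for n
        unfolding E_def using K(1) L(1)
        by (intro compact_Int compact_continuous_image continuous_intros) (auto simp: body_compact)
      show "E n \<noteq> {}" for n
      proof -
        obtain k l where "k \<in> K n" "l \<in> L n" "x = k + l"
          using INT_D[OF x UNIV_I, of n] by (auto simp: set_plus_def)
        then have "k \<in> E n" by (auto simp: E_def image_iff intro!: bexI[of _ l])
        then show ?thesis by blast
      qed
      show "E n \<subseteq> E m" if "m \<le> n" for m n
        unfolding E_def using decseqD[OF K(2) that] decseqD[OF L(2) that] by blast
    qed
    then obtain k where k: "\<And>n. k \<in> E n" by blast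
    have "k \<in> K n" "x - k \<in> L n" for n
      using k[of n] by (auto simp: E_def)
    then have "k \<in> (\<Inter>n. K n)" "x - k \<in> (\<Inter>n. L n)"
      by auto
    then show "x \<in> (\<Inter>n. K n) + (\<Inter>n. L n)"
      by (metis add.commute diff_add_cancel set_plus_intro)
  qed
qed

lemma area_decseq_limit:
  fixes K :: "nat \<Rightarrow> (real^2) set"
  assumes "\<And>n. K n \<in> K2" "decseq K"
  shows "(\<lambda>n. area (K n)) \<longlonglongrightarrow> area (\<Inter>n. K n)"
  unfolding area_def
proof (rule Lim_measure_decseq[OF _ assms(2)])
  show "range K \<subseteq> sets lebesgue"
    using assms(1) by (auto simp: body_lmeasurable fmeasurableD)
  show "emeasure lebesgue (K i) \<noteq> \<infinity>" for i
    using fmeasurableD2[OF body_lmeasurable[OF assms(1)]] by simp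
qed

lemma decseq_set_plus:
  "decseq K \<Longrightarrow> decseq L \<Longrightarrow> decseq (\<lambda>n. K n + L n)"
  for K L :: "nat \<Rightarrow> ('a::plus) set"
  by (simp add: decseq_def set_plus_mono2)

text \<open>All approximations in use are decreasing sequences of bodies, so continuity from above
  of Lebesgue measure, applied to \<open>K n\<close>, \<open>L n\<close> and their sums, takes the
  place of continuity in the Hausdorff metric.\<close>

lemma dmv_decseq_limit:
  fixes K L :: "nat \<Rightarrow> (real^2) set"
  assumes "\<And>n. K n \<in> K2" "decseq K" "\<And>n. L n \<in> K2" "decseq L"
  shows "(\<lambda>n. dmv (K n) (L n)) \<longlonglongrightarrow> dmv (\<Inter>n. K n) (\<Inter>n. L n)"
  unfolding dmv_def INT_plus_decseq[OF assms, symmetric]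
  using assms by (intro tendsto_diff area_decseq_limit) (auto simp: body_plus decseq_set_plus)

text \<open>Serves twice: with an arbitrary \<open>K'\<close>, to pass from \<open>K'\<close> to
  \<open>K\<close> by cuts each of which can only lower the mixed area, and with a box as
  \<open>K'\<close>, to approximate \<open>K\<close> from outside by polytopes.\<close>

lemma body_halfspace_seq:
  assumes K: "K \<in> K2" and K': "K' \<in> K2" and sub: "K \<subseteq> K'"
  obtains P a b where "P 0 = K'" "\<And>n::nat. P (Suc n) = P n \<inter> {x. a n \<bullet> x \<le> b n}"
    "\<And>n. a n \<noteq> 0" "\<And>n. P n \<in> K2" "decseq P" "(\<Inter>n. P n) = K"
proof -
  obtain a b where ab: "\<And>n::nat. a n \<noteq> 0" "K = (\<Inter>n. {x. a n \<bullet> x \<le> b n})"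
    by (rule body_eq_INT_halfspaces[OF K]) (rule that)
  define P where "P n = K' \<inter> (\<Inter>i<n. {x. a i \<bullet> x \<le> b i})" for n
  have Kab: "a i \<bullet> x \<le> b i" if "x \<in> K" for x i
    using that by (subst (asm) ab(2)) simp
  have KP: "K \<subseteq> P n" for n
    unfolding P_def using sub Kab by auto
  have P: "P n \<in> K2" for n
    unfolding P_def
  proof (rule body_Int_closed[OF K'])
    show "K' \<inter> (\<Inter>i<n. {x. a i \<bullet> x \<le> b i}) \<noteq> {}"
      using KP[of n] body_nonempty[OF K] unfolding P_def by blast
  qed (intro closed_INT convex_INT ballI closed_halfspace_le convex_halfspace_le)+
  have PS: "P (Suc n) = P n \<inter> {x. a n \<bullet> x \<le> b n}" for n
    by (auto simp: P_def lessThan_Suc)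
  have "decseq P" by (rule decseq_SucI) (auto simp: PS)
  moreover have "(\<Inter>n. P n) = K"
  proof
    show "K \<subseteq> (\<Inter>n. P n)" using KP by auto
    show "(\<Inter>n. P n) \<subseteq> K"
    proof
      fix x assume x: "x \<in> (\<Inter>n. P n)"
      have "a n \<bullet> x \<le> b n" for n
        using INT_D[OF x UNIV_I, of "Suc n"] by (simp add: PS)
      then show "x \<in> K" unfolding ab(2) by simp
    qed
  qed
  moreover have "P 0 = K'" by (simp add: P_def)
  ultimately show thesis using that PS ab(1) P by blast
qed

lemma dmv_mono_left:
  assumes K: "K \<in> K2" and K': "K' \<in> K2" and sub: "K \<subseteq> K'" and L: "L \<in> K2"
  shows "dmv K L \<le> dmv K' L"
proof -
  obtain P a b where P0: "P 0 = K'" and PS: "\<And>n::nat. P (Suc n) = P n \<inter> {x. a n \<bullet> x \<le> b n}"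
    and a: "\<And>n. a n \<noteq> 0" and P: "\<And>n. P n \<in> K2" "decseq P" "(\<Inter>n. P n) = K"
    by (rule body_halfspace_seq[OF K K' sub]) (rule that)
  have step: "dmv (P n) L \<le> dmv K' L" for n
  proof (induction n)
    case 0
    show ?case by (simp add: P0)
  next
    case (Suc n)
    have "P (Suc n) \<noteq> {}" by (rule body_nonempty[OF P(1)])
    then show ?case
      using dmv_halfspace_le[OF P(1)[of n] L a[of n], of "b n"] Suc by (simp add: PS)
  qed
  have "(\<lambda>n. dmv (P n) L) \<longlonglongrightarrow> dmv (\<Inter>n. P n) (\<Inter>n::nat. L)"
    by (intro dmv_decseq_limit P L) (simp_all add: decseq_def)
  then have "(\<lambda>n. dmv (P n) L) \<longlonglongrightarrow> dmv K L"
    by (simp add: P(3))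
  then show ?thesis
    by (rule LIMSEQ_le_const2) (use step in blast)
qed

lemma dmv_mono:
  assumes "K \<in> K2" "K' \<in> K2" "L \<in> K2" "L' \<in> K2" "K \<subseteq> K'" "L \<subseteq> L'"
  shows "dmv K L \<le> dmv K' L'"
proof -
  have "dmv K L \<le> dmv K' L"
    using assms by (intro dmv_mono_left)
  also have "\<dots> = dmv L K'"
    by (rule dmv_commute)
  also have "\<dots> \<le> dmv L' K'"
    using assms by (intro dmv_mono_left)
  also have "\<dots> = dmv K' L'"
    by (rule dmv_commute)
  finally show ?thesis .
qed

lemma dmv_nonneg:
  assumes "K \<in> K2" "L \<in> K2"
  shows "0 \<le> dmv K L"
proof -
  obtain k where "k \<in> K" using assms body_nonempty by blast
  then show ?thesis using dmv_mono_left[of "{k}" K L] assms by simp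
qed

section \<open>Mixed area with a segment\<close>

abbreviation pt :: "real \<Rightarrow> real \<Rightarrow> real^2" where
  "pt a b \<equiv> vector [a, b]"

lemma vec2_eq_iff: "(x::real^2) = y \<longleftrightarrow> x$1 = y$1 \<and> x$2 = y$2"
  by (simp add: vec_eq_iff forall_2)

text \<open>The determinant of \<open>u\<close> and \<open>v\<close>. Its sign tells the side of a
  line; as the inner product with the quarter turn of \<open>u\<close> it makes lines in direction
  \<open>u\<close> level sets for the halfplane lemmas.\<close>

definition cr :: "real^2 \<Rightarrow> real^2 \<Rightarrow> real" where
  "cr u v = u$1 * v$2 - u$2 * v$1"

lemma cr_simps [simp]:
  "cr u (v + w) = cr u v + cr u w" "cr (u + v) w = cr u w + cr v w"
  "cr u (v - w) = cr u v - cr u w" "cr (u - v) w = cr u w - cr v w"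
  "cr (r *\<^sub>R u) v = r * cr u v" "cr u (r *\<^sub>R v) = r * cr u v"
  "cr u u = 0" "cr 0 v = 0" "cr u 0 = 0" "cr (- u) v = - cr u v" "cr u (- v) = - cr u v"
  by (auto simp: cr_def algebra_simps)

lemma cr_skew: "cr u v = - cr v u"
  by (simp add: cr_def)

lemma inner_pt: "x \<bullet> pt a b = x$1 * a + x$2 * b" "pt a b \<bullet> x = a * x$1 + b * x$2"
  by (simp_all add: inner_vec_def sum_2)

lemma cr_eq_inner: "cr u v = pt (- (u$2)) (u$1) \<bullet> v"
  by (simp add: cr_def inner_pt)

lemma rotate_eq_0_iff: "pt (- (u$2)) (u$1) = 0 \<longleftrightarrow> u = 0" for u :: "real^2"
  by (auto simp: vec2_eq_iff)

lemma cr_basis: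
  assumes "cr d e \<noteq> 0"
  shows "x = (cr x e / cr d e) *\<^sub>R d + (cr d x / cr d e) *\<^sub>R e"
proof -
  have "cr d e * x$i = cr x e * d$i + cr d x * e$i" for i
    using exhaust_2[of i] by (auto simp: cr_def algebra_simps)
  then show ?thesis
    using assms by (simp add: vec_eq_iff field_simps)
qed

lemma body_attains_inner_max:
  assumes "K \<in> K2"
  obtains p where "p \<in> K" "\<And>x. x \<in> K \<Longrightarrow> n \<bullet> x \<le> n \<bullet> p"
  using continuous_attains_sup[of K "\<lambda>x. n \<bullet> x"] body_compact[OF assms] body_nonempty[OF assms]
  by (auto simp: continuous_on_inner)

lemma body_attains_inner_min:
  assumes "K \<in> K2"
  obtains p where "p \<in> K" "\<And>x. x \<in> K \<Longrightarrow> n \<bullet> p \<le> n \<bullet> x"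
  using body_attains_inner_max[OF assms, of "- n"] by auto

lemma segment_eq_translate: "closed_segment a b = {a} + closed_segment 0 (b - a)"
  by (simp add: singleton_plus flip: closed_segment_translation)

lemma area_cr_const:
  assumes "d \<noteq> 0" "\<And>x. x \<in> K \<Longrightarrow> cr d x = c"
  shows "area K = 0"
  by (rule area_hyperplane[of "pt (- (d$2)) (d$1)" _ c])
     (use assms in \<open>auto simp: rotate_eq_0_iff cr_eq_inner\<close>)

lemma in_segment_alt: "x \<in> closed_segment a b \<longleftrightarrow> (\<exists>u. 0 \<le> u \<and> u \<le> 1 \<and> x = a + u *\<^sub>R (b - a))"
  by (auto simp: in_segment algebra_simps)

lemma area_segment [simp]: "area (closed_segment a b) = 0"
proof (cases "a = b")
  case False
  then show ?thesis
    by (intro area_cr_const[of "b - a" _ "cr (b - a) a"])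
       (auto simp: in_segment_alt cr_skew[of b a])
qed simp

lemma linear_coords: "linear (\<lambda>x::real^2. x$1 *\<^sub>R d + x$2 *\<^sub>R e)"
  by (intro linearI) (auto simp: algebra_simps)

lemma det_coords: "det (matrix (\<lambda>x::real^2. x$1 *\<^sub>R d + x$2 *\<^sub>R e)) = cr d e"
  for d e :: "real^2"
  by (simp add: det_2 matrix_def axis_def cr_def)

lemma segment_0_eq: "closed_segment 0 d = {u *\<^sub>R d | u. 0 \<le> u \<and> u \<le> 1}"
  by (auto simp: in_segment)

lemma in_cbox_pt: "x \<in> cbox (pt a b) (pt c d) \<longleftrightarrow> a \<le> x$1 \<and> x$1 \<le> c \<and> b \<le> x$2 \<and> x$2 \<le> d"
  by (auto simp: mem_box_cart forall_2)

lemma parallelogram_eq_image: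
  "closed_segment 0 d + closed_segment 0 e = (\<lambda>x::real^2. x$1 *\<^sub>R d + x$2 *\<^sub>R e) ` cbox (pt 0 0) (pt 1 1)"
  for d e :: "real^2"
proof
  show "closed_segment 0 d + closed_segment 0 e \<subseteq> (\<lambda>x::real^2. x$1 *\<^sub>R d + x$2 *\<^sub>R e) ` cbox (pt 0 0) (pt 1 1)"
  proof
    fix z assume "z \<in> closed_segment 0 d + closed_segment 0 e"
    then obtain u v where "0 \<le> u" "u \<le> 1" "0 \<le> v" "v \<le> 1" "z = u *\<^sub>R d + v *\<^sub>R e"
      by (auto simp: segment_0_eq set_plus_def)
    then show "z \<in> (\<lambda>x::real^2. x$1 *\<^sub>R d + x$2 *\<^sub>R e) ` cbox (pt 0 0) (pt 1 1)"
      by (intro image_eqI[of _ _ "pt u v"]) (auto simp: in_cbox_pt)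
  qed
  show "(\<lambda>x::real^2. x$1 *\<^sub>R d + x$2 *\<^sub>R e) ` cbox (pt 0 0) (pt 1 1) \<subseteq> closed_segment 0 d + closed_segment 0 e"
    by (auto simp: segment_0_eq in_cbox_pt intro!: set_plus_intro)
qed

lemma area_parallelogram: "area (closed_segment 0 d + closed_segment 0 e) = \<bar>cr d e\<bar>"
proof -
  have "area (cbox (pt 0 0) (pt 1 1)) = 1"
    by (simp add: area_def content_cbox_cart interval_ne_empty_cart prod_2 UNIV_2 forall_2
        content_cbox_if_cart in_cbox_pt)
  then show ?thesis
    by (simp add: parallelogram_eq_image area_linear_image linear_coords det_coords)
qed

lemma dmv_segments: "dmv (closed_segment 0 d) (closed_segment q p) = \<bar>cr d (p - q)\<bar>"
proof -
  have "dmv (closed_segment 0 d) ({q} + closed_segment 0 (p - q)) = \<bar>cr d (p - q)\<bar>"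
    unfolding dmv_translate_right by (simp add: dmv_def area_parallelogram del: cr_simps)
  then show ?thesis by (simp only: flip: segment_eq_translate)
qed

lemma segment_0_minus: "{d} + closed_segment 0 (- d) = closed_segment 0 d"
  by (metis add.right_neutral closed_segment_commute diff_0 segment_eq_translate)

lemma dmv_segment_minus: "dmv (closed_segment 0 (- d)) K = dmv (closed_segment 0 d) K"
  using dmv_translate_left[of d "closed_segment 0 (- d)" K] by (simp only: segment_0_minus)

text \<open>Sweep \<open>K\<close> along \<open>d\<close>, away from the chord. A point
  \<open>x + t d\<close> with \<open>x = y + u d\<close> is still in the parallelogram over the
  chord if \<open>t + u \<le> 1\<close>; otherwise it already belongs to the end position
  \<open>d + K\<close>. So the sweep adds at most the area of the parallelogram, and monotonicity
  gives the other inequality.\<close>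

lemma dmv_segment_one_sided:
  assumes K: "K \<in> K2" and qp: "closed_segment q p \<subseteq> K"
    and side: "\<And>x. x \<in> K \<Longrightarrow> \<exists>y\<in>closed_segment q p. \<exists>u\<ge>0. x = y + u *\<^sub>R d"
  shows "dmv (closed_segment 0 d) K = dmv (closed_segment 0 d) (closed_segment q p)"
proof (rule antisym)
  show "dmv (closed_segment 0 d) (closed_segment q p) \<le> dmv (closed_segment 0 d) K"
    using K qp by (intro dmv_mono) auto
  have sub: "closed_segment 0 d + K \<subseteq> (closed_segment 0 d + closed_segment q p) \<union> ({d} + K)"
  proof
    fix z assume "z \<in> closed_segment 0 d + K"
    then obtain t x where t: "0 \<le> t" "t \<le> 1" and x: "x \<in> K" "z = t *\<^sub>R d + x"
      by (auto simp: segment_0_eq set_plus_def)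
    obtain y u where y: "y \<in> closed_segment q p" and u: "u \<ge> 0" "x = y + u *\<^sub>R d"
      using side[OF x(1)] by blast
    show "z \<in> (closed_segment 0 d + closed_segment q p) \<union> ({d} + K)"
    proof (cases "t + u \<le> 1")
      case True
      have "z = (t + u) *\<^sub>R d + y" by (simp add: x u algebra_simps)
      moreover have "(t + u) *\<^sub>R d \<in> closed_segment 0 d"
        using True t u by (auto simp: segment_0_eq)
      ultimately show ?thesis using y by blast
    next
      case False
      \<comment> \<open>\<open>z - d\<close> is \<open>y + (t + u - 1) d\<close>, a point between
        \<open>y\<close> and \<open>x\<close>; \<open>w\<close> is its position on that segment, at
        most 1 because \<open>t \<le> 1\<close>.\<close>
      define w where "w = (t + u - 1) / u"
      have w: "0 \<le> w" "w \<le> 1" and "u > 0" using False t u by (auto simp: w_def field_simps)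
      have "(1 - w) *\<^sub>R y + w *\<^sub>R x \<in> K"
        using w body_convex[OF K] qp y x(1) by (intro convexD) auto
      moreover have "(1 - w) *\<^sub>R y + w *\<^sub>R x = y + (w * u) *\<^sub>R d"
        by (simp add: u algebra_simps)
      moreover have "w * u = t + u - 1" using \<open>u > 0\<close> by (simp add: w_def)
      moreover have "z = d + (y + (t + u - 1) *\<^sub>R d)"
        by (simp add: x u algebra_simps)
      ultimately show ?thesis by (auto simp: set_plus_def)
    qed
  qed
  have "area (closed_segment 0 d + K) \<le> area ((closed_segment 0 d + closed_segment q p) \<union> ({d} + K))"
    using K by (intro area_mono[OF sub] fmeasurable.Un body_lmeasurable body_plus) auto
  also have "\<dots> \<le> area (closed_segment 0 d + closed_segment q p) + area ({d} + K)"
    unfolding area_def using K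
    by (intro measure_Un_le fmeasurableD body_lmeasurable body_plus) auto
  finally show "dmv (closed_segment 0 d) K \<le> dmv (closed_segment 0 d) (closed_segment q p)"
    by (simp add: dmv_def)
qed

text \<open>Cut \<open>K\<close> along the chord between the two points where the lines parallel to \<open>d\<close> support it.\<close>
lemma dmv_segment_width:
  assumes K: "K \<in> K2" and p: "p \<in> K" and q: "q \<in> K"
    and max: "\<And>x. x \<in> K \<Longrightarrow> cr d x \<le> cr d p" and min: "\<And>x. x \<in> K \<Longrightarrow> cr d q \<le> cr d x"
  shows "dmv (closed_segment 0 d) K = cr d p - cr d q"
proof (cases "cr d p = cr d q")
  case True
  have "dmv (closed_segment 0 d) K = 0"
  proof (cases "d = 0")
    case False
    have "area (closed_segment 0 d + K) = 0"
    proof (rule area_cr_const[OF False])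
      fix x assume "x \<in> closed_segment 0 d + K"
      then obtain u y where "x = u *\<^sub>R d + y" "y \<in> K"
        by (auto simp: segment_0_eq set_plus_def)
      then show "cr d x = cr d p"
        using max[of y] min[of y] True by simp
    qed
    moreover have "area K = 0"
      using max min True by (intro area_cr_const[OF False, of _ "cr d p"]) force
    ultimately show ?thesis by (simp add: dmv_def)
  qed simp
  then show ?thesis using True by simp
next
  case False
  define e where "e = p - q"
  have de: "cr d e > 0" using False max[OF q] by (simp add: e_def)
  have seg: "closed_segment q p \<subseteq> K"
    using K p q by (simp add: body_convex closed_segment_subset)
  have seg_eq: "closed_segment q p = {q + t *\<^sub>R e | t. 0 \<le> t \<and> t \<le> 1}"
    by (auto simp: in_segment e_def algebra_simps)
  \<comment> \<open>Coordinates of \<open>x - q\<close> in the basis \<open>e\<close>,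
    \<open>d\<close>: the support lines confine the first to [0, 1], and the sign of the second
    tells the side of the chord.\<close>
  have rep: "\<exists>t u. x = (q + t *\<^sub>R e) + u *\<^sub>R d \<and> 0 \<le> t \<and> t \<le> 1 \<and> u = - cr e (x - q) / cr d e"
    if x: "x \<in> K" for x
  proof (intro exI conjI)
    show "x = (q + (cr d (x - q) / cr d e) *\<^sub>R e) + (- cr e (x - q) / cr d e) *\<^sub>R d"
      using cr_basis[of d e "x - q"] less_imp_neq[OF de] by (simp add: cr_skew[of "x - q" e] del: cr_simps) (simp add: algebra_simps)
    show "0 \<le> cr d (x - q) / cr d e" "cr d (x - q) / cr d e \<le> 1"
      using de min[OF x] max[OF x] by (auto simp: e_def)
  qed simp
  define n where "n = pt (- (e$2)) (e$1)"
  define c where "c = cr e q"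
  have n: "n \<bullet> x = cr e x" for x by (simp add: n_def cr_eq_inner)
  have pq: "p \<in> K \<inter> {x. n \<bullet> x \<le> c}" "p \<in> K \<inter> {x. n \<bullet> x \<ge> c}"
    using p by (auto simp: n c_def e_def cr_skew[of q p])
  have mid: "K \<inter> {x. n \<bullet> x = c} = closed_segment q p"
  proof
    show "closed_segment q p \<subseteq> K \<inter> {x. n \<bullet> x = c}"
      using seg by (auto simp: seg_eq n c_def)
    show "K \<inter> {x. n \<bullet> x = c} \<subseteq> closed_segment q p"
    proof
      fix x assume "x \<in> K \<inter> {x. n \<bullet> x = c}"
      then show "x \<in> closed_segment q p"
        using rep[of x] by (auto simp: seg_eq n c_def)
    qed
  qed
  have bodies: "K \<inter> {x. n \<bullet> x \<le> c} \<in> K2" "K \<inter> {x. n \<bullet> x \<ge> c} \<in> K2"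
    using pq K by (auto intro!: body_Int_closed simp: closed_halfspace_le closed_halfspace_ge
        convex_halfspace_le convex_halfspace_ge)
  have 1: "dmv (closed_segment 0 d) (K \<inter> {x. n \<bullet> x \<le> c}) = dmv (closed_segment 0 d) (closed_segment q p)"
  proof (rule dmv_segment_one_sided[OF bodies(1)])
    show "closed_segment q p \<subseteq> K \<inter> {x. n \<bullet> x \<le> c}" using mid by auto
    fix x assume "x \<in> K \<inter> {x. n \<bullet> x \<le> c}"
    then have "x \<in> K" "- cr e (x - q) / cr d e \<ge> 0"
      using de by (auto simp: n c_def)
    then obtain t u where "x = (q + t *\<^sub>R e) + u *\<^sub>R d" "0 \<le> t" "t \<le> 1" "u \<ge> 0"
      using rep[of x] by metis
    then have "q + t *\<^sub>R e \<in> closed_segment q p \<and> u \<ge> 0 \<and> x = (q + t *\<^sub>R e) + u *\<^sub>R d"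
      by (auto simp: seg_eq)
    then show "\<exists>y\<in>closed_segment q p. \<exists>u\<ge>0. x = y + u *\<^sub>R d"
      by blast
  qed
  \<comment> \<open>The other half lies behind the chord, so it is swept along \<open>- d\<close>;
    reversing a segment only translates it.\<close>
  have 2: "dmv (closed_segment 0 (- d)) (K \<inter> {x. n \<bullet> x \<ge> c}) = dmv (closed_segment 0 (- d)) (closed_segment q p)"
  proof (rule dmv_segment_one_sided[OF bodies(2)])
    show "closed_segment q p \<subseteq> K \<inter> {x. n \<bullet> x \<ge> c}" using mid by auto
    fix x assume "x \<in> K \<inter> {x. n \<bullet> x \<ge> c}"
    then have x: "x \<in> K" "- cr e (x - q) / cr d e \<le> 0"
      using de by (auto simp: n c_def divide_le_0_iff)
    then obtain t u where "x = (q + t *\<^sub>R e) + u *\<^sub>R d" "0 \<le> t" "t \<le> 1" "u \<le> 0"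
      using rep[of x] by metis
    then have "q + t *\<^sub>R e \<in> closed_segment q p \<and> - u \<ge> 0 \<and> x = (q + t *\<^sub>R e) + (- u) *\<^sub>R (- d)"
      by (auto simp: seg_eq)
    then show "\<exists>y\<in>closed_segment q p. \<exists>u\<ge>0. x = y + u *\<^sub>R - d"
      by blast
  qed
  have "dmv K (closed_segment 0 d) = dmv (closed_segment q p) (closed_segment 0 d)"
    using dmv_cut[OF K body_segment[of 0 d], of n c] pq 1 2
    by (auto simp: mid dmv_segment_minus dmv_commute[of _ "closed_segment 0 d"])
  then have "dmv (closed_segment 0 d) K = \<bar>cr d (p - q)\<bar>"
    by (metis dmv_commute dmv_segments)
  then show ?thesis using de by (simp add: e_def)
qed

lemma dmv_segment_plus:
  assumes K: "K \<in> K2" and L: "L \<in> K2"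
  shows "dmv (closed_segment 0 d) (K + L) = dmv (closed_segment 0 d) K + dmv (closed_segment 0 d) L"
proof -
  define n where "n = pt (- (d$2)) (d$1)"
  have n: "n \<bullet> x = cr d x" for x by (simp add: n_def cr_eq_inner)
  obtain p where p: "p \<in> K" "\<And>x. x \<in> K \<Longrightarrow> cr d x \<le> cr d p"
    using body_attains_inner_max[OF K, of n] unfolding n by blast
  obtain q where q: "q \<in> K" "\<And>x. x \<in> K \<Longrightarrow> cr d q \<le> cr d x"
    using body_attains_inner_min[OF K, of n] unfolding n by blast
  obtain p' where p': "p' \<in> L" "\<And>x. x \<in> L \<Longrightarrow> cr d x \<le> cr d p'"
    using body_attains_inner_max[OF L, of n] unfolding n by blast
  obtain q' where q': "q' \<in> L" "\<And>x. x \<in> L \<Longrightarrow> cr d q' \<le> cr d x"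
    using body_attains_inner_min[OF L, of n] unfolding n by blast
  have "dmv (closed_segment 0 d) (K + L) = cr d (p + p') - cr d (q + q')"
  proof (rule dmv_segment_width)
    fix x assume "x \<in> K + L"
    then obtain y z where "x = y + z" "y \<in> K" "z \<in> L" by (auto simp: set_plus_def)
    then show "cr d x \<le> cr d (p + p')" "cr d (q + q') \<le> cr d x"
      using p(2) p'(2) q(2) q'(2) by (auto intro: add_mono)
  qed (use p q p' q' K L in \<open>auto intro: body_plus\<close>)
  moreover have "dmv (closed_segment 0 d) K = cr d p - cr d q"
    by (rule dmv_segment_width[OF K p(1) q(1) p(2) q(2)])
  moreover have "dmv (closed_segment 0 d) L = cr d p' - cr d q'"
    by (rule dmv_segment_width[OF L p'(1) q'(1) p'(2) q'(2)])
  ultimately show ?thesis by simp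
qed

section \<open>Bilinearity\<close>

text \<open>
  The defect of additivity is the third difference of the area, hence symmetric in its three
  arguments, and it is a valuation in each of them that vanishes on segments and parallelograms.
\<close>
definition tdiff :: "(real^2) set \<Rightarrow> (real^2) set \<Rightarrow> (real^2) set \<Rightarrow> real" where
  "tdiff K L M = dmv K (L + M) - dmv K L - dmv K M"

lemma tdiff_swap: "tdiff K L M = tdiff L K M"
proof -
  have "K + (L + M) = L + (K + M)" "K + L = L + K" by (simp_all add: ac_simps)
  then show ?thesis by (simp add: tdiff_def dmv_def)
qed

lemma tdiff_rotate: "tdiff K L M = tdiff L M K"
  by (subst tdiff_swap) (simp add: tdiff_def add.commute)

lemma tdiff_translate [simp]: "tdiff ({a} + K) L M = tdiff K L M"
  by (simp add: tdiff_def)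

lemma tdiff_segment: "L \<in> K2 \<Longrightarrow> M \<in> K2 \<Longrightarrow> tdiff (closed_segment a b) L M = 0"
  by (subst segment_eq_translate) (simp add: tdiff_def dmv_segment_plus)

lemma tdiff_parallelogram:
  assumes "L \<in> K2" "M \<in> K2"
  shows "tdiff (closed_segment 0 d + closed_segment 0 e) L M = 0"
proof -
  \<comment> \<open>Regrouped by associativity, this is additivity of the width across
    \<open>d\<close> for the bodies \<open>closed_segment 0 e\<close> and \<open>N\<close>.\<close>
  have "dmv (closed_segment 0 d + closed_segment 0 e) N
      = dmv (closed_segment 0 d) N + dmv (closed_segment 0 e) N" if "N \<in> K2" for N
    using dmv_segment_plus[OF body_segment that, of d 0 e] by (simp add: dmv_def add.assoc)
  then show ?thesis
    using assms by (simp add: tdiff_def dmv_segment_plus body_plus)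
qed

lemma tdiff_cut:
  assumes "K \<in> K2" "L \<in> K2" "M \<in> K2"
    and "K \<inter> {x. n \<bullet> x \<le> c} \<noteq> {}" "K \<inter> {x. n \<bullet> x \<ge> c} \<noteq> {}"
  shows "tdiff K L M + tdiff (K \<inter> {x. n \<bullet> x = c}) L M
       = tdiff (K \<inter> {x. n \<bullet> x \<le> c}) L M + tdiff (K \<inter> {x. n \<bullet> x \<ge> c}) L M"
  using dmv_cut[OF assms(1) _ assms(4,5)] assms(2,3) unfolding tdiff_def
  by (smt (verit) body_plus)

lemma tdiff_linear_image:
  assumes "linear f" "K \<in> K2" "L \<in> K2" "M \<in> K2"
  shows "tdiff (f ` K) (f ` L) (f ` M) = \<bar>det (matrix f)\<bar> * tdiff K L M"
  using assms
  by (simp add: tdiff_def dmv_linear_image body_plus right_diff_distrib flip: linear_image_plus)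

lemma det_scaleR: "det (matrix ((*\<^sub>R) r :: real^2 \<Rightarrow> real^2)) = r\<^sup>2"
  by (simp add: det_2 matrix_def axis_def power2_eq_square)

definition tri :: "(real^2) set" where
  "tri = convex hull {pt 0 0, pt 1 0, pt 0 1}"

lemma tri_eq: "tri = {x. 0 \<le> x$1 \<and> 0 \<le> x$2 \<and> x$1 + x$2 \<le> 1}"
  unfolding tri_def convex_hull_3_alt
proof safe
  fix x :: "real^2" assume "0 \<le> x$1" "0 \<le> x$2" "x$1 + x$2 \<le> 1"
  then show "\<exists>u v. x = pt 0 0 + u *\<^sub>R (pt 1 0 - pt 0 0) + v *\<^sub>R (pt 0 1 - pt 0 0) \<and> 0 \<le> u \<and> 0 \<le> v \<and> u + v \<le> 1"
    by (intro exI[of _ "x$1"] exI[of _ "x$2"]) (simp add: vec2_eq_iff)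
qed auto

lemma tri_body [simp]: "tri \<in> K2"
  unfolding tri_def by (rule body_hull) auto

lemma half_tri_translate:
  "{pt a b} + (*\<^sub>R) (1/2) ` tri = {x. a \<le> x$1 \<and> b \<le> x$2 \<and> x$1 + x$2 \<le> 1/2 + a + b}"
proof -
  have *: "x \<in> {pt a b} + (*\<^sub>R) (1/2) ` tri \<longleftrightarrow> 2 *\<^sub>R (x - pt a b) \<in> tri" for x
  proof
    assume "2 *\<^sub>R (x - pt a b) \<in> tri"
    then have "(1/2) *\<^sub>R (2 *\<^sub>R (x - pt a b)) \<in> (*\<^sub>R) (1/2) ` tri" by blast
    then have "pt a b + (x - pt a b) \<in> {pt a b} + (*\<^sub>R) (1/2) ` tri"
      by (intro set_plus_intro) auto
    then show "x \<in> {pt a b} + (*\<^sub>R) (1/2) ` tri" by simp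
  qed (auto simp: set_plus_def)
  show ?thesis
    by (rule set_eqI) (unfold *, auto simp: tri_eq)
qed

text \<open>The lines where the first, then the second coordinate is 1/2 cut \<open>tri\<close> into
  two translates of its half and a square. On the square and on the cuts, which are segments,
  \<open>tdiff\<close> vanishes.\<close>

lemma tdiff_tri_half:
  assumes L: "L \<in> K2" and M: "M \<in> K2"
  shows "tdiff tri L M = 2 * tdiff ((*\<^sub>R) (1/2) ` tri) L M"
proof -
  let ?H = "(*\<^sub>R) (1/2) ` tri"
  define R where "R = tri \<inter> {x. pt 1 0 \<bullet> x \<le> 1/2}"
  have in_tri: "pt 1 0 \<in> tri" "pt 0 0 \<in> tri" "pt 0 (1/2) \<in> tri" by (auto simp: tri_eq)
  have R: "R \<in> K2"
  proof -
    have "pt 0 0 \<in> tri \<inter> {x. pt 1 0 \<bullet> x \<le> 1/2}" using in_tri(2) by (simp add: inner_pt)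
    then show ?thesis
      unfolding R_def by (intro body_Int_closed closed_halfspace_le convex_halfspace_le tri_body) blast
  qed
  have 1: "tri \<inter> {x. pt 1 0 \<bullet> x \<ge> 1/2} = {pt (1/2) 0} + ?H"
    unfolding half_tri_translate by (auto simp: tri_eq inner_pt)
  have seg: "closed_segment (pt a b) (pt c d) = {x. \<exists>u. 0 \<le> u \<and> u \<le> 1 \<and> x$1 = a + u * (c - a) \<and> x$2 = b + u * (d - b)}"
    for a b c d by (auto simp: in_segment_alt vec2_eq_iff)
  have 2: "tri \<inter> {x. pt 1 0 \<bullet> x = 1/2} = closed_segment (pt (1/2) 0) (pt (1/2) (1/2))"
    unfolding seg
  proof safe
    fix x assume "x \<in> tri" "pt 1 0 \<bullet> x = 1/2"
    then show "\<exists>u\<ge>0. u \<le> 1 \<and> x$1 = 1/2 + u * (1/2 - 1/2) \<and> x$2 = 0 + u * (1/2 - 0)"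
      by (intro exI[of _ "2 * x$2"]) (auto simp: tri_eq inner_pt)
  qed (auto simp: tri_eq inner_pt)
  have 3: "R \<inter> {x. pt 0 1 \<bullet> x \<ge> 1/2} = {pt 0 (1/2)} + ?H"
    unfolding half_tri_translate by (auto simp: tri_eq inner_pt R_def)
  have 4: "R \<inter> {x. pt 0 1 \<bullet> x = 1/2} = closed_segment (pt 0 (1/2)) (pt (1/2) (1/2))"
    unfolding seg
  proof safe
    fix x assume "x \<in> R" "pt 0 1 \<bullet> x = 1/2"
    then show "\<exists>u\<ge>0. u \<le> 1 \<and> x$1 = 0 + u * (1/2 - 0) \<and> x$2 = 1/2 + u * (1/2 - 1/2)"
      by (intro exI[of _ "2 * x$1"]) (auto simp: tri_eq inner_pt R_def)
  qed (auto simp: tri_eq inner_pt R_def)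
  have 5: "R \<inter> {x. pt 0 1 \<bullet> x \<le> 1/2} = closed_segment 0 (pt (1/2) 0) + closed_segment 0 (pt 0 (1/2))"
    unfolding parallelogram_eq_image
  proof safe
    fix x assume "x \<in> R" "pt 0 1 \<bullet> x \<le> 1/2"
    then show "x \<in> (\<lambda>x. x$1 *\<^sub>R pt (1/2) 0 + x$2 *\<^sub>R pt 0 (1/2)) ` cbox (pt 0 0) (pt 1 1)"
      by (intro image_eqI[of _ _ "2 *\<^sub>R x"]) (auto simp: tri_eq inner_pt R_def in_cbox_pt vec2_eq_iff)
  qed (auto simp: tri_eq inner_pt R_def in_cbox_pt)
  have "tri \<inter> {x. pt 1 0 \<bullet> x \<ge> 1/2} \<noteq> {}" "tri \<inter> {x. pt 1 0 \<bullet> x \<le> 1/2} \<noteq> {}"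
    "R \<inter> {x. pt 0 1 \<bullet> x \<ge> 1/2} \<noteq> {}" "R \<inter> {x. pt 0 1 \<bullet> x \<le> 1/2} \<noteq> {}"
    using in_tri by (auto simp: inner_pt R_def)
  then have "tdiff tri L M = tdiff R L M + tdiff ?H L M" "tdiff R L M = tdiff ?H L M"
    using tdiff_cut[OF tri_body L M, of "pt 1 0" "1/2"] tdiff_cut[OF R L M, of "pt 0 1" "1/2"] L M
    by (simp_all only: 1 2 3 4 5 tdiff_translate tdiff_segment tdiff_parallelogram R_def[symmetric])
       simp_all
  then show ?thesis by simp
qed

lemma convex_hull_3_image:
  "convex hull {a, b, c} = {a} + (\<lambda>x::real^2. x$1 *\<^sub>R (b - a) + x$2 *\<^sub>R (c - a)) ` tri"
  for a b c :: "real^2"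
proof -
  have "(\<lambda>x::real^2. x$1 *\<^sub>R (b - a) + x$2 *\<^sub>R (c - a)) ` tri
      = {u *\<^sub>R (b - a) + v *\<^sub>R (c - a) | u v. 0 \<le> u \<and> 0 \<le> v \<and> u + v \<le> 1}"
  proof safe
    fix u v :: real assume "0 \<le> u" "0 \<le> v" "u + v \<le> 1"
    then show "u *\<^sub>R (b - a) + v *\<^sub>R (c - a) \<in> (\<lambda>x::real^2. x$1 *\<^sub>R (b - a) + x$2 *\<^sub>R (c - a)) ` tri"
      by (intro image_eqI[of _ _ "pt u v"]) (auto simp: tri_eq)
  next
    fix x assume "x \<in> tri"
    then show "\<exists>u v. x$1 *\<^sub>R (b - a) + x$2 *\<^sub>R (c - a) = u *\<^sub>R (b - a) + v *\<^sub>R (c - a) \<and> 0 \<le> u \<and> 0 \<le> v \<and> u + v \<le> 1"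
      unfolding tri_eq by blast
  qed
  then show ?thesis
    unfolding convex_hull_3_alt singleton_plus by (auto simp: image_iff add.assoc)
qed

lemma linear_scaleR_image_commute:
  "linear f \<Longrightarrow> (*\<^sub>R) r ` f ` K = f ` (*\<^sub>R) r ` K"
  by (simp add: image_image linear_scale)

lemma scaleR_image_plus: "(*\<^sub>R) r ` (K + L) = (*\<^sub>R) r ` K + (*\<^sub>R) r ` L"
  for K L :: "'a::real_vector set"
  by (intro linear_image_plus linear_scaleR)

lemma tdiff_triangle_half:
  assumes L: "L \<in> K2" and M: "M \<in> K2" and ne: "cr (b - a) (c - a) \<noteq> 0"
  shows "tdiff (convex hull {a, b, c}) L M = 2 * tdiff ((*\<^sub>R) (1/2) ` (convex hull {a, b, c})) L M"
proof -
  define f where "f = (\<lambda>x::real^2. x$1 *\<^sub>R (b - a) + x$2 *\<^sub>R (c - a))"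
  have f: "linear f" "det (matrix f) \<noteq> 0"
    using ne by (auto simp: f_def linear_coords det_coords)
  then have "inj f" "surj f"
    by (metis det_nz_iff_inj f, metis det_nz_iff_inj f linear_inj_imp_surj)
  then obtain g where g: "linear g" "f \<circ> g = id"
    using linear_surjective_right_inverse f(1) by blast
  have fg: "f ` g ` K = K" for K using g(2) by (metis image_comp image_id id_apply)
  have gb: "g ` L \<in> K2" "g ` M \<in> K2"
    using L M g(1) by (simp_all add: body_linear_image)
  have "tdiff (f ` tri) L M = \<bar>det (matrix f)\<bar> * tdiff tri (g ` L) (g ` M)"
    using tdiff_linear_image[OF f(1) tri_body gb] by (simp add: fg)
  also have "\<dots> = 2 * (\<bar>det (matrix f)\<bar> * tdiff ((*\<^sub>R) (1/2) ` tri) (g ` L) (g ` M))"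
    using gb by (simp add: tdiff_tri_half)
  also have "\<dots> = 2 * tdiff (f ` (*\<^sub>R) (1/2) ` tri) L M"
    using tdiff_linear_image[OF f(1) _ gb, of "(*\<^sub>R) (1/2) ` tri"]
    by (simp add: fg body_linear_image linear_scaleR)
  also have "f ` (*\<^sub>R) (1/2) ` tri = (*\<^sub>R) (1/2) ` f ` tri"
    using linear_scaleR_image_commute[OF f(1)] by simp
  finally show ?thesis
    by (simp add: convex_hull_3_image scaleR_image_plus f_def)
qed

text \<open>
  Halving all three triangles divides the value by \<open>8\<close> by the previous lemma, but by \<open>4\<close> by
  homogeneity of the area.
\<close>
lemma tdiff_triangles:
  assumes "cr (b - a) (c - a) \<noteq> 0" "cr (b' - a') (c' - a') \<noteq> 0" "cr (b'' - a'') (c'' - a'') \<noteq> 0"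
  shows "tdiff (convex hull {a, b, c}) (convex hull {a', b', c'}) (convex hull {a'', b'', c''}) = 0"
    (is "tdiff ?A ?B ?C = 0")
proof -
  let ?h = "(`) ((*\<^sub>R) (1/2 :: real)) :: (real^2) set \<Rightarrow> _"
  have [simp]: "?A \<in> K2" "?B \<in> K2" "?C \<in> K2"
    by (auto intro!: body_hull)
  have [simp]: "?h K \<in> K2" if "K \<in> K2" for K
    using that by (simp add: body_linear_image linear_scaleR)
  have "tdiff ?A ?B ?C = 2 * tdiff (?h ?A) ?B ?C"
    by (rule tdiff_triangle_half) (use assms in auto)
  also have "\<dots> = 2 * tdiff ?B ?C (?h ?A)" by (metis tdiff_rotate)
  also have "\<dots> = 4 * tdiff (?h ?B) ?C (?h ?A)"
    by (subst tdiff_triangle_half) (use assms in auto)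
  also have "\<dots> = 4 * tdiff ?C (?h ?A) (?h ?B)" by (metis tdiff_rotate)
  also have "\<dots> = 8 * tdiff (?h ?C) (?h ?A) (?h ?B)"
    by (subst tdiff_triangle_half) (use assms in auto)
  also have "\<dots> = 8 * tdiff (?h ?A) (?h ?B) (?h ?C)" by (metis tdiff_rotate)
  also have "\<dots> = 2 * tdiff ?A ?B ?C"
    by (subst tdiff_linear_image) (auto simp: linear_scaleR det_scaleR power2_eq_square)
  finally show ?thesis by simp
qed

section \<open>Cutting convex polygons along diagonals\<close>

lemma cr_eq_0_collinear:
  assumes "cr (b - a) (c - a) = 0"
  shows "a \<in> closed_segment b c \<or> b \<in> closed_segment a c \<or> c \<in> closed_segment a b"
proof (cases "a = b")
  case False
  define d where "d = b - a"
  have d: "d \<noteq> 0" using False by (simp add: d_def)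
  define e where "e = pt (- (d$2)) (d$1)"
  have de: "cr d e \<noteq> 0"
    using d by (simp add: cr_def e_def vec2_eq_iff sum_squares_eq_zero_iff del: cr_simps flip: power2_eq_square)
  define u where "u = cr (c - a) e / cr d e"
  have "c - a = u *\<^sub>R d"
    using cr_basis[OF de, of "c - a"] assms by (simp add: u_def d_def[symmetric] del: cr_simps(3,4))
  then have c: "c = a + u *\<^sub>R (b - a)" by (simp add: d_def algebra_simps)
  consider "u < 0" | "0 \<le> u" "u \<le> 1" | "u > 1" by linarith
  then show ?thesis
  proof cases
    case 1
    have "a = b + (1 / (1 - u)) *\<^sub>R (c - b)"
    proof -
      have "c - b = (1 - u) *\<^sub>R (a - b)" by (simp add: c algebra_simps)
      then show ?thesis using 1 by simp
    qed
    moreover have "0 \<le> 1 / (1 - u)" "1 / (1 - u) \<le> 1" using 1 by auto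
    ultimately show ?thesis unfolding in_segment_alt by blast
  next
    case 2
    then show ?thesis unfolding in_segment_alt using c by blast
  next
    case 3
    have "b = a + (1 / u) *\<^sub>R (c - a)" using 3 by (simp add: c)
    moreover have "0 \<le> 1 / u" "1 / u \<le> 1" using 3 by auto
    ultimately show ?thesis unfolding in_segment_alt by blast
  qed
qed simp

text \<open>Write \<open>x\<close> as a mixture of \<open>y\<close> from the hull of the lower
  points and \<open>z\<close> from that of the upper ones. The segment from \<open>x\<close> to
  \<open>z\<close> meets the cutting line in a point \<open>w\<close>, which by assumption is in the
  hull of the lower points, and \<open>x\<close> lies between \<open>y\<close> and
  \<open>w\<close>.\<close>

lemma convex_hull_Int_halfspace_le:
  fixes S :: "'a::euclidean_space set"
  assumes mid: "convex hull S \<inter> {x. n \<bullet> x = k} \<subseteq> convex hull (S \<inter> {x. n \<bullet> x \<le> k})"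
    and ne: "S \<inter> {x. n \<bullet> x \<le> k} \<noteq> {}"
  shows "convex hull S \<inter> {x. n \<bullet> x \<le> k} = convex hull (S \<inter> {x. n \<bullet> x \<le> k})"
proof
  let ?A = "S \<inter> {x. n \<bullet> x \<le> k}" and ?B = "S \<inter> {x. n \<bullet> x \<ge> k}"
  show "convex hull ?A \<subseteq> convex hull S \<inter> {x. n \<bullet> x \<le> k}"
    using hull_mono[of ?A S convex] hull_minimal[of ?A "{x. n \<bullet> x \<le> k}" convex]
    by (auto simp: convex_halfspace_le)
  show "convex hull S \<inter> {x. n \<bullet> x \<le> k} \<subseteq> convex hull ?A"
  proof (cases "?B = {}")
    case True
    then have "S = ?A" by force
    then show ?thesis by auto
  next
    case False
    have S: "?A \<union> ?B = S" by auto
    have hB: "convex hull ?B \<subseteq> {x. n \<bullet> x \<ge> k}"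
      by (rule hull_minimal) (auto simp: convex_halfspace_ge)
    show ?thesis
    proof
      fix x assume x: "x \<in> convex hull S \<inter> {x. n \<bullet> x \<le> k}"
      then have "x \<in> convex hull (?A \<union> ?B)"
        unfolding S by simp
      then have "x \<in> convex hull ((convex hull ?A) \<union> (convex hull ?B))"
        by (simp only: hull_Un_left[symmetric] hull_Un_right[symmetric])
      then obtain s t y z where st: "0 \<le> s" "0 \<le> t" "s + t = 1" and y: "y \<in> convex hull ?A"
        and z: "z \<in> convex hull ?B" and xt: "x = s *\<^sub>R y + t *\<^sub>R z"
        using convex_hull_union_two[of "convex hull ?A" "convex hull ?B"] ne False by auto
      have zS: "z \<in> convex hull S"
        using z hull_mono[of ?B S convex] by auto
      have "closed_segment x z \<inter> {x. n \<bullet> x = k} \<noteq> {}"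
        using connected_ivt_hyperplane[OF connected_segment, of x x z z n k] x z hB by auto
      then obtain w' where "w' \<in> closed_segment x z" "n \<bullet> w' = k" by blast
      then obtain r where r: "0 \<le> r" "r \<le> 1" and w: "n \<bullet> ((1 - r) *\<^sub>R x + r *\<^sub>R z) = k"
        unfolding in_segment by blast
      define w where "w = (1 - r) *\<^sub>R x + r *\<^sub>R z"
      have "w \<in> convex hull S"
        unfolding w_def using x zS r by (intro convexD) auto
      then have wA: "w \<in> convex hull ?A"
        using mid w by (auto simp: w_def)
      show "x \<in> convex hull ?A"
      proof (cases "t = 0")
        case True
        then show ?thesis using st xt y by simp
      next
        case False
        \<comment> \<open>Eliminating \<open>z\<close> from the equations for \<open>x\<close> and
          \<open>w\<close> gives \<open>x\<close> as a combination of \<open>w\<close> and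
          \<open>y\<close> with weights proportional to \<open>t\<close> and \<open>r * s\<close>;
          \<open>q\<close> is their sum.\<close>
        define q where "q = t + r * s"
        have q: "q > 0" using False st r by (simp add: q_def add_pos_nonneg)
        have "q *\<^sub>R x = t *\<^sub>R w + (r * s) *\<^sub>R y"
        proof -
          have "t *\<^sub>R w + (r * s) *\<^sub>R y = (t * (1 - r)) *\<^sub>R x + r *\<^sub>R (s *\<^sub>R y + t *\<^sub>R z)"
            by (simp add: w_def algebra_simps)
          also have "\<dots> = (t * (1 - r) + r) *\<^sub>R x"
            by (simp only: scaleR_left_distrib flip: xt)
          also have "t * (1 - r) + r = q"
            using st(3) by (simp add: q_def algebra_simps flip: distrib_left)
          finally show ?thesis by simp
        qed
        then have "(1 / q) *\<^sub>R (q *\<^sub>R x) = (t / q) *\<^sub>R w + ((r * s) / q) *\<^sub>R y"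
          by (simp add: scaleR_right_distrib)
        then have "x = (t / q) *\<^sub>R w + ((r * s) / q) *\<^sub>R y"
          using q by simp
        moreover have "t / q + (r * s) / q = 1"
          using q by (simp add: q_def flip: add_divide_distrib)
        ultimately show ?thesis
          using wA y st r q by (metis convexD convex_convex_hull divide_nonneg_pos mult_nonneg_nonneg)
      qed
    qed
  qed
qed

lemma convex_hull_Int_halfspace_ge:
  fixes S :: "'a::euclidean_space set"
  assumes "convex hull S \<inter> {x. n \<bullet> x = k} \<subseteq> convex hull (S \<inter> {x. n \<bullet> x \<ge> k})"
    and "S \<inter> {x. n \<bullet> x \<ge> k} \<noteq> {}"
  shows "convex hull S \<inter> {x. n \<bullet> x \<ge> k} = convex hull (S \<inter> {x. n \<bullet> x \<ge> k})"
  using convex_hull_Int_halfspace_le[of S "- n" "- k"] assms by simp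

lemma convex_hull_Int_line:
  fixes S :: "(real^2) set"
  assumes S: "finite S" "a \<in> S" "c \<in> S" "a \<noteq> c"
    and indep: "a \<notin> convex hull (S - {a})" "c \<notin> convex hull (S - {c})"
  shows "convex hull S \<inter> {x. cr (c - a) x = cr (c - a) a} = closed_segment a c"
proof
  have ac: "a \<in> convex hull S" "c \<in> convex hull S" using S by (auto simp: hull_inc)
  have ext: "a extreme_point_of convex hull S" "c extreme_point_of convex hull S"
    using extreme_point_of_convex_hull_insert[OF _ indep(1)] extreme_point_of_convex_hull_insert[OF _ indep(2)] S
    by (simp_all add: insert_absorb)
  show "closed_segment a c \<subseteq> convex hull S \<inter> {x. cr (c - a) x = cr (c - a) a}"
    using closed_segment_subset[OF ac] cr_skew[of c a] by (auto simp: in_segment_alt)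
  show "convex hull S \<inter> {x. cr (c - a) x = cr (c - a) a} \<subseteq> closed_segment a c"
  proof
    fix x assume x: "x \<in> convex hull S \<inter> {x. cr (c - a) x = cr (c - a) a}"
    then have "cr (c - a) (x - a) = 0" by simp
    then consider "a \<in> closed_segment c x" | "c \<in> closed_segment a x" | "x \<in> closed_segment a c"
      using cr_eq_0_collinear by blast
    then show "x \<in> closed_segment a c"
    proof cases
      case 1
      then have "a = x"
        using ext(1) ac x S(4) unfolding extreme_point_of_def open_segment_def by auto
      then show ?thesis by simp
    next
      case 2
      then have "c = x"
        using ext(2) ac x S(4) unfolding extreme_point_of_def open_segment_def by auto
      then show ?thesis by simp
    qed
  qed
qed

text \<open>
  Four points in convex position form, by Radon's theorem, two crossing diagonals; cutting the
  polygon along one of them reduces the number of vertices.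
\<close>
lemma convex_hull_valuation_zero:
  fixes f :: "(real^2) set \<Rightarrow> real"
  assumes segment: "\<And>a b. f (closed_segment a b) = 0"
    and triangle: "\<And>a b c. cr (b - a) (c - a) \<noteq> 0 \<Longrightarrow> f (convex hull {a, b, c}) = 0"
    and cut: "\<And>K n k. K \<in> K2 \<Longrightarrow> K \<inter> {x. n \<bullet> x \<le> k} \<noteq> {} \<Longrightarrow> K \<inter> {x. n \<bullet> x \<ge> k} \<noteq> {} \<Longrightarrow>
      f K + f (K \<inter> {x. n \<bullet> x = k}) = f (K \<inter> {x. n \<bullet> x \<le> k}) + f (K \<inter> {x. n \<bullet> x \<ge> k})"
    and S: "finite S" "S \<noteq> {}"
  shows "f (convex hull S) = 0"
  using S
proof (induction "card S" arbitrary: S rule: less_induct)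
  case less
  have f_single: "f {a} = 0" for a using segment[of a a] by simp
  show ?case
  proof (cases "\<exists>x\<in>S. x \<in> convex hull (S - {x})")
    case True
    then obtain x where x: "x \<in> S" "x \<in> convex hull (S - {x})" by blast
    have "convex hull S = convex hull (S - {x})"
      using hull_redundant[OF x(2)] x(1) by (simp add: insert_absorb)
    moreover have "S - {x} \<noteq> {}" using x(2) by (metis convex_hull_empty empty_iff)
    moreover have "card (S - {x}) < card S"
      using x(1) less.prems by (simp add: card_gt_0_iff)
    ultimately show ?thesis using less.hyps[of "S - {x}"] less.prems by simp
  next
    case False
    then have indep: "x \<notin> convex hull (S - {x})" if "x \<in> S" for x using that by blast
    have between: "x \<notin> closed_segment y z" if "x \<in> S" "y \<in> S" "z \<in> S" "x \<noteq> y" "x \<noteq> z" for x y z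
    proof
      assume "x \<in> closed_segment y z"
      moreover have "closed_segment y z \<subseteq> convex hull (S - {x})"
        unfolding segment_convex_hull using that by (intro hull_mono) auto
      ultimately show False using indep[OF that(1)] by blast
    qed
    have noncoll: "cr (y - x) (z - x) \<noteq> 0" if "x \<in> S" "y \<in> S" "z \<in> S" "x \<noteq> y" "x \<noteq> z" "y \<noteq> z" for x y z
      using cr_eq_0_collinear[of y x z] between[of x y z] between[of y x z] between[of z x y] that by metis
    have "card S > 0" using less.prems by (simp add: card_gt_0_iff)
    then consider "card S = 1" | "card S = 2" | "card S = 3" | "card S \<ge> 4" by linarith
    then show ?thesis
    proof cases
      case 1
      then show ?thesis by (auto simp: card_1_singleton_iff f_single)
    next
      case 2
      then show ?thesis by (auto simp: card_2_iff segment simp flip: segment_convex_hull)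
    next
      case 3
      then obtain a b c where abc: "S = {a, b, c}" "a \<noteq> b" "b \<noteq> c" "a \<noteq> c" by (auto simp: card_3_iff)
      then show ?thesis using triangle noncoll by simp
    next
      case 4
      obtain T where T: "T \<subseteq> S" "card T = 4" "finite T"
        using obtain_subset_with_card_n[OF 4] by metis
      then have "affine_dependent T" by (intro affine_dependent_biggerset) auto
      then obtain M P where MP: "M \<subseteq> T" "P \<subseteq> T" "M \<inter> P = {}" "convex hull M \<inter> convex hull P \<noteq> {}"
        by (rule Radon)
      have fin: "finite M" "finite P" using MP T by (simp_all add: finite_subset[of _ T])
      have card2: "card M \<ge> 2" if "M \<subseteq> S" "P \<subseteq> S" "M \<inter> P = {}" "convex hull M \<inter> convex hull P \<noteq> {}" "finite M" for M P
      proof (rule ccontr)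
        assume "\<not> 2 \<le> card M"
        moreover have "M \<noteq> {}" using that by auto
        ultimately have "card M = 1" using that by (metis One_nat_def Suc_1 Suc_leI card_gt_0_iff le_antisym not_less_eq_eq)
        then obtain x where "M = {x}" by (auto simp: card_1_singleton_iff)
        then show False
          using that indep[of x] hull_mono[of P "S - {x}" convex] by auto
      qed
      have "card M \<ge> 2" "card P \<ge> 2"
        using card2[of M P] card2[of P M] MP T fin by auto
      moreover have "card M + card P \<le> 4"
        using MP T fin by (metis Un_subset_iff card_Un_disjoint card_mono)
      ultimately have "card M = 2" "card P = 2" by auto
      then obtain a c b d where M: "M = {a, c}" "a \<noteq> c" and P: "P = {b, d}" "b \<noteq> d"
        by (auto simp: card_2_iff)
      have abcd: "a \<in> S" "b \<in> S" "c \<in> S" "d \<in> S" and dist: "a \<noteq> b" "a \<noteq> d" "c \<noteq> b" "c \<noteq> d"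
        using M P MP T by auto
      define n where "n = pt (- ((c - a)$2)) ((c - a)$1)"
      define k where "k = cr (c - a) a"
      have n: "n \<bullet> x = cr (c - a) x" for x unfolding n_def by (rule cr_eq_inner[symmetric])
      have nac: "n \<bullet> a = k" "n \<bullet> c = k"
        using cr_skew[of c a] by (simp_all add: n k_def)
      have mid: "convex hull S \<inter> {x. n \<bullet> x = k} = closed_segment a c"
        using convex_hull_Int_line[OF less.prems(1) abcd(1,3) M(2)] indep abcd by (simp add: n k_def del: cr_simps)
      have nb: "n \<bullet> b \<noteq> k" and nd: "n \<bullet> d \<noteq> k"
        using noncoll[of a c b] noncoll[of a c d] abcd dist M by (auto simp: n k_def)
      obtain z where z: "z \<in> closed_segment a c" "z \<in> closed_segment b d"
        using MP(4) by (auto simp: M P segment_convex_hull)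
      have nz: "n \<bullet> z = k" using z(1) mid by blast
      obtain t where t: "0 \<le> t" "t \<le> 1" "z = (1 - t) *\<^sub>R b + t *\<^sub>R d"
        using z(2) unfolding in_segment by blast
      then have bd: "(1 - t) * (n \<bullet> b - k) + t * (n \<bullet> d - k) = 0"
        using nz by (simp add: inner_add_right left_diff_distrib right_diff_distrib)
      \<comment> \<open>The crossing point is on the line through \<open>a\<close> and
        \<open>c\<close> and is a mixture of \<open>b\<close> and \<open>d\<close>, neither of which
        is on it. So each of the two halfplanes misses one of \<open>b\<close>, \<open>d\<close>,
        and both pieces have fewer vertices.\<close>
      have opp: "(n \<bullet> b < k \<and> k < n \<bullet> d) \<or> (n \<bullet> d < k \<and> k < n \<bullet> b)"
      proof (rule ccontr)
        assume "\<not> ?thesis"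
        then consider "n \<bullet> b - k > 0" "n \<bullet> d - k > 0" | "n \<bullet> b - k < 0" "n \<bullet> d - k < 0"
          using nb nd by linarith
        then show False
        proof cases
          case 1
          then have "(1 - t) * (n \<bullet> b - k) \<ge> 0" "t * (n \<bullet> d - k) \<ge> 0" using t by simp_all
          then have "(1 - t) * (n \<bullet> b - k) = 0" "t * (n \<bullet> d - k) = 0" using bd by linarith+
          then show False using 1 by auto
        next
          case 2
          then have "(1 - t) * (n \<bullet> b - k) \<le> 0" "t * (n \<bullet> d - k) \<le> 0" using t by (simp_all add: mult_nonneg_nonpos)
          then have "(1 - t) * (n \<bullet> b - k) = 0" "t * (n \<bullet> d - k) = 0" using bd by linarith+
          then show False using 2 by auto
        qed
      qed
      have seg: "closed_segment a c \<subseteq> convex hull (S \<inter> {x. n \<bullet> x \<le> k})"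
        "closed_segment a c \<subseteq> convex hull (S \<inter> {x. n \<bullet> x \<ge> k})"
        unfolding segment_convex_hull using abcd nac by (auto intro!: hull_mono)
      have ne: "S \<inter> {x. n \<bullet> x \<le> k} \<noteq> {}" "S \<inter> {x. n \<bullet> x \<ge> k} \<noteq> {}"
        using abcd nac by auto
      have le: "convex hull S \<inter> {x. n \<bullet> x \<le> k} = convex hull (S \<inter> {x. n \<bullet> x \<le> k})"
        using seg ne by (intro convex_hull_Int_halfspace_le) (auto simp: mid)
      have ge: "convex hull S \<inter> {x. n \<bullet> x \<ge> k} = convex hull (S \<inter> {x. n \<bullet> x \<ge> k})"
        using seg ne by (intro convex_hull_Int_halfspace_ge) (auto simp: mid)
      have some: "\<exists>x\<in>S. \<not> n \<bullet> x \<le> k" "\<exists>x\<in>S. \<not> n \<bullet> x \<ge> k"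
        using abcd(2,4) opp linorder_not_le by blast+
      have "S \<inter> {x. n \<bullet> x \<le> k} \<subset> S" "S \<inter> {x. n \<bullet> x \<ge> k} \<subset> S"
        using some by blast+
      then have "card (S \<inter> {x. n \<bullet> x \<le> k}) < card S" "card (S \<inter> {x. n \<bullet> x \<ge> k}) < card S"
        by (simp_all add: psubset_card_mono[OF less.prems(1)])
      then have "f (convex hull (S \<inter> {x. n \<bullet> x \<le> k})) = 0" "f (convex hull (S \<inter> {x. n \<bullet> x \<ge> k})) = 0"
        using less.prems(1) ne by (auto intro: less.hyps)
      moreover have "f (convex hull S) + f (convex hull S \<inter> {x. n \<bullet> x = k})
          = f (convex hull S \<inter> {x. n \<bullet> x \<le> k}) + f (convex hull S \<inter> {x. n \<bullet> x \<ge> k})"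
        using less.prems ne by (intro cut body_hull) (auto simp: le ge)
      ultimately show ?thesis by (simp add: le ge mid segment)
    qed
  qed
qed

lemma body_polytope_seq:
  assumes K: "K \<in> K2"
  obtains P where "\<And>n::nat. P n \<in> K2" "decseq P" "(\<Inter>n. P n) = K" "\<And>n. polytope (P n)"
proof -
  obtain c d where cd: "K \<subseteq> cbox c d"
    using bounded_subset_cbox_symmetric body_compact[OF K] compact_imp_bounded by metis
  then have "cbox c d \<in> K2" using body_nonempty[OF K] by (intro bodyI) auto
  then obtain P a b where P0: "P 0 = cbox c d" and PS: "\<And>n::nat. P (Suc n) = P n \<inter> {x. a n \<bullet> x \<le> b n}"
    and "\<And>n. a n \<noteq> 0" and P: "\<And>n. P n \<in> K2" "decseq P" "(\<Inter>n. P n) = K"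
    by (rule body_halfspace_seq[OF K _ cd]) (rule that)
  have "polytope (P n)" for n
  proof (induction n)
    case 0
    show ?case by (simp add: P0 polytope_interval)
  next
    case (Suc n)
    then show ?case by (simp add: PS polytope_Int_polyhedron polyhedron_halfspace_le)
  qed
  with P show thesis by (rule that)
qed

lemma tdiff_polytope_zero:
  assumes L: "L \<in> K2" and M: "M \<in> K2" and P: "polytope P" "P \<noteq> {}"
    and "\<And>a b c. cr (b - a) (c - a) \<noteq> 0 \<Longrightarrow> tdiff (convex hull {a, b, c}) L M = 0"
  shows "tdiff P L M = 0"
proof -
  obtain S where S: "finite S" "P = convex hull S" using P(1) by (auto simp: polytope_def)
  show ?thesis
    unfolding S(2)
  proof (rule convex_hull_valuation_zero[where f = "\<lambda>K. tdiff K L M"])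
    show "tdiff (closed_segment a b) L M = 0" for a b by (rule tdiff_segment[OF L M])
    show "tdiff K L M + tdiff (K \<inter> {x. n \<bullet> x = k}) L M
      = tdiff (K \<inter> {x. n \<bullet> x \<le> k}) L M + tdiff (K \<inter> {x. n \<bullet> x \<ge> k}) L M"
      if "K \<in> K2" "K \<inter> {x. n \<bullet> x \<le> k} \<noteq> {}" "K \<inter> {x. n \<bullet> x \<ge> k} \<noteq> {}" for K n k
      by (rule tdiff_cut[OF that(1) L M that(2,3)])
    show "S \<noteq> {}" using P(2) S(2) by auto
  qed (use assms S in auto)
qed

text \<open>Triangles give way to polytopes one argument at a time, \<open>tdiff_rotate\<close>
  bringing the next argument to the front; decreasing sequences of polytopes then yield arbitrary
  bodies in all three arguments at once.\<close>

lemma tdiff_zero: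
  assumes K: "K \<in> K2" and L: "L \<in> K2" and M: "M \<in> K2"
  shows "tdiff K L M = 0"
proof -
  have tri: "convex hull {a, b, c} \<in> K2" for a b c :: "real^2" by (rule body_hull) auto
  have poly: "P \<in> K2" if "polytope P" "P \<noteq> {}" for P
    using that by (simp add: K2_def polytope_imp_compact polytope_imp_convex)
  have 1: "tdiff P (convex hull {a, b, c}) (convex hull {a', b', c'}) = 0"
    if "polytope P" "P \<noteq> {}" "cr (b - a) (c - a) \<noteq> 0" "cr (b' - a') (c' - a') \<noteq> 0" for P a b c a' b' c'
    using that by (intro tdiff_polytope_zero[OF tri tri that(1,2)] tdiff_triangles)
  have 2: "tdiff P Q (convex hull {a, b, c}) = 0"
    if "polytope P" "P \<noteq> {}" "polytope Q" "Q \<noteq> {}" "cr (b - a) (c - a) \<noteq> 0" for P Q a b c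
  proof (rule tdiff_polytope_zero[OF poly[OF that(3,4)] tri that(1,2)])
    show "tdiff (convex hull {a', b', c'}) Q (convex hull {a, b, c}) = 0"
      if "cr (b' - a') (c' - a') \<noteq> 0" for a' b' c'
      unfolding tdiff_rotate[of _ Q] using \<open>polytope Q\<close> \<open>Q \<noteq> {}\<close> \<open>cr (b - a) (c - a) \<noteq> 0\<close> that by (rule 1)
  qed
  have 3: "tdiff P Q R = 0"
    if "polytope P" "P \<noteq> {}" "polytope Q" "Q \<noteq> {}" "polytope R" "R \<noteq> {}" for P Q R
  proof (rule tdiff_polytope_zero[OF poly[OF that(3,4)] poly[OF that(5,6)] that(1,2)])
    show "tdiff (convex hull {a, b, c}) Q R = 0" if "cr (b - a) (c - a) \<noteq> 0" for a b c
      unfolding tdiff_rotate[of _ Q] by (rule 2) fact+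
  qed
  obtain P where P: "\<And>n::nat. P n \<in> K2" "decseq P" "(\<Inter>n. P n) = K" "\<And>n. polytope (P n)"
    by (rule body_polytope_seq[OF K]) (rule that)
  obtain Q where Q: "\<And>n::nat. Q n \<in> K2" "decseq Q" "(\<Inter>n. Q n) = L" "\<And>n. polytope (Q n)"
    by (rule body_polytope_seq[OF L]) (rule that)
  obtain R where R: "\<And>n::nat. R n \<in> K2" "decseq R" "(\<Inter>n. R n) = M" "\<And>n. polytope (R n)"
    by (rule body_polytope_seq[OF M]) (rule that)
  have "(\<lambda>n. tdiff (P n) (Q n) (R n)) \<longlonglongrightarrow> dmv (\<Inter>n. P n) (\<Inter>n. Q n + R n) - dmv (\<Inter>n. P n) (\<Inter>n. Q n) - dmv (\<Inter>n. P n) (\<Inter>n. R n)"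
    unfolding tdiff_def
    by (intro tendsto_diff dmv_decseq_limit body_plus decseq_set_plus P Q R)
  then have "(\<lambda>n. tdiff (P n) (Q n) (R n)) \<longlonglongrightarrow> tdiff K L M"
    by (simp add: tdiff_def P Q R INT_plus_decseq)
  moreover have "tdiff (P n) (Q n) (R n) = 0" for n
    using P Q R body_nonempty by (intro 3) auto
  ultimately show ?thesis by (simp add: LIMSEQ_const_iff)
qed

theorem dmv_plus_right:
  "K \<in> K2 \<Longrightarrow> L \<in> K2 \<Longrightarrow> M \<in> K2 \<Longrightarrow> dmv K (L + M) = dmv K L + dmv K M"
  using tdiff_zero[of K L M] by (simp add: tdiff_def)

lemma dmv_plus_left:
  "K \<in> K2 \<Longrightarrow> L \<in> K2 \<Longrightarrow> M \<in> K2 \<Longrightarrow> dmv (L + M) K = dmv L K + dmv M K"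
  using dmv_plus_right[of K L M] by (simp add: dmv_commute)

text \<open>If \<open>k\<close> is the integer part of \<open>n * r\<close>, then
  \<open>n * f r\<close> and \<open>n * r * f 1\<close> both lie between \<open>k * f 1\<close> and
  \<open>(k + 1) * f 1\<close>. So \<open>n\<close> times the error is at most \<open>f 1\<close>
  for every \<open>n\<close>, and the error is 0.\<close>

lemma additive_nonneg_linear:
  fixes f :: "real \<Rightarrow> real"
  assumes add: "\<And>r s. 0 \<le> r \<Longrightarrow> 0 \<le> s \<Longrightarrow> f (r + s) = f r + f s"
    and nonneg: "\<And>r. 0 \<le> r \<Longrightarrow> 0 \<le> f r" and r: "0 \<le> r"
  shows "f r = r * f 1"
proof -
  have mono: "f r \<le> f s" if "0 \<le> r" "r \<le> s" for r s
    using add[of r "s - r"] nonneg[of "s - r"] that by simp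
  have nat_mult: "f (real n * s) = real n * f s" if "0 \<le> s" for n s
  proof (induction n)
    case 0
    show ?case using add[of 0 0] by simp
  next
    case (Suc n)
    then show ?case using add[of s "real n * s"] that by (simp add: algebra_simps)
  qed
  have "real n * \<bar>f r - r * f 1\<bar> \<le> f 1" for n
  proof -
    define k where "k = nat \<lfloor>real n * r\<rfloor>"
    have k: "real k \<le> real n * r" "real n * r \<le> real k + 1"
      using r by (simp_all add: k_def)
    have "real k * f 1 \<le> real n * f r"
      using mono[OF _ k(1)] nat_mult[of 1 k] nat_mult[OF r, of n] by simp
    moreover have "real n * f r \<le> (real k + 1) * f 1"
      using mono[OF _ k(2)] nat_mult[of 1 "Suc k"] nat_mult[OF r, of n] r by (simp add: add.commute)
    moreover have "real k * f 1 \<le> real n * r * f 1" "real n * r * f 1 \<le> (real k + 1) * f 1"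
      using k nonneg[of 1] by (auto intro: mult_right_mono)
    ultimately have "\<bar>real n * f r - real n * r * f 1\<bar> \<le> f 1"
      by (simp add: algebra_simps abs_le_iff)
    then show ?thesis
      by (simp add: abs_mult mult.assoc flip: right_diff_distrib)
  qed
  then have "\<not> \<bar>f r - r * f 1\<bar> > 0"
    using reals_Archimedean3 by (metis linorder_not_le)
  then show ?thesis by simp
qed

lemma body_scaleR: "K \<in> K2 \<Longrightarrow> (*\<^sub>R) r ` K \<in> K2"
  by (simp add: body_linear_image linear_scaleR)

lemma convex_scaleR_add:
  fixes K :: "'a::real_vector set"
  assumes "convex K" "0 \<le> r" "0 \<le> s"
  shows "(*\<^sub>R) (r + s) ` K = (*\<^sub>R) r ` K + (*\<^sub>R) s ` K"
proof
  show "(*\<^sub>R) (r + s) ` K \<subseteq> (*\<^sub>R) r ` K + (*\<^sub>R) s ` K"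
    by (auto simp: scaleR_left_distrib)
  show "(*\<^sub>R) r ` K + (*\<^sub>R) s ` K \<subseteq> (*\<^sub>R) (r + s) ` K"
  proof
    fix z assume "z \<in> (*\<^sub>R) r ` K + (*\<^sub>R) s ` K"
    then obtain x y where xy: "x \<in> K" "y \<in> K" "z = r *\<^sub>R x + s *\<^sub>R y"
      by (auto simp: set_plus_def)
    show "z \<in> (*\<^sub>R) (r + s) ` K"
    proof (cases "r + s = 0")
      case True
      then have "r = 0" "s = 0" using assms by auto
      then show ?thesis using xy by auto
    next
      case False
      then have "z = (r + s) *\<^sub>R ((r / (r + s)) *\<^sub>R x + (s / (r + s)) *\<^sub>R y)"
        by (simp add: xy scaleR_right_distrib)
      moreover have "(r / (r + s)) *\<^sub>R x + (s / (r + s)) *\<^sub>R y \<in> K"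
        using assms False xy by (intro convexD) (auto simp flip: add_divide_distrib)
      ultimately show ?thesis by blast
    qed
  qed
qed

lemma dmv_scaleR_left:
  assumes "K \<in> K2" "L \<in> K2" "0 \<le> r"
  shows "dmv ((*\<^sub>R) r ` K) L = r * dmv K L"
  using additive_nonneg_linear[of "\<lambda>r. dmv ((*\<^sub>R) r ` K) L" r] assms
  by (simp add: convex_scaleR_add body_convex dmv_plus_left body_scaleR dmv_nonneg)

lemma dmv_scaleR_right:
  assumes "K \<in> K2" "L \<in> K2" "0 \<le> r"
  shows "dmv K ((*\<^sub>R) r ` L) = r * dmv K L"
  using dmv_scaleR_left[OF assms(2,1,3)] by (simp add: dmv_commute)

section \<open>Bodies inscribed in the standard triangle\<close>

lemma triangle_split:
  fixes u v w :: "real^2"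
  assumes p: "p \<in> closed_segment v w"
  shows "convex hull {u, v, w} \<subseteq> convex hull {u, v, p} \<union> convex hull {u, p, w}"
proof
  fix x assume x0: "x \<in> convex hull {u, v, w}"
  then obtain \<alpha> \<beta> \<gamma> where c: "0 \<le> \<alpha>" "0 \<le> \<beta>" "0 \<le> \<gamma>" "\<alpha> + \<beta> + \<gamma> = 1"
    and x: "x = \<alpha> *\<^sub>R u + \<beta> *\<^sub>R v + \<gamma> *\<^sub>R w"
    unfolding convex_hull_3 by blast
  obtain t where t: "0 \<le> t" "t \<le> 1" and pt: "p = (1 - t) *\<^sub>R v + t *\<^sub>R w"
    using p unfolding in_segment by blast
  show "x \<in> convex hull {u, v, p} \<union> convex hull {u, p, w}"
  proof (cases "\<gamma> * (1 - t) \<le> \<beta> * t \<and> t > 0")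
    case True
    define b where "b = \<beta> - \<gamma> / t * (1 - t)"
    have "0 \<le> b" using True by (simp add: b_def field_simps)
    moreover have "\<alpha> + b + \<gamma> / t = 1"
    proof -
      have "\<gamma> / t - \<gamma> / t * (1 - t) = \<gamma>" using True by (simp add: field_simps)
      then show ?thesis using c by (simp add: b_def)
    qed
    moreover have "x = \<alpha> *\<^sub>R u + b *\<^sub>R v + (\<gamma> / t) *\<^sub>R p"
    proof -
      have "(\<gamma> / t) *\<^sub>R p = (\<gamma> / t * (1 - t)) *\<^sub>R v + \<gamma> *\<^sub>R w"
        using True by (simp add: pt scaleR_right_distrib)
      then show ?thesis by (simp add: x b_def algebra_simps)
    qed
    moreover have "0 \<le> \<gamma> / t" using c True by simp
    ultimately show ?thesis using c(1) unfolding convex_hull_3 by blast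
  next
    case False
    then have lt: "\<beta> * t \<le> \<gamma> * (1 - t)" using c t by (auto simp: not_le)
    show ?thesis
    proof (cases "t = 1")
      case True
      then have "p = w" by (simp add: pt)
      then show ?thesis using x0 by simp
    next
      case tne: False
      then have t1: "1 - t > 0" using t by simp
      define b where "b = \<gamma> - \<beta> / (1 - t) * t"
      have "0 \<le> b"
        using lt t1 by (simp add: b_def field_simps)
      moreover have "\<alpha> + \<beta> / (1 - t) + b = 1"
      proof -
        have "\<beta> / (1 - t) - \<beta> / (1 - t) * t = \<beta> / (1 - t) * (1 - t)" by (simp only: right_diff_distrib mult_1_right)
        also have "\<dots> = \<beta>" using t1 by simp
        finally show ?thesis using c by (simp add: b_def)
      qed
      moreover have "x = \<alpha> *\<^sub>R u + (\<beta> / (1 - t)) *\<^sub>R p + b *\<^sub>R w"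
      proof -
        have "(\<beta> / (1 - t)) *\<^sub>R p = \<beta> *\<^sub>R v + (\<beta> / (1 - t) * t) *\<^sub>R w"
          using t1 by (simp add: pt scaleR_right_distrib)
        then show ?thesis by (simp add: x b_def algebra_simps)
      qed
      moreover have "0 \<le> \<beta> / (1 - t)" using c t1 by simp
      ultimately show ?thesis using c(1) unfolding convex_hull_3 by blast
    qed
  qed
qed

lemma convex_hull_3_subset:
  "convex A \<Longrightarrow> x \<in> A \<Longrightarrow> y \<in> A \<Longrightarrow> z \<in> A \<Longrightarrow> convex hull {x, y, z} \<subseteq> A"
  by (rule hull_minimal) auto

text \<open>Cut \<open>tri\<close> along the segment from the vertex (0, 1) to
  \<open>pt a 0\<close>. Each half splits at its marked point on the outer side into a corner
  triangle and a triangle that is divided once more where the cut crosses the chord from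
  \<open>pt 0 (1 - c)\<close> to \<open>pt (1 - b) b\<close>. Marked points may coincide with
  vertices.\<close>

lemma tri_cover:
  assumes a: "0 \<le> a" "a \<le> 1" and b: "0 \<le> b" "b \<le> 1" and c: "0 \<le> c" "c \<le> 1"
  shows "tri \<subseteq> convex hull {pt a 0, pt (1 - b) b, pt 0 (1 - c)}
    \<union> convex hull {pt 0 0, pt a 0, pt 0 (1 - c)}
    \<union> convex hull {pt 1 0, pt (1 - b) b, pt a 0}
    \<union> convex hull {pt 0 1, pt 0 (1 - c), pt (1 - b) b}" (is "_ \<subseteq> ?Q \<union> ?N1 \<union> ?N2 \<union> ?N3")
proof -
  let ?v1 = "pt 0 0" and ?v2 = "pt 1 0" and ?v3 = "pt 0 1"
  let ?p = "pt a 0" and ?q = "pt (1 - b) b" and ?r = "pt 0 (1 - c)"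
  have p: "?p \<in> closed_segment ?v1 ?v2"
    unfolding in_segment_alt using a by (intro exI[of _ a]) (auto simp: vec2_eq_iff)
  have q: "?q \<in> closed_segment ?v2 ?v3"
    unfolding in_segment_alt using b by (intro exI[of _ b]) (auto simp: vec2_eq_iff)
  have r: "?r \<in> closed_segment ?v3 ?v1"
    unfolding in_segment_alt using c by (intro exI[of _ c]) (auto simp: vec2_eq_iff)
  have "\<exists>z. z \<in> closed_segment ?v3 ?p \<and> z \<in> closed_segment ?r ?q"
  proof (cases "c = 0 \<or> b = 1")
    case True
    then show ?thesis by (intro exI[of _ ?v3]) auto
  next
    case False
    define k where "k = (1 - a) * (1 - b) + a * c"
    have cb: "c > 0" "1 - b > 0" using False b c by auto
    have k: "k > 0"
    proof (cases "a = 0")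
      case False
      then show ?thesis using a cb by (simp add: k_def add_nonneg_pos)
    qed (use cb in \<open>simp add: k_def\<close>)
    define l where "l = c * (1 - b) / k"
    define m where "m = a * c / k"
    have "c * (1 - b) \<le> k"
    proof -
      have "(1 - a) * (1 - b) * c \<le> (1 - a) * (1 - b)" "a * c * (1 - b) \<le> a * c"
        using a b c by (auto intro!: mult_left_le mult_nonneg_nonneg)
      then show ?thesis by (simp add: k_def algebra_simps)
    qed
    then have l: "0 \<le> l" "l \<le> 1" using k cb by (auto simp: l_def)
    have m: "0 \<le> m" "m \<le> 1" using k a b c by (auto simp: m_def k_def)
    have "l * a = m * (1 - b)" "1 - l = (1 - c) + m * (b - (1 - c))"
      using k by (auto simp: l_def m_def field_simps) (simp add: k_def algebra_simps)
    then have "?v3 + l *\<^sub>R (?p - ?v3) = ?r + m *\<^sub>R (?q - ?r)"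
      by (simp add: vec2_eq_iff)
    then show ?thesis unfolding in_segment_alt using l m by metis
  qed
  then obtain o' where o: "o' \<in> closed_segment ?v3 ?p" "o' \<in> closed_segment ?r ?q" by blast
  have oQ: "o' \<in> ?Q" and oN: "o' \<in> ?N3"
    using o(2) by (auto simp: segment_convex_hull intro: subsetD[OF hull_mono, rotated])
  have sub1: "convex hull {?r, ?v3, ?p} \<subseteq> ?Q \<union> ?N3"
  proof -
    have "convex hull {?r, o', ?p} \<subseteq> ?Q"
      by (rule convex_hull_3_subset) (auto simp: oQ hull_inc)
    moreover have "convex hull {?r, ?v3, o'} \<subseteq> ?N3"
      by (rule convex_hull_3_subset) (auto simp: oN hull_inc)
    ultimately show ?thesis using triangle_split[OF o(1), of ?r] by blast
  qed
  have sub2: "convex hull {?q, ?v3, ?p} \<subseteq> ?Q \<union> ?N3"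
  proof -
    have "convex hull {?q, o', ?p} \<subseteq> ?Q"
      by (rule convex_hull_3_subset) (auto simp: oQ hull_inc)
    moreover have "convex hull {?q, ?v3, o'} \<subseteq> ?N3"
      by (rule convex_hull_3_subset) (auto simp: oN hull_inc)
    ultimately show ?thesis using triangle_split[OF o(1), of ?q] by blast
  qed
  have 1: "tri \<subseteq> convex hull {?v3, ?v1, ?p} \<union> convex hull {?v3, ?p, ?v2}"
    unfolding tri_def using triangle_split[OF p, of ?v3] by (simp add: insert_commute)
  have 2: "convex hull {?v3, ?v1, ?p} \<subseteq> ?N1 \<union> convex hull {?r, ?v3, ?p}"
    using triangle_split[OF r, of ?p] by (auto simp: insert_commute)
  have 3: "convex hull {?v3, ?p, ?v2} \<subseteq> ?N2 \<union> convex hull {?q, ?v3, ?p}"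
    using triangle_split[OF q, of ?p] by (auto simp: insert_commute)
  show ?thesis using 1 2 3 sub1 sub2 by blast
qed

section \<open>Corner triangles and the mixed area they contribute\<close>

lemma convex_hull_0_segment:
  "convex hull {0, p, q} = {l *\<^sub>R y | l y. 0 \<le> l \<and> l \<le> 1 \<and> y \<in> closed_segment p q}"
proof -
  have "convex hull {0, p, q} = {x. \<exists>u\<ge>0. \<exists>v\<ge>0. \<exists>b. u + v = 1 \<and> b \<in> closed_segment p q \<and> x = u *\<^sub>R 0 + v *\<^sub>R b}"
    by (subst convex_hull_insert) (auto simp: segment_convex_hull)
  also have "\<dots> = {l *\<^sub>R y | l y. 0 \<le> l \<and> l \<le> 1 \<and> y \<in> closed_segment p q}"
  proof safe
    fix l :: real and y assume "0 \<le> l" "l \<le> 1" "y \<in> closed_segment p q"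
    then show "\<exists>u\<ge>0. \<exists>v\<ge>0. \<exists>b. u + v = 1 \<and> b \<in> closed_segment p q \<and> l *\<^sub>R y = u *\<^sub>R 0 + v *\<^sub>R b"
      by (intro exI[of _ "1 - l"] conjI exI[of _ l] exI[of _ y]) auto
  next
    fix u v :: real and y assume "0 \<le> u" "0 \<le> v" "u + v = 1" "y \<in> closed_segment p q"
    then show "\<exists>l y'. u *\<^sub>R 0 + v *\<^sub>R y = l *\<^sub>R y' \<and> 0 \<le> l \<and> l \<le> 1 \<and> y' \<in> closed_segment p q"
      by (intro exI[of _ v] exI[of _ y]) auto
  qed
  finally show ?thesis .
qed

lemma cone_rep:
  assumes "0 \<le> \<alpha>" "0 \<le> \<beta>"
  obtains y where "y \<in> closed_segment p q" "\<alpha> *\<^sub>R p + \<beta> *\<^sub>R q = (\<alpha> + \<beta>) *\<^sub>R y"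
proof (cases "\<alpha> + \<beta> = 0")
  case True
  then have "\<alpha> = 0" "\<beta> = 0" using assms by auto
  then show thesis using that[of p] by simp
next
  case False
  define t where "t = \<beta> / (\<alpha> + \<beta>)"
  have "0 \<le> t" "t \<le> 1" and t: "1 - t = \<alpha> / (\<alpha> + \<beta>)"
    using assms False by (auto simp: t_def field_simps)
  then have "(1 - t) *\<^sub>R p + t *\<^sub>R q \<in> closed_segment p q"
    unfolding in_segment by blast
  moreover have "(\<alpha> + \<beta>) *\<^sub>R ((1 - t) *\<^sub>R p + t *\<^sub>R q) = \<alpha> *\<^sub>R p + \<beta> *\<^sub>R q"
    unfolding t using False by (simp add: t_def scaleR_right_distrib)
  ultimately show thesis using that by metis
qed

text \<open>
  A corner of the standard triangle: \<open>v\<close> is a vertex, and \<open>v + p\<close>, \<open>v + q\<close> lie on the two sides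
  at \<open>v\<close> (\<open>p = 0\<close> or \<open>q = 0\<close> is allowed).
\<close>
definition corner :: "real^2 \<Rightarrow> real^2 \<Rightarrow> real^2 \<Rightarrow> bool" where
  "corner v p q \<longleftrightarrow> v \<in> tri \<and> (\<forall>t\<in>tri. 0 \<le> cr (t - v) (q - p)) \<and>
    (p = 0 \<or> q = 0 \<or> cr p q > 0 \<and> (\<forall>t\<in>tri. 0 \<le> cr (t - v) q \<and> 0 \<le> cr p (t - v)))"

text \<open>The loss in mixed area with \<open>K\<close> when a corner triangle is collapsed onto
  its third side. It is unchanged by translation, so the vertex \<open>v\<close> does not
  occur.\<close>

definition excess :: "real^2 \<Rightarrow> real^2 \<Rightarrow> (real^2) set \<Rightarrow> real" where
  "excess p q K = dmv (convex hull {0, p, q}) K - dmv (closed_segment p q) K"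

lemma corner_cases:
  assumes "corner v p q"
  obtains (flat) "convex hull {0, p, q} = closed_segment p q" "cr p q = 0"
  | (proper) "cr p q > 0" "\<And>t. t \<in> tri \<Longrightarrow> 0 \<le> cr (t - v) q" "\<And>t. t \<in> tri \<Longrightarrow> 0 \<le> cr p (t - v)"
  using assms unfolding corner_def
  by (auto simp: segment_convex_hull insert_commute)

text \<open>\<open>t\<close> lies in the cone at \<open>v\<close> spanned by \<open>p\<close> and
  \<open>q\<close>, so it is reached from \<open>v\<close> along a ray through a point of the third
  side. The factor is the sum of its coordinates along \<open>p\<close> and \<open>q\<close>, equal
  to 1 exactly on the line of the third side.\<close>

lemma proper_corner_rep:
  assumes "cr p q > 0" "0 \<le> cr (t - v) q" "0 \<le> cr p (t - v)"
  obtains y where "y \<in> closed_segment p q" "t = v + (cr (t - v) (q - p) / cr p q) *\<^sub>R y"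
proof -
  define \<alpha> where "\<alpha> = cr (t - v) q / cr p q"
  define \<beta> where "\<beta> = cr p (t - v) / cr p q"
  have ab: "0 \<le> \<alpha>" "0 \<le> \<beta>" using assms by (auto simp: \<alpha>_def \<beta>_def)
  obtain y where y: "y \<in> closed_segment p q" "\<alpha> *\<^sub>R p + \<beta> *\<^sub>R q = (\<alpha> + \<beta>) *\<^sub>R y"
    by (rule cone_rep[OF ab])
  have "t - v = \<alpha> *\<^sub>R p + \<beta> *\<^sub>R q"
    unfolding \<alpha>_def \<beta>_def by (rule cr_basis) (use assms in simp)
  moreover have "\<alpha> + \<beta> = cr (t - v) (q - p) / cr p q"
    using cr_skew[of "t - v" p] by (simp add: \<alpha>_def \<beta>_def diff_divide_distrib add_divide_distrib)
  ultimately show thesis using that[OF y(1)] y(2) by (metis add.commute diff_add_cancel)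
qed

text \<open>Shifting the weight \<open>1 - l\<close> from the first term to the second completes a
  full point of \<open>s\<close>; in this way a point of a corner triangle is traded for one of its
  third side.\<close>

lemma slide_along_ray:
  fixes s :: "'a::real_vector set"
  assumes "convex s" "y \<in> s" "y' \<in> s" "0 \<le> l" "l \<le> 1"
  shows "\<exists>z\<in>s. m *\<^sub>R y' + l *\<^sub>R y = (m + l - 1) *\<^sub>R y' + z"
proof
  show "(1 - l) *\<^sub>R y' + l *\<^sub>R y \<in> s" using assms by (intro convexD) auto
  show "m *\<^sub>R y' + l *\<^sub>R y = (m + l - 1) *\<^sub>R y' + ((1 - l) *\<^sub>R y' + l *\<^sub>R y)"
    by (simp add: algebra_simps)
qed

lemma body_hull_3 [simp]: "convex hull {a, b, c} \<in> K2" for a b c :: "real^2"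
  by (rule body_hull) auto

text \<open>Seen from \<open>v\<close>, a point of \<open>tri\<close> plus the corner triangle is
  \<open>m y' + l y\<close> with \<open>y\<close>, \<open>y'\<close> on the third side. If
  \<open>m + l \<le> 1\<close> it lies in the corner triangle at \<open>v\<close>, otherwise it
  slides into \<open>tri\<close> plus the third side. So using the corner triangle instead of its
  third side adds at most its own area, which \<open>dmv\<close> subtracts.\<close>

lemma excess_tri_nonpos:
  assumes "corner v p q"
  shows "excess p q tri \<le> 0"
  using assms
proof (cases rule: corner_cases)
  case flat
  then show ?thesis by (simp add: excess_def)
next
  case proper
  let ?N = "convex hull {0, p, q}" and ?s = "closed_segment p q"
  have v: "v \<in> tri" using assms by (simp add: corner_def)
  have nn: "0 \<le> cr (t - v) (q - p)" if "t \<in> tri" for t using assms that by (simp add: corner_def)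
  have "tri + ?N \<subseteq> (tri + ?s) \<union> ({v} + ?N)"
  proof
    fix x assume "x \<in> tri + ?N"
    then obtain t l y where t: "t \<in> tri" and l: "0 \<le> l" "l \<le> 1" and y: "y \<in> ?s" and x: "x = t + l *\<^sub>R y"
      by (auto simp: set_plus_def convex_hull_0_segment)
    obtain y' where y': "y' \<in> ?s" "t = v + (cr (t - v) (q - p) / cr p q) *\<^sub>R y'"
      using proper_corner_rep[OF proper(1) proper(2)[OF t] proper(3)[OF t]] by metis
    define m where "m = cr (t - v) (q - p) / cr p q"
    have m: "0 \<le> m" using nn[OF t] proper(1) by (simp add: m_def)
    have tm: "t = v + m *\<^sub>R y'" using y' by (simp add: m_def)
    show "x \<in> (tri + ?s) \<union> ({v} + ?N)"
    proof (cases "m + l \<le> 1")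
      case True
      obtain z where z: "z \<in> ?s" "m *\<^sub>R y' + l *\<^sub>R y = (m + l) *\<^sub>R z"
      proof -
        obtain z where "z \<in> closed_segment y' y" "m *\<^sub>R y' + l *\<^sub>R y = (m + l) *\<^sub>R z"
          by (rule cone_rep[OF m l(1)])
        moreover have "closed_segment y' y \<subseteq> ?s" using y y' by (simp add: subset_closed_segment)
        ultimately show thesis using that by blast
      qed
      have "0 \<le> m + l" using m l by simp
      then have "(m + l) *\<^sub>R z \<in> ?N" unfolding convex_hull_0_segment using z(1) True by blast
      then have "v + (m + l) *\<^sub>R z \<in> {v} + ?N" by (intro set_plus_intro) auto
      then show ?thesis using z(2) by (simp add: x tm add.assoc)
    next
      case False
      obtain z where z: "z \<in> ?s" "m *\<^sub>R y' + l *\<^sub>R y = (m + l - 1) *\<^sub>R y' + z"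
        using slide_along_ray[OF convex_closed_segment y y'(1) l] by blast
      \<comment> \<open>The position between \<open>v\<close> and \<open>t\<close> of the remainder
        \<open>v + (m + l - 1) y'\<close>, which therefore stays in \<open>tri\<close>.\<close>
      define w where "w = (m + l - 1) / m"
      have "m > 0" using False l by simp
      then have w: "0 \<le> w" "w \<le> 1" "w * m = m + l - 1" using False l by (auto simp: w_def field_simps)
      have "(1 - w) *\<^sub>R v + w *\<^sub>R t \<in> tri"
        using w v t body_convex[OF tri_body] by (intro convexD) auto
      moreover have "(1 - w) *\<^sub>R v + w *\<^sub>R t = v + (w * m) *\<^sub>R y'"
        by (simp add: tm algebra_simps)
      then have "(1 - w) *\<^sub>R v + w *\<^sub>R t = v + (m + l - 1) *\<^sub>R y'"
        by (simp only: w(3))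
      ultimately have "(v + (m + l - 1) *\<^sub>R y') + z \<in> tri + ?s" using z(1) by auto
      then show ?thesis using z(2) by (simp add: x tm add.assoc)
    qed
  qed
  then have "area (tri + ?N) \<le> area ((tri + ?s) \<union> ({v} + ?N))"
    by (intro area_mono fmeasurable.Un body_lmeasurable body_plus) auto
  also have "\<dots> \<le> area (tri + ?s) + area ({v} + ?N)"
    unfolding area_def
    by (intro measure_Un_le fmeasurableD body_lmeasurable body_plus) auto
  finally show ?thesis
    by (simp add: excess_def dmv_def add.commute[of _ tri])
qed

lemma hull_translate_3: "{v} + convex hull {0, p, q} = convex hull {v, v + p, v + q}"
  for v p q :: "real^2"
  by (simp add: singleton_plus convex_hull_translation[symmetric])

text \<open>A point of a corner triangle trades places with a point of its third side, which belongs
  to the inscribed triangle. So \<open>tri\<close> plus the three sides is contained in the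
  inscribed triangle plus the three corner triangles; monotonicity and additivity do the
  rest.\<close>

lemma dmv_tri_le_inscribed:
  assumes a: "0 \<le> a" "a \<le> 1" and b: "0 \<le> b" "b \<le> 1" and c: "0 \<le> c" "c \<le> 1" and K: "K \<in> K2"
  shows "dmv tri K \<le> dmv (convex hull {pt a 0, pt (1 - b) b, pt 0 (1 - c)}) K
    + excess (pt a 0) (pt 0 (1 - c)) K + excess (pt (- b) b) (pt (a - 1) 0) K
    + excess (pt 0 (- c)) (pt (1 - b) (b - 1)) K"
proof -
  let ?Q = "convex hull {pt a 0, pt (1 - b) b, pt 0 (1 - c)}"
  let ?N1 = "convex hull {0, pt a 0, pt 0 (1 - c)}" and ?s1 = "closed_segment (pt a 0) (pt 0 (1 - c))"
  let ?N2 = "convex hull {0, pt (- b) b, pt (a - 1) 0}" and ?s2 = "closed_segment (pt (- b) b) (pt (a - 1) 0)"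
  let ?N3 = "convex hull {0, pt 0 (- c), pt (1 - b) (b - 1)}" and ?s3 = "closed_segment (pt 0 (- c)) (pt (1 - b) (b - 1))"
  have e: "pt 0 0 + pt a 0 = pt a 0" "pt 0 0 + pt 0 (1 - c) = pt 0 (1 - c)"
    "pt 1 0 + pt (- b) b = pt (1 - b) b" "pt 1 0 + pt (a - 1) 0 = pt a 0"
    "pt 0 1 + pt 0 (- c) = pt 0 (1 - c)" "pt 0 1 + pt (1 - b) (b - 1) = pt (1 - b) b"
    by (simp_all add: vec2_eq_iff)
  have cover: "tri \<subseteq> ?Q \<union> ({pt 0 0} + ?N1) \<union> ({pt 1 0} + ?N2) \<union> ({pt 0 1} + ?N3)"
    using tri_cover[OF a b c] by (simp add: hull_translate_3 e)
  have sN: "?s1 \<subseteq> ?N1" "?s2 \<subseteq> ?N2" "?s3 \<subseteq> ?N3"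
    unfolding segment_convex_hull by (intro hull_mono; auto)+
  have sQ: "{pt 0 0} + ?s1 \<subseteq> ?Q" "{pt 1 0} + ?s2 \<subseteq> ?Q" "{pt 0 1} + ?s3 \<subseteq> ?Q"
    unfolding singleton_plus closed_segment_translation[symmetric] e
    unfolding segment_convex_hull by (intro hull_mono; auto)+
  have "tri + (?s1 + (?s2 + ?s3)) \<subseteq> ?Q + (?N1 + (?N2 + ?N3))"
  proof
    fix x assume "x \<in> tri + (?s1 + (?s2 + ?s3))"
    then obtain t y1 y2 y3 where t: "t \<in> tri" and y: "y1 \<in> ?s1" "y2 \<in> ?s2" "y3 \<in> ?s3"
      and x: "x = t + (y1 + (y2 + y3))"
      by (auto elim!: set_plus_elim)
    consider "t \<in> ?Q" | "t \<in> {pt 0 0} + ?N1" | "t \<in> {pt 1 0} + ?N2" | "t \<in> {pt 0 1} + ?N3"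
      using cover t by blast
    then show "x \<in> ?Q + (?N1 + (?N2 + ?N3))"
    proof cases
      case 1
      then show ?thesis unfolding x using y sN by (intro set_plus_intro) auto
    next
      case 2
      then obtain n where n: "n \<in> ?N1" "t = pt 0 0 + n" by (auto elim!: set_plus_elim)
      have "pt 0 0 + y1 \<in> ?Q" using sQ(1) y(1) by (auto simp: singleton_plus)
      moreover have "x = (pt 0 0 + y1) + (n + (y2 + y3))" by (simp add: x n algebra_simps)
      ultimately show ?thesis using y sN n by (auto intro!: set_plus_intro)
    next
      case 3
      then obtain n where n: "n \<in> ?N2" "t = pt 1 0 + n" by (auto elim!: set_plus_elim)
      have "pt 1 0 + y2 \<in> ?Q" using sQ(2) y(2) by (auto simp: singleton_plus)
      moreover have "x = (pt 1 0 + y2) + (y1 + (n + y3))" by (simp add: x n algebra_simps)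
      ultimately show ?thesis using y sN n by (auto intro!: set_plus_intro)
    next
      case 4
      then obtain n where n: "n \<in> ?N3" "t = pt 0 1 + n" by (auto elim!: set_plus_elim)
      have "pt 0 1 + y3 \<in> ?Q" using sQ(3) y(3) by (auto simp: singleton_plus)
      moreover have "x = (pt 0 1 + y3) + (y1 + (y2 + n))" by (simp add: x n algebra_simps)
      ultimately show ?thesis using y sN n by (auto intro!: set_plus_intro)
    qed
  qed
  then have "dmv (tri + (?s1 + (?s2 + ?s3))) K \<le> dmv (?Q + (?N1 + (?N2 + ?N3))) K"
    using K by (intro dmv_mono_left body_plus) auto
  then show ?thesis
    using K by (simp add: dmv_plus_left body_plus excess_def)
qed

text \<open>The touching points divide the sides, run through counterclockwise from (0, 0), at the
  fractions \<open>a\<close>, \<open>b\<close>, \<open>c\<close>. The corner triangles they cut off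
  then have, cyclically, the doubled areas \<open>a * (1 - c)\<close>, \<open>b * (1 - a)\<close>,
  \<open>c * (1 - b)\<close>. A body may touch a side in several points; one choice is
  recorded.\<close>

definition inscribed :: "real \<Rightarrow> real \<Rightarrow> real \<Rightarrow> (real^2) set \<Rightarrow> bool" where
  "inscribed a b c K \<longleftrightarrow> K \<in> K2 \<and> K \<subseteq> tri \<and> pt a 0 \<in> K \<and> pt (1 - b) b \<in> K \<and> pt 0 (1 - c) \<in> K"

lemma inscribed_bounds:
  assumes "inscribed a b c K"
  shows "0 \<le> a" "a \<le> 1" "0 \<le> b" "b \<le> 1" "0 \<le> c" "c \<le> 1"
proof -
  have "pt a 0 \<in> tri" "pt (1 - b) b \<in> tri" "pt 0 (1 - c) \<in> tri"
    using assms by (auto simp: inscribed_def)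
  then show "0 \<le> a" "a \<le> 1" "0 \<le> b" "b \<le> 1" "0 \<le> c" "c \<le> 1"
    by (simp_all add: tri_eq)
qed

lemma pt_0_0: "pt 0 0 = 0"
  by (simp add: vec2_eq_iff)

lemma corner_tri:
  assumes "0 \<le> a" "a \<le> 1" "0 \<le> b" "b \<le> 1" "0 \<le> c" "c \<le> 1"
  shows "corner (pt 0 0) (pt a 0) (pt 0 (1 - c))"
    and "corner (pt 1 0) (pt (- b) b) (pt (a - 1) 0)"
    and "corner (pt 0 1) (pt 0 (- c)) (pt (1 - b) (b - 1))"
proof -
  have nn: "0 \<le> x * (t$1)" "0 \<le> x * (t$2)" "0 \<le> x * (1 - t$1 - t$2)" if "t \<in> tri" "0 \<le> x" for x t
    using that by (auto simp: tri_eq)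
  have 1: "0 \<le> cr (t - pt 0 0) (pt 0 (1 - c) - pt a 0)" "0 \<le> cr (t - pt 0 0) (pt 0 (1 - c))"
    "0 \<le> cr (pt a 0) (t - pt 0 0)" if "t \<in> tri" for t
    using nn[OF that, of a] nn[OF that, of "1 - c"] assms by (simp_all add: cr_def algebra_simps)
  have 2: "0 \<le> cr (t - pt 1 0) (pt (a - 1) 0 - pt (- b) b)" "0 \<le> cr (t - pt 1 0) (pt (a - 1) 0)"
    "0 \<le> cr (pt (- b) b) (t - pt 1 0)" if "t \<in> tri" for t
    using nn[OF that, of b] nn[OF that, of "1 - a"] assms by (simp_all add: cr_def algebra_simps)
  have 3: "0 \<le> cr (t - pt 0 1) (pt (1 - b) (b - 1) - pt 0 (- c))" "0 \<le> cr (t - pt 0 1) (pt (1 - b) (b - 1))"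
    "0 \<le> cr (pt 0 (- c)) (t - pt 0 1)" if "t \<in> tri" for t
    using nn[OF that, of c] nn[OF that, of "1 - b"] assms by (simp_all add: cr_def algebra_simps)
  have z: "pt x y = 0 \<longleftrightarrow> x = 0 \<and> y = 0" for x y by (simp add: vec2_eq_iff)
  have pos: "0 < cr (pt a 0) (pt 0 (1 - c))" if "a \<noteq> 0" "c \<noteq> 1" using assms that by (simp add: cr_def)
  have pos2: "0 < cr (pt (- b) b) (pt (a - 1) 0)" if "b \<noteq> 0" "a \<noteq> 1"
    using assms that by (simp add: cr_def mult_pos_neg)
  have pos3: "0 < cr (pt 0 (- c)) (pt (1 - b) (b - 1))" if "c \<noteq> 0" "b \<noteq> 1" using assms that by (simp add: cr_def)
  show "corner (pt 0 0) (pt a 0) (pt 0 (1 - c))"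
    using 1 pos unfolding corner_def z by (auto simp: tri_eq simp del: cr_simps)
  show "corner (pt 1 0) (pt (- b) b) (pt (a - 1) 0)"
    using 2 pos2 unfolding corner_def z by (auto simp: tri_eq simp del: cr_simps)
  show "corner (pt 0 1) (pt 0 (- c)) (pt (1 - b) (b - 1))"
    using 3 pos3 unfolding corner_def z by (auto simp: tri_eq simp del: cr_simps)
qed

lemma inscribed_hull_subset:
  "inscribed a b c K \<Longrightarrow> convex hull {pt a 0, pt (1 - b) b, pt 0 (1 - c)} \<subseteq> K"
  unfolding inscribed_def by (intro convex_hull_3_subset) (auto simp: body_convex)

lemma inscribed_tri: "inscribed 0 0 0 tri"
  unfolding inscribed_def by (intro conjI tri_body) (simp_all add: tri_eq)

text \<open>For \<open>tri\<close> the three corner terms are at most 0, so the triangle of touching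
  points has as much mixed area with \<open>tri\<close> as \<open>tri\<close> itself, and
  \<open>K\<close> is squeezed between the two.\<close>

lemma dmv_tri_inscribed_eq_self:
  assumes K: "inscribed a b c K"
  shows "dmv tri K = dmv tri tri"
proof (rule antisym)
  note bd = inscribed_bounds[OF K]
  have KK: "K \<in> K2" "K \<subseteq> tri" using K by (auto simp: inscribed_def)
  show "dmv tri K \<le> dmv tri tri" using KK by (intro dmv_mono) auto
  let ?Q = "convex hull {pt a 0, pt (1 - b) b, pt 0 (1 - c)}"
  have "dmv tri tri \<le> dmv ?Q tri"
    using dmv_tri_le_inscribed[OF bd tri_body] excess_tri_nonpos[OF corner_tri(1)[OF bd]]
      excess_tri_nonpos[OF corner_tri(2)[OF bd]] excess_tri_nonpos[OF corner_tri(3)[OF bd]]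
    by linarith
  also have "\<dots> \<le> dmv K tri"
    using KK inscribed_hull_subset[OF K] by (intro dmv_mono) auto
  finally show "dmv tri tri \<le> dmv tri K" by (simp add: dmv_commute)
qed

text \<open>The bottom side alone touches all three sides of \<open>tri\<close>, and mixed area with
  a segment is a width.\<close>

lemma dmv_tri_tri: "dmv tri tri = 1"
proof -
  let ?s = "closed_segment (pt 0 0) (pt 1 0)"
  have "inscribed 1 0 1 ?s"
    unfolding inscribed_def
    using closed_segment_subset[OF _ _ body_convex[OF tri_body], of "pt 0 0" "pt 1 0"] by (auto simp: tri_eq)
  then have "dmv tri tri = dmv tri ?s" by (simp add: dmv_tri_inscribed_eq_self)
  also have "\<dots> = dmv (closed_segment 0 (pt 1 0)) tri"
    by (simp add: dmv_commute pt_0_0)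
  also have "\<dots> = cr (pt 1 0) (pt 0 1) - cr (pt 1 0) (pt 0 0)"
    by (rule dmv_segment_width[OF tri_body]) (auto simp: tri_eq cr_def)
  finally show ?thesis by (simp add: cr_def)
qed

lemma dmv_tri_inscribed: "inscribed a b c K \<Longrightarrow> dmv tri K = 1"
  by (simp add: dmv_tri_inscribed_eq_self dmv_tri_tri)

lemma quadrant_body_scaled_inscribed:
  assumes K: "K \<in> K2" and nn: "\<And>k. k \<in> K \<Longrightarrow> 0 \<le> k$1 \<and> 0 \<le> k$2"
    and k1: "k1 \<in> K" "k1$1 = 0" and k2: "k2 \<in> K" "k2$2 = 0"
    and k3: "k3 \<in> K" "\<And>k. k \<in> K \<Longrightarrow> k$1 + k$2 \<le> k3$1 + k3$2"
  obtains a b c K' where "inscribed a b c K'" "K = (*\<^sub>R) (k3$1 + k3$2) ` K'"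
proof -
  define M where "M = k3$1 + k3$2"
  have M: "0 \<le> M" using nn[OF k3(1)] by (simp add: M_def)
  show thesis
  proof (cases "M = 0")
    case True
    have "k = 0" if "k \<in> K" for k
      using nn[OF that] k3(2)[OF that] True by (auto simp: vec2_eq_iff M_def)
    then have "K = {0}" using k1(1) by auto
    also have "\<dots> = (*\<^sub>R) (k3$1 + k3$2) ` tri"
      using True body_nonempty[OF tri_body] by (auto simp: M_def)
    finally show ?thesis using that inscribed_tri by blast
  next
    case False
    define K' where "K' = (*\<^sub>R) (1 / M) ` K"
    have KK: "K = (*\<^sub>R) (k3$1 + k3$2) ` K'"
      using False by (simp add: K'_def image_image flip: M_def)
    have "K' \<in> K2" using K by (simp add: K'_def body_scaleR)
    moreover have "K' \<subseteq> tri"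
    proof
      fix x assume "x \<in> K'"
      then obtain k where k: "k \<in> K" "x = (1 / M) *\<^sub>R k" by (auto simp: K'_def)
      have "k$1 + k$2 \<le> M" using k3(2)[OF k(1)] by (simp add: M_def)
      then show "x \<in> tri" using nn[OF k(1)] False M by (simp add: tri_eq k(2) flip: add_divide_distrib)
    qed
    moreover have "pt (k2$1 / M) 0 \<in> K'" "pt (1 - k3$2 / M) (k3$2 / M) \<in> K'" "pt 0 (1 - (1 - k1$2 / M)) \<in> K'"
    proof -
      have "pt (k2$1 / M) 0 = (1 / M) *\<^sub>R k2" "pt 0 (1 - (1 - k1$2 / M)) = (1 / M) *\<^sub>R k1"
        using k1 k2 by (auto simp: vec2_eq_iff)
      moreover have "pt (1 - k3$2 / M) (k3$2 / M) = (1 / M) *\<^sub>R k3"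
        using False by (auto simp: vec2_eq_iff M_def field_simps)
      ultimately show "pt (k2$1 / M) 0 \<in> K'" "pt (1 - k3$2 / M) (k3$2 / M) \<in> K'" "pt 0 (1 - (1 - k1$2 / M)) \<in> K'"
        using k1 k2 k3 by (auto simp: K'_def)
    qed
    ultimately have "inscribed (k2$1 / M) (k3$2 / M) (1 - k1$2 / M) K'"
      by (simp add: inscribed_def)
    then show ?thesis using that KK by blast
  qed
qed

lemma dmv_tri_quadrant:
  assumes K: "K \<in> K2" and nn: "\<And>k. k \<in> K \<Longrightarrow> 0 \<le> k$1 \<and> 0 \<le> k$2"
    and k1: "k1 \<in> K" "k1$1 = 0" and k2: "k2 \<in> K" "k2$2 = 0"
    and k3: "k3 \<in> K" "\<And>k. k \<in> K \<Longrightarrow> k$1 + k$2 \<le> k3$1 + k3$2"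
  shows "dmv tri K = k3$1 + k3$2"
proof -
  obtain a b c K' where K': "inscribed a b c K'" "K = (*\<^sub>R) (k3$1 + k3$2) ` K'"
    using quadrant_body_scaled_inscribed[OF assms] .
  have "K' \<in> K2" using K'(1) by (simp add: inscribed_def)
  then show ?thesis
    using dmv_scaleR_right[OF tri_body, of K' "k3$1 + k3$2"] nn[OF k3(1)] dmv_tri_inscribed[OF K'(1)]
    by (simp flip: K'(2))
qed

text \<open>
  For \<open>K\<close> touching both sides at the corner, \<open>\<gamma>\<close> is the factor by which the triangle \<open>v, v + p, v + q\<close>
  has to be scaled from \<open>v\<close> for its third side to support \<open>K\<close>.
\<close>
lemma excess_value:
  assumes cor: "corner v p q" and K: "K \<in> K2" "K \<subseteq> tri"
    and k1: "k1 \<in> K" "cr (k1 - v) q = 0" and k2: "k2 \<in> K" "cr p (k2 - v) = 0"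
  obtains \<gamma> where "0 \<le> \<gamma>" "excess p q K = cr p q * \<gamma>" "\<And>k. k \<in> K \<Longrightarrow> cr p q * \<gamma> \<le> cr (k - v) (q - p)"
    "cr p q = 0 \<Longrightarrow> \<gamma> = 0"
  using cor
proof (cases rule: corner_cases)
  case flat
  then show ?thesis using that[of 0] cor K by (auto simp: excess_def corner_def simp del: cr_simps)
next
  case proper
  define z where "z = cr p q"
  have z: "z > 0" using proper(1) by (simp add: z_def)
  define f where "f = (\<lambda>x::real^2. x$1 *\<^sub>R p + x$2 *\<^sub>R q)"
  define g where "g = (\<lambda>y::real^2. pt (cr y q / z) (cr p y / z))"
  have lin: "linear f" "linear g"
    unfolding f_def g_def by (rule linear_coords) (auto intro!: linearI simp: vec2_eq_iff add_divide_distrib)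
  have det: "\<bar>det (matrix f)\<bar> = z" using z by (simp add: f_def det_coords z_def)
  have fg: "f (g y) = y" for y
    using cr_basis[of p q y] z by (simp add: f_def g_def z_def)
  \<comment> \<open>\<open>K\<close> in the coordinates of the corner: it lies in the quadrant and
    touches both axes, the corner triangle becomes \<open>tri\<close>, and its third side the
    hypotenuse.\<close>
  define K0 where "K0 = g ` ({- v} + K)"
  have K0: "K0 \<in> K2" using K lin by (simp add: K0_def body_linear_image body_plus)
  have K0_eq: "K0 = (\<lambda>k. g (k - v)) ` K" by (auto simp: K0_def singleton_plus image_image)
  have "f ` K0 = {- v} + K" by (simp add: K0_def image_image fg)
  then have dK: "dmv L K = dmv L (f ` K0)" for L by simp
  have hull: "convex hull {0, p, q} = f ` tri"
    using convex_hull_3_image[of 0 p q] by (simp add: f_def)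
  have seg: "closed_segment p q = f ` closed_segment (pt 1 0) (pt 0 1)"
    using closed_segment_linear_image[OF lin(1), of "pt 1 0" "pt 0 1"] by (simp add: f_def)
  obtain M where M: "M \<in> K0" "\<And>k. k \<in> K0 \<Longrightarrow> k$1 + k$2 \<le> M$1 + M$2"
    using body_attains_inner_max[OF K0, of "pt 1 1"] by (auto simp: inner_pt)
  obtain m where m: "m \<in> K0" "\<And>k. k \<in> K0 \<Longrightarrow> m$1 + m$2 \<le> k$1 + k$2"
    using body_attains_inner_min[OF K0, of "pt 1 1"] by (auto simp: inner_pt)
  have nn: "0 \<le> k$1 \<and> 0 \<le> k$2" if "k \<in> K0" for k
    using that proper K z by (auto simp: K0_eq g_def simp del: cr_simps)
  have "dmv tri K0 = M$1 + M$2"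
  proof (rule dmv_tri_quadrant[OF K0 nn _ _ _ _ M])
    show "g (k1 - v) \<in> K0" "g (k2 - v) \<in> K0" using k1 k2 by (auto simp: K0_eq)
    show "g (k1 - v) $ 1 = 0" "g (k2 - v) $ 2 = 0" using k1 k2 by (auto simp: g_def simp del: cr_simps)
  qed
  moreover have "dmv (closed_segment (pt 1 0) (pt 0 1)) K0 = (M$1 + M$2) - (m$1 + m$2)"
  proof -
    have cr_e: "cr (pt 0 1 - pt 1 0) x = - (x$1 + x$2)" for x by (simp add: cr_def)
    have "dmv (closed_segment (pt 1 0) (pt 0 1)) K0 = dmv (closed_segment 0 (pt 0 1 - pt 1 0)) K0"
      by (subst segment_eq_translate) simp
    also have "\<dots> = cr (pt 0 1 - pt 1 0) m - cr (pt 0 1 - pt 1 0) M"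
      by (rule dmv_segment_width[OF K0 m(1) M(1)]) (simp_all only: cr_e neg_le_iff_le M(2) m(2))
    finally show ?thesis by (simp add: cr_def)
  qed
  moreover have "excess p q K = z * (dmv tri K0 - dmv (closed_segment (pt 1 0) (pt 0 1)) K0)"
    unfolding excess_def dK hull seg
    by (simp add: dmv_linear_image lin K0 det right_diff_distrib)
  \<comment> \<open>\<open>tri\<close> sees the maximum of the coordinate sum, attained at
    \<open>M\<close>, and the hypotenuse sees its range from \<open>m\<close> to \<open>M\<close>;
    in the difference only the minimum survives, and it becomes \<gamma>.\<close>
  ultimately have "excess p q K = z * (m$1 + m$2)"
    by simp
  moreover have "z * (m$1 + m$2) \<le> cr (k - v) (q - p)" if "k \<in> K" for k
  proof -
    have "g (k - v) \<in> K0" using that by (auto simp: K0_eq)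
    then have "m$1 + m$2 \<le> (cr (k - v) q + cr p (k - v)) / z"
      using m(2)[of "g (k - v)"] by (simp add: g_def add_divide_distrib del: cr_simps)
    also have "cr (k - v) q + cr p (k - v) = cr (k - v) (q - p)"
      using cr_skew[of p "k - v"] by (simp del: cr_simps(1,2,4))
    finally show ?thesis using z by (simp add: field_simps del: cr_simps)
  qed
  ultimately show thesis using that[of "m$1 + m$2"] nn[OF m(1)] z by (simp add: z_def)
qed

text \<open>\<open>E\<close> lies beyond the corner triangle scaled by \<delta> from
  \<open>v\<close>, so a point of \<open>E\<close> plus one of the scaled corner triangle slides
  back towards \<open>v\<close> and splits off a point of the scaled third side. The rest lies
  between \<open>v\<close> and a point of \<open>E\<close>, hence in \<open>E'\<close>: giving back
  the corner gains at least \<delta> times the excess.\<close>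

lemma excess_step:
  assumes cor: "corner v p q" and d: "0 \<le> \<delta>" "cr p q = 0 \<Longrightarrow> \<delta> = 0"
    and E: "E \<in> K2" "E \<subseteq> tri" "\<And>x. x \<in> E \<Longrightarrow> cr p q * \<delta> \<le> cr (x - v) (q - p)"
    and E': "E' \<in> K2" "E \<subseteq> E'" "v \<in> E'" and K: "K \<in> K2"
  shows "dmv E K + \<delta> * excess p q K \<le> dmv E' K"
proof (cases "\<delta> = 0")
  case True
  then show ?thesis using E E' K by (simp add: dmv_mono_left)
next
  case False
  then have d0: "\<delta> > 0" and "cr p q \<noteq> 0" using d by auto
  then have z: "cr p q > 0" and nn: "\<And>t. t \<in> tri \<Longrightarrow> 0 \<le> cr (t - v) q" "\<And>t. t \<in> tri \<Longrightarrow> 0 \<le> cr p (t - v)"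
    using cor by (auto elim: corner_cases)
  let ?N = "convex hull {0, p, q}" and ?s = "closed_segment p q"
  have "E + (*\<^sub>R) \<delta> ` ?N \<subseteq> E' + (*\<^sub>R) \<delta> ` ?s"
  proof
    fix w assume "w \<in> E + (*\<^sub>R) \<delta> ` ?N"
    then obtain x l y where x: "x \<in> E" and l: "0 \<le> l" "l \<le> 1" and y: "y \<in> ?s" and w: "w = x + \<delta> *\<^sub>R (l *\<^sub>R y)"
      by (auto simp: set_plus_def convex_hull_0_segment)
    obtain y' where y': "y' \<in> ?s" "x = v + (cr (x - v) (q - p) / cr p q) *\<^sub>R y'"
      using proper_corner_rep[OF z nn(1) nn(2)] E(2) x by (metis subsetD)
    define m where "m = cr (x - v) (q - p) / cr p q / \<delta>"
    have m: "1 \<le> m" using E(3)[OF x] z d0 by (simp add: m_def field_simps del: cr_simps)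
    have xm: "x = v + \<delta> *\<^sub>R (m *\<^sub>R y')" using y'(2) d0 by (simp add: m_def del: cr_simps)
    obtain u where u: "u \<in> ?s" "m *\<^sub>R y' + l *\<^sub>R y = (m + l - 1) *\<^sub>R y' + u"
      using slide_along_ray[OF convex_closed_segment y y'(1) l] by blast
    define r where "r = (m + l - 1) / m"
    have r: "0 \<le> r" "r \<le> 1" "r * m = m + l - 1" using m l by (auto simp: r_def field_simps)
    have "(1 - r) *\<^sub>R v + r *\<^sub>R x \<in> E'"
      using r E' x body_convex[OF E'(1)] by (intro convexD) auto
    moreover have "(1 - r) *\<^sub>R v + r *\<^sub>R x = v + \<delta> *\<^sub>R ((r * m) *\<^sub>R y')"
      by (simp add: xm algebra_simps)
    then have "(1 - r) *\<^sub>R v + r *\<^sub>R x = v + \<delta> *\<^sub>R ((m + l - 1) *\<^sub>R y')"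
      by (simp only: r(3))
    moreover have "w = v + \<delta> *\<^sub>R (m *\<^sub>R y' + l *\<^sub>R y)"
      by (simp add: w xm algebra_simps)
    moreover have "\<delta> *\<^sub>R (m *\<^sub>R y' + l *\<^sub>R y) = \<delta> *\<^sub>R ((m + l - 1) *\<^sub>R y') + \<delta> *\<^sub>R u"
      by (simp only: u(2) scaleR_right_distrib)
    ultimately have "w = ((1 - r) *\<^sub>R v + r *\<^sub>R x) + \<delta> *\<^sub>R u" by (simp only: add.assoc)
    then show "w \<in> E' + (*\<^sub>R) \<delta> ` ?s"
      using \<open>(1 - r) *\<^sub>R v + r *\<^sub>R x \<in> E'\<close> u(1) by auto
  qed
  then have "dmv (E + (*\<^sub>R) \<delta> ` ?N) K \<le> dmv (E' + (*\<^sub>R) \<delta> ` ?s) K"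
    using E E' K by (intro dmv_mono_left body_plus body_scaleR) auto
  then show ?thesis
    using E E' K d by (simp add: dmv_plus_left dmv_scaleR_left body_scaleR excess_def algebra_simps)
qed

text \<open>
  With \<open>g1 \<ge> 1\<close> the left side is largest at \<open>d1 = 0\<close>. The term \<open>a * (1 - c) * g1\<close> is bounded by a
  convex combination of the two constraints in \<open>G\<close>: with weight \<open>1 - b\<close> on the first one if
  \<open>d2 \<le> 1\<close>, and otherwise, for \<open>e = b * (d2 - 1)\<close>, with weight \<open>0\<close> or \<open>1 - e / a\<close>.
\<close>
lemma corner_weights_aux:
  fixes a b c g1 g2 g3 d1 d2 d3 :: real
  assumes a: "0 \<le> a" "a \<le> 1" and b: "0 \<le> b" "b \<le> 1" and c: "0 \<le> c" "c \<le> 1"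
    and g: "1 \<le> g1" "g2 \<le> 1" "g3 \<le> 1" "0 \<le> g2" "0 \<le> g3" and d: "0 \<le> d1" "0 \<le> d2" "0 \<le> d3"
    and G: "a * g1 + (1 - a) * g2 \<le> 1" "c * g3 + (1 - c) * g1 \<le> 1"
    and D: "(1 - a) * d2 \<le> 1" "b * d2 + (1 - b) * d3 \<le> 1"
    and d3: "d3 \<le> 1"
  shows "a * (1 - c) * (g1 + d1 - g1 * d1) + b * (1 - a) * (g2 + d2 - g2 * d2)
    + c * (1 - b) * (g3 + d3 - g3 * d3) \<le> 1"
proof -
  define u where "u = 1 - a"
  \<comment> \<open>Slacks at corners 2 and 3; in these terms the constraints on \<open>g1\<close>
    become \<open>a * g1 \<le> a + w2\<close> and
    \<open>(1 - c) * g1 \<le> 1 - c + w3\<close>.\<close>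
  define w2 where "w2 = u * (1 - g2)"
  define w3 where "w3 = c * (1 - g3)"
  have w2: "0 \<le> w2" "w2 \<le> u" using a g by (auto simp: w2_def u_def mult_left_le)
  have w3: "0 \<le> w3" "w3 \<le> c" using c g by (auto simp: w3_def mult_left_le)
  define G where "G = a * (1 - c) * g1"
  have G2: "G \<le> (1 - c) * (a + w2)"
  proof -
    have "(1 - c) * (a * g1) \<le> (1 - c) * (a + w2)"
      using c G(1) by (intro mult_left_mono) (auto simp: w2_def u_def algebra_simps)
    then show ?thesis by (simp add: G_def mult.commute mult.left_commute)
  qed
  have G3: "G \<le> a * (1 - c + w3)"
  proof -
    have "a * ((1 - c) * g1) \<le> a * (1 - c + w3)"
      using a G(2) by (intro mult_left_mono) (auto simp: w3_def algebra_simps)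
    then show ?thesis by (simp add: G_def mult.assoc)
  qed
  have t1: "a * (1 - c) * (g1 + d1 - g1 * d1) \<le> G"
  proof -
    have "a * (1 - c) * (g1 + d1 - g1 * d1) = G + (a * (1 - c)) * (d1 * (1 - g1))"
      by (simp add: G_def algebra_simps)
    moreover have "(a * (1 - c)) * (d1 * (1 - g1)) \<le> 0"
      using a c g d by (intro mult_nonneg_nonpos mult_nonneg_nonneg) auto
    ultimately show ?thesis by linarith
  qed
  have t2: "b * (1 - a) * (g2 + d2 - g2 * d2) = b * u + w2 * (b * d2 - b)"
    by (simp add: w2_def u_def algebra_simps)
  have t3: "c * (1 - b) * (g3 + d3 - g3 * d3) = (1 - b) * c + w3 * ((1 - b) * d3 - (1 - b))"
    by (simp add: w3_def algebra_simps)
  \<comment> \<open>The three weights fall short of 1 by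
    \<open>a * b * c + (1 - a) * (1 - b) * (1 - c)\<close>; the surplus of \<open>G\<close> over its
    weight \<open>a * (1 - c)\<close> has to be paid from this gap.\<close>
  have const: "1 - a * (1 - c) - b * u - (1 - b) * c = a * b * c + u * ((1 - b) * (1 - c))"
    by (simp add: u_def algebra_simps)
  have d3': "w3 * ((1 - b) * d3 - (1 - b)) \<le> 0"
  proof -
    have "(1 - b) * d3 \<le> (1 - b) * 1" using b d3 by (intro mult_left_mono) auto
    then show ?thesis using w3 by (intro mult_nonneg_nonpos) auto
  qed
  show ?thesis
  proof (cases "b * d2 \<le> b")
    case True
    have "G \<le> (1 - b) * ((1 - c) * (a + w2)) + b * (a * (1 - c + w3))"
      using mult_left_mono[OF G2, of "1 - b"] mult_left_mono[OF G3, of b] b by (simp add: algebra_simps)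
    also have "\<dots> = a * (1 - c) + ((1 - b) * (1 - c)) * w2 + (a * b) * w3"
      by (simp add: algebra_simps)
    also have "\<dots> \<le> a * (1 - c) + ((1 - b) * (1 - c)) * u + (a * b) * c"
      using w2 w3 a b c by (intro add_mono mult_left_mono mult_nonneg_nonneg) auto
    finally have "G \<le> a * (1 - c) + ((1 - b) * (1 - c)) * u + (a * b) * c" .
    moreover have "w2 * (b * d2 - b) \<le> 0" using w2 True by (intro mult_nonneg_nonpos) auto
    ultimately show ?thesis using t1 t2 t3 d3' const by (simp add: mult.commute)
  next
    case False
    define e where "e = b * d2 - b"
    have e: "e > 0" using False by (simp add: e_def)
    have e1: "e \<le> 1 - b"
    proof -
      have "0 \<le> (1 - b) * d3" using b d by simp
      then show ?thesis using D(2) by (simp add: e_def)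
    qed
    have ue: "u * e \<le> a * b"
    proof -
      have "b * ((1 - a) * d2) \<le> b * 1" using b D(1) by (intro mult_left_mono) auto
      then show ?thesis by (simp add: e_def u_def algebra_simps)
    qed
    have ea: "e \<le> a"
    proof (rule ccontr)
      assume ne: "\<not> e \<le> a"
      show False
      proof (cases "a = 0")
        case True
        then show False using ue e by (simp add: u_def)
      next
        case False
        have "u * a \<le> u * e" using ne a by (intro mult_left_mono) (auto simp: u_def)
        then have "a * u \<le> a * b" using ue by (simp add: mult.commute)
        then have "u \<le> b" using False a by simp
        then show False using ne e1 by (simp add: u_def)
      qed
    qed
    have T3: "w3 * ((1 - b) * d3 - (1 - b)) \<le> - (w3 * e)"
    proof -
      have "(1 - b) * d3 - (1 - b) \<le> - e" using D(2) by (simp add: e_def)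
      then have "w3 * ((1 - b) * d3 - (1 - b)) \<le> w3 * (- e)" using w3(1) by (rule mult_left_mono)
      then show ?thesis by simp
    qed
    \<comment> \<open>For \<open>c \<le> u\<close> the bound \<open>G3\<close> alone is used, and
      the term to control is \<open>(u - c) * e\<close> with \<open>e \<le> 1 - b\<close>. Otherwise
      the weight \<open>e / a\<close> on \<open>G3\<close> cancels \<open>w3\<close>, and the term
      to control is \<open>(c - u) * (u * e)\<close> with \<open>u * e \<le> a * b\<close>. The sign
      of \<open>u - c\<close> decides which bound may be inserted.\<close>
    have key: "G + w2 * e - w3 * e \<le> a * (1 - c) + a * b * c + u * ((1 - b) * (1 - c))"
    proof (cases "c \<le> u")
      case True
      have "G + w2 * e - w3 * e \<le> a * (1 - c) + w2 * e + w3 * (a - e)"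
        using G3 by (simp add: algebra_simps)
      also have "\<dots> \<le> a * (1 - c) + u * e + c * (a - e)"
        using w2 w3 e ea c by (intro add_mono mult_right_mono) auto
      also have "\<dots> = a * (1 - c) + (u - c) * e + c * a" by (simp add: algebra_simps)
      also have "\<dots> \<le> a * (1 - c) + (u - c) * (1 - b) + c * a"
        using True e1 a c by (intro add_mono mult_left_mono) auto
      also have "\<dots> = a * (1 - c) + a * b * c + u * ((1 - b) * (1 - c))"
        by (simp add: u_def algebra_simps)
      finally show ?thesis .
    next
      case False
      have a0: "a > 0" using e ea by simp
      have "a * (G + w2 * e - w3 * e) = (a - e) * G + e * G + a * (w2 * e) - a * (w3 * e)"
        by (simp add: algebra_simps)
      also have "\<dots> \<le> (a - e) * ((1 - c) * (a + w2)) + e * (a * (1 - c + w3)) + a * (w2 * e) - a * (w3 * e)"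
      proof -
        have "(a - e) * G \<le> (a - e) * ((1 - c) * (a + w2))" using ea by (intro mult_left_mono[OF G2]) simp
        moreover have "e * G \<le> e * (a * (1 - c + w3))" using e by (intro mult_left_mono[OF G3]) simp
        ultimately show ?thesis by linarith
      qed
      also have "\<dots> = a * (a * (1 - c)) + w2 * ((a - e) * (1 - c) + a * e)"
        by (simp add: algebra_simps)
      also have "\<dots> \<le> a * (a * (1 - c)) + u * ((a - e) * (1 - c) + a * e)"
        using w2 e ea a0 c by (intro add_mono mult_right_mono add_nonneg_nonneg mult_nonneg_nonneg) auto
      also have "\<dots> = a * (a * (1 - c)) + a * u * (1 - c) + (c - u) * (u * e)"
        by (simp add: u_def algebra_simps)
      also have "\<dots> \<le> a * (a * (1 - c)) + a * u * (1 - c) + (c - u) * (a * b)"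
        using mult_left_mono[OF ue, of "c - u"] False by simp
      also have "\<dots> = a * (a * (1 - c) + a * b * c + u * ((1 - b) * (1 - c)))"
        by (simp add: u_def algebra_simps)
      finally show ?thesis using a0 by simp
    qed
    show ?thesis using t1 t2 t3 T3 const key by (simp add: e_def[symmetric])
  qed
qed

lemma weighted_mean_le_one:
  fixes s x t y :: real
  assumes "0 \<le> s" "0 \<le> t" "s + t = 1" "s * x + t * y \<le> 1" "1 < x"
  shows "y \<le> 1"
proof (rule ccontr)
  assume y: "\<not> y \<le> 1"
  have "s * (x - 1) + t * (y - 1) = (s * x + t * y) - (s + t)" by (simp add: algebra_simps)
  then have le: "s * (x - 1) + t * (y - 1) \<le> 0" using assms by simp
  show False
  proof (cases "s = 0")
    case True
    then show False using assms y by simp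
  next
    case False
    then have "0 < s * (x - 1)" "0 \<le> t * (y - 1)" using assms y by simp_all
    then show False using le by linarith
  qed
qed

text \<open>Since \<open>g1 > 1\<close>, the two constraints that contain \<open>g1\<close> keep
  \<open>g2\<close> and \<open>g3\<close> at most 1, and \<open>d2\<close>, \<open>d3\<close> cannot
  both exceed 1. If \<open>d3\<close> does, a reflection exchanges corners 2 and 3.\<close>

lemma corner_weights_first_gt:
  fixes a b c g1 g2 g3 d1 d2 d3 :: real
  assumes a: "0 \<le> a" "a \<le> 1" and b: "0 \<le> b" "b \<le> 1" and c: "0 \<le> c" "c \<le> 1"
    and g: "0 \<le> g1" "0 \<le> g2" "0 \<le> g3" and d: "0 \<le> d1" "0 \<le> d2" "0 \<le> d3"
    and G: "a * g1 + (1 - a) * g2 \<le> 1" "b * g2 + (1 - b) * g3 \<le> 1" "c * g3 + (1 - c) * g1 \<le> 1"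
    and D: "a * d1 + (1 - a) * d2 \<le> 1" "b * d2 + (1 - b) * d3 \<le> 1" "c * d3 + (1 - c) * d1 \<le> 1"
    and g1: "1 < g1"
  shows "a * (1 - c) * (g1 + d1 - g1 * d1) + b * (1 - a) * (g2 + d2 - g2 * d2)
    + c * (1 - b) * (g3 + d3 - g3 * d3) \<le> 1"
proof -
  have g2: "g2 \<le> 1"
    using weighted_mean_le_one[of a "1 - a" g1 g2] a G(1) g1 by simp
  have g3: "g3 \<le> 1"
    using weighted_mean_le_one[of "1 - c" c g1 g3] c G(3) g1 by (simp add: add.commute)
  have "0 \<le> a * d1" "0 \<le> (1 - c) * d1" using a c d by auto
  then have nn: "(1 - a) * d2 \<le> 1" "c * d3 \<le> 1" using D by linarith+
  show ?thesis
  proof (cases "d3 \<le> 1")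
    case True
    show ?thesis
      by (rule corner_weights_aux) (use assms g2 g3 True nn in \<open>auto\<close>)
  next
    case False
    have d2: "d2 \<le> 1"
      using weighted_mean_le_one[of "1 - b" b d3 d2] b D(2) False by (simp add: add.commute)
    \<comment> \<open>The reflection fixing corner 1 turns \<open>(a, b, c)\<close> into
      \<open>(1 - c, 1 - b, 1 - a)\<close>.\<close>
    have "(1 - c) * (1 - (1 - a)) * (g1 + d1 - g1 * d1) + (1 - b) * (1 - (1 - c)) * (g3 + d3 - g3 * d3)
      + (1 - a) * (1 - (1 - b)) * (g2 + d2 - g2 * d2) \<le> 1"
      by (rule corner_weights_aux) (use assms g2 g3 d2 nn in \<open>auto simp: add.commute\<close>)
    then show ?thesis by (simp add: algebra_simps)
  qed
qed

text \<open>If no factor exceeds 1, each \<open>x + y - x * y\<close> is at most 1 and the weights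
  sum to at most 1. Otherwise a rotation of the corners and an exchange of the \<open>g\<close> with
  the \<open>d\<close> make the large factor the first one.\<close>

lemma corner_weights:
  fixes a b c g1 g2 g3 d1 d2 d3 :: real
  assumes a: "0 \<le> a" "a \<le> 1" and b: "0 \<le> b" "b \<le> 1" and c: "0 \<le> c" "c \<le> 1"
    and g: "0 \<le> g1" "0 \<le> g2" "0 \<le> g3" and d: "0 \<le> d1" "0 \<le> d2" "0 \<le> d3"
    and G: "a * g1 + (1 - a) * g2 \<le> 1" "b * g2 + (1 - b) * g3 \<le> 1" "c * g3 + (1 - c) * g1 \<le> 1"
    and D: "a * d1 + (1 - a) * d2 \<le> 1" "b * d2 + (1 - b) * d3 \<le> 1" "c * d3 + (1 - c) * d1 \<le> 1"
  shows "a * (1 - c) * (g1 + d1 - g1 * d1) + b * (1 - a) * (g2 + d2 - g2 * d2)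
    + c * (1 - b) * (g3 + d3 - g3 * d3) \<le> 1" (is "?S \<le> 1")
proof -
  have swap: "x + y - x * y = y + x - y * x" for x y :: real by (simp add: mult.commute)
  consider "1 < g1" | "1 < g2" | "1 < g3" | "1 < d1" | "1 < d2" | "1 < d3"
    | "g1 \<le> 1" "g2 \<le> 1" "g3 \<le> 1" "d1 \<le> 1" "d2 \<le> 1" "d3 \<le> 1" by linarith
  then show ?thesis
  proof cases
    case 1
    show ?thesis by (rule corner_weights_first_gt) (use assms 1 in auto)
  next
    case 2
    have "b * (1 - a) * (g2 + d2 - g2 * d2) + c * (1 - b) * (g3 + d3 - g3 * d3) + a * (1 - c) * (g1 + d1 - g1 * d1) \<le> 1"
      by (rule corner_weights_first_gt) (use assms 2 in auto)
    then show ?thesis by linarith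
  next
    case 3
    have "c * (1 - b) * (g3 + d3 - g3 * d3) + a * (1 - c) * (g1 + d1 - g1 * d1) + b * (1 - a) * (g2 + d2 - g2 * d2) \<le> 1"
      by (rule corner_weights_first_gt) (use assms 3 in auto)
    then show ?thesis by linarith
  next
    case 4
    have "a * (1 - c) * (d1 + g1 - d1 * g1) + b * (1 - a) * (d2 + g2 - d2 * g2) + c * (1 - b) * (d3 + g3 - d3 * g3) \<le> 1"
      by (rule corner_weights_first_gt) (use assms 4 in auto)
    then show ?thesis by (simp only: swap[of g1] swap[of g2] swap[of g3])
  next
    case 5
    have "b * (1 - a) * (d2 + g2 - d2 * g2) + c * (1 - b) * (d3 + g3 - d3 * g3) + a * (1 - c) * (d1 + g1 - d1 * g1) \<le> 1"
      by (rule corner_weights_first_gt) (use assms 5 in auto)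
    then show ?thesis by (simp only: swap[of g1] swap[of g2] swap[of g3])
  next
    case 6
    have "c * (1 - b) * (d3 + g3 - d3 * g3) + a * (1 - c) * (d1 + g1 - d1 * g1) + b * (1 - a) * (d2 + g2 - d2 * g2) \<le> 1"
      by (rule corner_weights_first_gt) (use assms 6 in auto)
    then show ?thesis by (simp only: swap[of g1] swap[of g2] swap[of g3])
  next
    case 7
    have le1: "x + y - x * y \<le> 1" if "x \<le> 1" "y \<le> 1" for x y :: real
    proof -
      have "0 \<le> (1 - x) * (1 - y)" using that by simp
      then show ?thesis by (simp add: algebra_simps)
    qed
    have "?S \<le> a * (1 - c) * 1 + b * (1 - a) * 1 + c * (1 - b) * 1"
      using a b c 7 le1 by (intro add_mono mult_left_mono mult_nonneg_nonneg) auto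
    also have "\<dots> = 1 - (a * b * c + (1 - a) * (1 - b) * (1 - c))" by (simp add: algebra_simps)
    also have "\<dots> \<le> 1"
    proof -
      have "0 \<le> a * b * c" "0 \<le> (1 - a) * (1 - b) * (1 - c)"
        using a b c by (intro mult_nonneg_nonneg; simp)+
      then show ?thesis by linarith
    qed
    finally show ?thesis .
  qed
qed

section \<open>Corner weights of inscribed bodies\<close>

lemma halfplane_cr_eq: "{x. k \<le> cr (x - v) w} = {x. pt (w$2) (- (w$1)) \<bullet> x \<ge> k + cr v w}"
  by (auto simp: cr_def inner_pt algebra_simps)

lemma closed_halfplane_cr: "closed {x. k \<le> cr (x - v) w}"
  and convex_halfplane_cr: "convex {x. k \<le> cr (x - v) w}"
  unfolding halfplane_cr_eq by (simp_all only: closed_halfspace_ge convex_halfspace_ge)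

text \<open>The constraints come from the touching points of \<open>K\<close>. The supporting line
  at corner 1 leaves \<open>pt a' 0\<close> on its far side, so \<open>a * g1 \<le> a'\<close>; that
  at corner 2 gives \<open>(1 - a) * g2 \<le> 1 - a'\<close>. Adding the two bounds on each side of
  \<open>tri\<close> eliminates \<open>a'\<close>, \<open>b'\<close>, \<open>c'\<close>.\<close>

lemma inscribed_excess:
  assumes a: "0 \<le> a" "a \<le> 1" and b: "0 \<le> b" "b \<le> 1" and c: "0 \<le> c" "c \<le> 1"
    and K: "inscribed a' b' c' K"
  obtains g1 g2 g3 where "0 \<le> g1" "0 \<le> g2" "0 \<le> g3"
    "excess (pt a 0) (pt 0 (1 - c)) K = a * (1 - c) * g1"
    "excess (pt (- b) b) (pt (a - 1) 0) K = b * (1 - a) * g2"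
    "excess (pt 0 (- c)) (pt (1 - b) (b - 1)) K = c * (1 - b) * g3"
    "a * g1 + (1 - a) * g2 \<le> 1" "b * g2 + (1 - b) * g3 \<le> 1" "c * g3 + (1 - c) * g1 \<le> 1"
    "a * (1 - c) = 0 \<Longrightarrow> g1 = 0" "b * (1 - a) = 0 \<Longrightarrow> g2 = 0" "c * (1 - b) = 0 \<Longrightarrow> g3 = 0"
    "\<And>k. k \<in> K \<Longrightarrow> a * (1 - c) * g1 \<le> cr (k - pt 0 0) (pt 0 (1 - c) - pt a 0)"
    "\<And>k. k \<in> K \<Longrightarrow> b * (1 - a) * g2 \<le> cr (k - pt 1 0) (pt (a - 1) 0 - pt (- b) b)"
    "\<And>k. k \<in> K \<Longrightarrow> c * (1 - b) * g3 \<le> cr (k - pt 0 1) (pt (1 - b) (b - 1) - pt 0 (- c))"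
proof -
  note cor = corner_tri[OF a b c]
  note bd = inscribed_bounds[OF K]
  have KK: "K \<in> K2" "K \<subseteq> tri" and mem: "pt a' 0 \<in> K" "pt (1 - b') b' \<in> K" "pt 0 (1 - c') \<in> K"
    using K by (auto simp: inscribed_def)
  have z: "cr (pt a 0) (pt 0 (1 - c)) = a * (1 - c)" "cr (pt (- b) b) (pt (a - 1) 0) = b * (1 - a)"
    "cr (pt 0 (- c)) (pt (1 - b) (b - 1)) = c * (1 - b)"
    by (simp_all add: cr_def algebra_simps)
  have e: "cr (pt 0 (1 - c') - pt 0 0) (pt 0 (1 - c)) = 0" "cr (pt a 0) (pt a' 0 - pt 0 0) = 0"
    "cr (pt a' 0 - pt 1 0) (pt (a - 1) 0) = 0" "cr (pt (- b) b) (pt (1 - b') b' - pt 1 0) = 0"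
    "cr (pt (1 - b') b' - pt 0 1) (pt (1 - b) (b - 1)) = 0" "cr (pt 0 (- c)) (pt 0 (1 - c') - pt 0 1) = 0"
    by (simp_all add: cr_def algebra_simps)
  obtain g1 where g1: "0 \<le> g1" "excess (pt a 0) (pt 0 (1 - c)) K = a * (1 - c) * g1"
    "\<And>k. k \<in> K \<Longrightarrow> a * (1 - c) * g1 \<le> cr (k - pt 0 0) (pt 0 (1 - c) - pt a 0)" "a * (1 - c) = 0 \<Longrightarrow> g1 = 0"
    by (rule excess_value[OF cor(1) KK mem(3) e(1) mem(1) e(2), unfolded z]) (rule that)
  obtain g2 where g2: "0 \<le> g2" "excess (pt (- b) b) (pt (a - 1) 0) K = b * (1 - a) * g2"
    "\<And>k. k \<in> K \<Longrightarrow> b * (1 - a) * g2 \<le> cr (k - pt 1 0) (pt (a - 1) 0 - pt (- b) b)" "b * (1 - a) = 0 \<Longrightarrow> g2 = 0"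
    by (rule excess_value[OF cor(2) KK mem(1) e(3) mem(2) e(4), unfolded z]) (rule that)
  obtain g3 where g3: "0 \<le> g3" "excess (pt 0 (- c)) (pt (1 - b) (b - 1)) K = c * (1 - b) * g3"
    "\<And>k. k \<in> K \<Longrightarrow> c * (1 - b) * g3 \<le> cr (k - pt 0 1) (pt (1 - b) (b - 1) - pt 0 (- c))" "c * (1 - b) = 0 \<Longrightarrow> g3 = 0"
    by (rule excess_value[OF cor(3) KK mem(2) e(5) mem(3) e(6), unfolded z]) (rule that)
  \<comment> \<open>At a flat corner the common factor may be 0 and cannot be cancelled; the
    convention \<open>g = 0\<close> there saves the bound.\<close>
  have cancel: "s * g \<le> u" if "s * r * g \<le> u * r" "s * r = 0 \<Longrightarrow> g = 0" "0 \<le> r" "0 \<le> u" for s r g u :: real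
  proof (cases "r = 0")
    case False
    have "(s * g) * r \<le> u * r" using that(1) by (simp add: mult.commute mult.left_commute)
    then show ?thesis using False that(3) by simp
  qed (use that in simp)
  have "a * g1 \<le> a'"
    using cancel[of a "1 - c" g1 a'] g1(3)[OF mem(1)] g1(4) bd c by (simp add: cr_def algebra_simps)
  moreover have "(1 - c) * g1 \<le> 1 - c'"
    using cancel[of "1 - c" a g1 "1 - c'"] g1(3)[OF mem(3)] g1(4) bd a by (simp add: cr_def algebra_simps)
  moreover have "(1 - a) * g2 \<le> 1 - a'"
    using cancel[of "1 - a" b g2 "1 - a'"] g2(3)[OF mem(1)] g2(4) bd b by (simp add: cr_def algebra_simps)
  moreover have "b * g2 \<le> b'"
    using cancel[of b "1 - a" g2 b'] g2(3)[OF mem(2)] g2(4) bd a by (simp add: cr_def algebra_simps)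
  moreover have "(1 - b) * g3 \<le> 1 - b'"
    using cancel[of "1 - b" c g3 "1 - b'"] g3(3)[OF mem(2)] g3(4) bd c by (simp add: cr_def algebra_simps)
  moreover have "c * g3 \<le> c'"
    using cancel[of c "1 - b" g3 c'] g3(3)[OF mem(3)] g3(4) bd b by (simp add: cr_def algebra_simps)
  ultimately have "a * g1 + (1 - a) * g2 \<le> 1" "b * g2 + (1 - b) * g3 \<le> 1" "c * g3 + (1 - c) * g1 \<le> 1"
    by linarith+
  then show thesis
    using that g1 g2 g3 by blast
qed

text \<open>\<open>D\<close> is enlarged to \<open>tri\<close> without its corner triangles scaled
  by \<open>d1\<close>, \<open>d2\<close>, \<open>d3\<close>; then the corners are given back one
  after another. Each restored vertex has to survive the cuts still in force, which the constraints
  \<open>S\<close> guarantee.\<close>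

lemma dmv_le_excess:
  assumes a: "0 \<le> a" "a \<le> 1" and b: "0 \<le> b" "b \<le> 1" and c: "0 \<le> c" "c \<le> 1"
    and D: "D \<in> K2" "D \<subseteq> tri" and K: "K \<in> K2" and d: "0 \<le> d1" "0 \<le> d2" "0 \<le> d3"
    and S: "a * d1 + (1 - a) * d2 \<le> 1" "b * d2 + (1 - b) * d3 \<le> 1" "c * d3 + (1 - c) * d1 \<le> 1"
    and z: "a * (1 - c) = 0 \<Longrightarrow> d1 = 0" "b * (1 - a) = 0 \<Longrightarrow> d2 = 0" "c * (1 - b) = 0 \<Longrightarrow> d3 = 0"
    and far: "\<And>k. k \<in> D \<Longrightarrow> a * (1 - c) * d1 \<le> cr (k - pt 0 0) (pt 0 (1 - c) - pt a 0)"
    "\<And>k. k \<in> D \<Longrightarrow> b * (1 - a) * d2 \<le> cr (k - pt 1 0) (pt (a - 1) 0 - pt (- b) b)"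
    "\<And>k. k \<in> D \<Longrightarrow> c * (1 - b) * d3 \<le> cr (k - pt 0 1) (pt (1 - b) (b - 1) - pt 0 (- c))"
  shows "dmv D K + d1 * excess (pt a 0) (pt 0 (1 - c)) K + d2 * excess (pt (- b) b) (pt (a - 1) 0) K
    + d3 * excess (pt 0 (- c)) (pt (1 - b) (b - 1)) K \<le> dmv tri K"
proof -
  note cor = corner_tri[OF a b c]
  have zz: "cr (pt a 0) (pt 0 (1 - c)) = a * (1 - c)" "cr (pt (- b) b) (pt (a - 1) 0) = b * (1 - a)"
    "cr (pt 0 (- c)) (pt (1 - b) (b - 1)) = c * (1 - b)"
    by (simp_all add: cr_def algebra_simps)
  define H1 where "H1 = {x. a * (1 - c) * d1 \<le> cr (x - pt 0 0) (pt 0 (1 - c) - pt a 0)}"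
  define H2 where "H2 = {x. b * (1 - a) * d2 \<le> cr (x - pt 1 0) (pt (a - 1) 0 - pt (- b) b)}"
  define H3 where "H3 = {x. c * (1 - b) * d3 \<le> cr (x - pt 0 1) (pt (1 - b) (b - 1) - pt 0 (- c))}"
  have DH: "D \<subseteq> tri \<inter> H3 \<inter> H2 \<inter> H1" using D far by (auto simp: H1_def H2_def H3_def simp del: cr_simps)
  moreover have "D \<noteq> {}" using D body_nonempty by blast
  ultimately have E: "tri \<inter> H3 \<in> K2" "tri \<inter> H3 \<inter> H2 \<in> K2" "tri \<inter> H3 \<inter> H2 \<inter> H1 \<in> K2"
    unfolding H1_def H2_def H3_def
    by (blast intro!: body_Int_closed closed_halfplane_cr convex_halfplane_cr tri_body)+
  have nn: "0 \<le> a * d1" "0 \<le> (1 - a) * d2" "0 \<le> b * d2" "0 \<le> (1 - b) * d3" "0 \<le> c * d3" "0 \<le> (1 - c) * d1"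
    using a b c d by auto
  have le: "(1 - a) * d2 \<le> 1" "c * d3 \<le> 1" "(1 - b) * d3 \<le> 1"
    using nn S by linarith+
  have "b * ((1 - a) * d2) \<le> b * 1" "(1 - b) * (c * d3) \<le> (1 - b) * 1" "c * ((1 - b) * d3) \<le> c * 1"
    using b c mult_left_mono[OF le(1), of b] mult_left_mono[OF le(2), of "1 - b"]
      mult_left_mono[OF le(3), of c] by simp_all
  then have v: "pt 0 0 \<in> tri \<inter> H3 \<inter> H2" "pt 1 0 \<in> tri \<inter> H3"
    by (auto simp: tri_eq H2_def H3_def cr_def algebra_simps)
  have "dmv D K \<le> dmv (tri \<inter> H3 \<inter> H2 \<inter> H1) K"
    using DH E D K by (intro dmv_mono_left)
  moreover have "dmv (tri \<inter> H3 \<inter> H2 \<inter> H1) K + d1 * excess (pt a 0) (pt 0 (1 - c)) K \<le> dmv (tri \<inter> H3 \<inter> H2) K"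
    by (rule excess_step[OF cor(1) d(1) _ E(3) _ _ E(2) _ v(1) K]) (auto simp: zz z H1_def simp del: cr_simps)
  moreover have "dmv (tri \<inter> H3 \<inter> H2) K + d2 * excess (pt (- b) b) (pt (a - 1) 0) K \<le> dmv (tri \<inter> H3) K"
    by (rule excess_step[OF cor(2) d(2) _ E(2) _ _ E(1) _ v(2) K]) (auto simp: zz z H2_def simp del: cr_simps)
  moreover have "dmv (tri \<inter> H3) K + d3 * excess (pt 0 (- c)) (pt (1 - b) (b - 1)) K \<le> dmv tri K"
    by (rule excess_step[OF cor(3) d(3) _ E(1) _ _ tri_body _ _ K]) (auto simp: zz z H3_def tri_eq simp del: cr_simps)
  ultimately show ?thesis by linarith
qed

text \<open>With \<open>w\<close> for the doubled corner areas of \<open>B\<close>, the terms on the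
  right are at least 1 minus the sums of \<open>w * g\<close> and of \<open>w * d\<close>, and the
  left side is at most 1 minus the sum of \<open>w * g * d\<close>. So it remains to bound the sum
  of \<open>w * (g + d - g * d)\<close> by 1.\<close>

theorem dmv_inscribed_triangle_inequality:
  assumes B: "inscribed a b c B" and C: "inscribed a' b' c' C" and D: "inscribed a'' b'' c'' D"
  shows "dmv C D \<le> dmv B C + dmv B D"
proof -
  note bd = inscribed_bounds[OF B]
  have bodies: "B \<in> K2" "C \<in> K2" "D \<in> K2" "D \<subseteq> tri" using B C D by (auto simp: inscribed_def)
  obtain g1 g2 g3 where g: "0 \<le> g1" "0 \<le> g2" "0 \<le> g3"
    and eg: "excess (pt a 0) (pt 0 (1 - c)) C = a * (1 - c) * g1"
    "excess (pt (- b) b) (pt (a - 1) 0) C = b * (1 - a) * g2"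
    "excess (pt 0 (- c)) (pt (1 - b) (b - 1)) C = c * (1 - b) * g3"
    and G: "a * g1 + (1 - a) * g2 \<le> 1" "b * g2 + (1 - b) * g3 \<le> 1" "c * g3 + (1 - c) * g1 \<le> 1"
    by (rule inscribed_excess[OF bd C]) (rule that)
  obtain d1 d2 d3 where d: "0 \<le> d1" "0 \<le> d2" "0 \<le> d3"
    and ed: "excess (pt a 0) (pt 0 (1 - c)) D = a * (1 - c) * d1"
    "excess (pt (- b) b) (pt (a - 1) 0) D = b * (1 - a) * d2"
    "excess (pt 0 (- c)) (pt (1 - b) (b - 1)) D = c * (1 - b) * d3"
    and S: "a * d1 + (1 - a) * d2 \<le> 1" "b * d2 + (1 - b) * d3 \<le> 1" "c * d3 + (1 - c) * d1 \<le> 1"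
    and z: "a * (1 - c) = 0 \<Longrightarrow> d1 = 0" "b * (1 - a) = 0 \<Longrightarrow> d2 = 0" "c * (1 - b) = 0 \<Longrightarrow> d3 = 0"
    and far: "\<And>k. k \<in> D \<Longrightarrow> a * (1 - c) * d1 \<le> cr (k - pt 0 0) (pt 0 (1 - c) - pt a 0)"
    "\<And>k. k \<in> D \<Longrightarrow> b * (1 - a) * d2 \<le> cr (k - pt 1 0) (pt (a - 1) 0 - pt (- b) b)"
    "\<And>k. k \<in> D \<Longrightarrow> c * (1 - b) * d3 \<le> cr (k - pt 0 1) (pt (1 - b) (b - 1) - pt 0 (- c))"
    by (rule inscribed_excess[OF bd D]) (rule that)
  have Q: "dmv (convex hull {pt a 0, pt (1 - b) b, pt 0 (1 - c)}) K \<le> dmv B K" if "K \<in> K2" for K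
    using that bodies(1) inscribed_hull_subset[OF B] by (intro dmv_mono_left) auto
  have 1: "1 - (a * (1 - c) * g1 + b * (1 - a) * g2 + c * (1 - b) * g3) \<le> dmv B C"
    using dmv_tri_le_inscribed[OF bd bodies(2)] dmv_tri_inscribed[OF C] Q[OF bodies(2)] eg by linarith
  have 2: "1 - (a * (1 - c) * d1 + b * (1 - a) * d2 + c * (1 - b) * d3) \<le> dmv B D"
    using dmv_tri_le_inscribed[OF bd bodies(3)] dmv_tri_inscribed[OF D] Q[OF bodies(3)] ed by linarith
  have "dmv D C + d1 * excess (pt a 0) (pt 0 (1 - c)) C + d2 * excess (pt (- b) b) (pt (a - 1) 0) C
    + d3 * excess (pt 0 (- c)) (pt (1 - b) (b - 1)) C \<le> dmv tri C"
    by (rule dmv_le_excess[OF bd bodies(3,4,2) d S z far])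
  then have 3: "dmv C D + d1 * (a * (1 - c) * g1) + d2 * (b * (1 - a) * g2) + d3 * (c * (1 - b) * g3) \<le> 1"
    by (simp add: eg dmv_tri_inscribed[OF C] dmv_commute[of D C])
  have "a * (1 - c) * (g1 + d1 - g1 * d1) + b * (1 - a) * (g2 + d2 - g2 * d2)
    + c * (1 - b) * (g3 + d3 - g3 * d3) \<le> 1"
    by (rule corner_weights[OF bd g d G S])
  then have "(a * (1 - c) * g1 + b * (1 - a) * g2 + c * (1 - b) * g3)
    + (a * (1 - c) * d1 + b * (1 - a) * d2 + c * (1 - b) * d3)
    - (d1 * (a * (1 - c) * g1) + d2 * (b * (1 - a) * g2) + d3 * (c * (1 - b) * g3)) \<le> 1"
    by (simp only: right_diff_distrib distrib_left mult.commute mult.left_commute)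
  then show ?thesis using 1 2 3 by linarith
qed

section \<open>The Pluecker-type inequality\<close>

definition supp :: "(real^2) set \<Rightarrow> real^2 \<Rightarrow> real" where
  "supp K u = Sup ((\<lambda>x. u \<bullet> x) ` K)"

lemma supp_eqI: "p \<in> K \<Longrightarrow> (\<And>x. x \<in> K \<Longrightarrow> u \<bullet> x \<le> u \<bullet> p) \<Longrightarrow> supp K u = u \<bullet> p"
  unfolding supp_def by (rule cSup_eq_maximum) auto

lemma supp_attained:
  assumes "K \<in> K2"
  obtains p where "p \<in> K" "supp K u = u \<bullet> p" "\<And>x. x \<in> K \<Longrightarrow> u \<bullet> x \<le> u \<bullet> p"
proof -
  obtain p where p: "p \<in> K" "\<And>x. x \<in> K \<Longrightarrow> u \<bullet> x \<le> u \<bullet> p"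
    by (rule body_attains_inner_max[OF assms, of u]) (rule that)
  then show thesis using that supp_eqI by blast
qed

lemma inner_le_supp:
  assumes "K \<in> K2" "x \<in> K"
  shows "u \<bullet> x \<le> supp K u"
proof -
  obtain p where "supp K u = u \<bullet> p" "\<And>x. x \<in> K \<Longrightarrow> u \<bullet> x \<le> u \<bullet> p"
    by (rule supp_attained[OF assms(1), of u]) (rule that)
  then show ?thesis using assms(2) by simp
qed

lemma supp_plus:
  assumes "K \<in> K2" "L \<in> K2"
  shows "supp (K + L) u = supp K u + supp L u"
proof -
  obtain p where p: "p \<in> K" "supp K u = u \<bullet> p" "\<And>x. x \<in> K \<Longrightarrow> u \<bullet> x \<le> u \<bullet> p"
    by (rule supp_attained[OF assms(1), of u]) (rule that)
  obtain q where q: "q \<in> L" "supp L u = u \<bullet> q" "\<And>x. x \<in> L \<Longrightarrow> u \<bullet> x \<le> u \<bullet> q"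
    by (rule supp_attained[OF assms(2), of u]) (rule that)
  have "supp (K + L) u = u \<bullet> (p + q)"
  proof (rule supp_eqI)
    fix x assume "x \<in> K + L"
    then obtain y z where "y \<in> K" "z \<in> L" "x = y + z" by (auto elim!: set_plus_elim)
    then show "u \<bullet> x \<le> u \<bullet> (p + q)" using p(3) q(3) by (simp add: inner_add_right add_mono)
  qed (use p q in auto)
  then show ?thesis using p q by (simp add: inner_add_right)
qed

lemma supp_scaleR_body:
  assumes "K \<in> K2" "0 \<le> r"
  shows "supp ((*\<^sub>R) r ` K) u = r * supp K u"
proof -
  obtain p where p: "p \<in> K" "supp K u = u \<bullet> p" "\<And>x. x \<in> K \<Longrightarrow> u \<bullet> x \<le> u \<bullet> p"
    by (rule supp_attained[OF assms(1), of u]) (rule that)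
  have "supp ((*\<^sub>R) r ` K) u = u \<bullet> (r *\<^sub>R p)"
    by (rule supp_eqI) (use p assms in \<open>auto intro!: mult_left_mono\<close>)
  then show ?thesis by (simp add: p)
qed

lemma supp_scaleR_dir:
  assumes "K \<in> K2" "0 \<le> r"
  shows "supp K (r *\<^sub>R u) = r * supp K u"
proof -
  obtain p where p: "p \<in> K" "supp K u = u \<bullet> p" "\<And>x. x \<in> K \<Longrightarrow> u \<bullet> x \<le> u \<bullet> p"
    by (rule supp_attained[OF assms(1), of u]) (rule that)
  have "supp K (r *\<^sub>R u) = (r *\<^sub>R u) \<bullet> p"
    by (rule supp_eqI) (use p assms in \<open>auto intro!: mult_left_mono\<close>)
  then show ?thesis by (simp add: p)
qed

lemma continuous_on_supp:
  assumes K: "K \<in> K2"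
  shows "continuous_on UNIV (supp K)"
proof -
  obtain R where R: "R > 0" "\<And>x. x \<in> K \<Longrightarrow> norm x \<le> R"
    using body_compact[OF K] compact_imp_bounded bounded_pos by metis
  have *: "supp K u \<le> supp K v + R * norm (u - v)" for u v
  proof -
    obtain p where p: "p \<in> K" "supp K u = u \<bullet> p" "\<And>x. x \<in> K \<Longrightarrow> u \<bullet> x \<le> u \<bullet> p"
      by (rule supp_attained[OF K, of u]) (rule that)
    have "u \<bullet> p = v \<bullet> p + (u - v) \<bullet> p" by (simp add: inner_diff_left)
    also have "v \<bullet> p \<le> supp K v" using K p(1) by (rule inner_le_supp)
    also have "(u - v) \<bullet> p \<le> norm (u - v) * norm p" by (rule norm_cauchy_schwarz)
    also have "\<dots> \<le> norm (u - v) * R" using R(2)[OF p(1)] by (intro mult_left_mono) auto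
    finally show ?thesis using p(2) by (simp add: mult.commute)
  qed
  have "R-lipschitz_on UNIV (supp K)"
  proof (rule lipschitz_onI)
    show "dist (supp K u) (supp K v) \<le> R * dist u v" for u v
      using *[of u v] *[of v u] by (simp add: dist_norm norm_minus_commute abs_le_iff)
  qed (use R in simp)
  then show ?thesis by (rule lipschitz_on_continuous_on)
qed

lemma translate_subset_if_supp_le:
  assumes B: "B \<in> K2" and M: "M \<in> K2" and le: "\<And>u. norm u = 1 \<Longrightarrow> u \<bullet> x + supp B u \<le> supp M u"
  shows "{x} + B \<subseteq> M"
proof
  fix z assume "z \<in> {x} + B"
  then obtain b where b: "b \<in> B" "z = x + b" by (auto elim!: set_plus_elim)
  show "z \<in> M"
  proof (rule ccontr)
    assume "z \<notin> M"
    then obtain a \<beta> where ab: "a \<bullet> z < \<beta>" "\<And>y. y \<in> M \<Longrightarrow> a \<bullet> y > \<beta>"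
      using separating_hyperplane_closed_point[of M z] M by (auto simp: body_closed body_convex)
    obtain m where "m \<in> M" using body_nonempty[OF M] by blast
    then have "a \<noteq> 0" using ab by force
    define u where "u = (- 1 / norm a) *\<^sub>R a"
    have u: "norm u = 1" using \<open>a \<noteq> 0\<close> by (simp add: u_def)
    obtain p where p: "p \<in> M" "supp M u = u \<bullet> p" "\<And>x. x \<in> M \<Longrightarrow> u \<bullet> x \<le> u \<bullet> p"
      by (rule supp_attained[OF M, of u]) (rule that)
    have "u \<bullet> z \<le> u \<bullet> p"
      using le[OF u] inner_le_supp[OF B b(1), of u] p(2) b(2) by (simp add: inner_add_right)
    then have "a \<bullet> p \<le> a \<bullet> z"
      using \<open>a \<noteq> 0\<close> by (simp add: u_def field_simps)
    then show False using ab(1) ab(2)[OF p(1)] by simp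
  qed
qed

lemma card_le_3_cases:
  assumes "finite S" "S \<noteq> {}" "card S \<le> 3"
  obtains x y z where "S = {x, y, z}"
proof -
  have "card S > 0" using assms by (simp add: card_gt_0_iff)
  then consider "card S = 1" | "card S = 2" | "card S = 3" using assms(3) by linarith
  then show thesis
  proof cases
    case 1
    then obtain x where "S = {x}" by (auto simp: card_1_singleton_iff)
    then show thesis using that[of x x x] by simp
  next
    case 2
    then obtain x y where "S = {x, y}" by (auto simp: card_2_iff)
    then show thesis using that[of x x y] by simp
  next
    case 3
    then show thesis using that by (auto simp: card_3_iff)
  qed
qed

text \<open>
  Minimise the \<open>t \<ge> 0\<close> for which some translate of \<open>B\<close> fits into \<open>M\<close> enlarged by the disc of radius \<open>t\<close>. If
  the minimum is positive, \<open>0\<close> is in the convex hull of the active directions, for otherwise a small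
  shift improves \<open>t\<close>; Caratheodory then gives three directions violating the hypothesis.
\<close>
theorem translate_contained_if_triples:
  assumes B: "B \<in> K2" and M: "M \<in> K2"
    and triples: "\<And>a1 a2 a3. a1 + a2 + a3 = 0 \<Longrightarrow>
      supp B a1 + supp B a2 + supp B a3 \<le> supp M a1 + supp M a2 + supp M a3"
  obtains x where "{x} + B \<subseteq> M"
proof -
  define c where "c u = supp M u - supp B u" for u
  have cont: "continuous_on A c" for A
    unfolding c_def by (intro continuous_on_diff continuous_on_subset[OF continuous_on_supp] B M) auto
  have c_scale: "c (r *\<^sub>R u) = r * c u" if "0 \<le> r" for r u
    using that by (simp add: c_def supp_scaleR_dir B M right_diff_distrib)
  let ?S = "sphere (0 :: real^2) 1"
  have "bounded (c ` ?S)"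
    by (intro compact_imp_bounded compact_continuous_image cont) simp
  then obtain T where T: "T > 0" "\<And>u. u \<in> ?S \<Longrightarrow> \<bar>c u\<bar> \<le> T"
    unfolding bounded_pos by auto
  \<comment> \<open>\<open>(x, t)\<close> is in \<open>F\<close> iff \<open>t \<ge> 0\<close> and
    \<open>{x} + B\<close> fits into \<open>M\<close> enlarged by the disc of radius
    \<open>t\<close>. The bound on \<open>x\<close> for \<open>t \<le> T\<close> makes the relevant
    part compact, so a minimal \<open>t\<close> is attained.\<close>
  define F where "F = {(x, t). 0 \<le> t \<and> (\<forall>u\<in>?S. u \<bullet> x \<le> c u + t)}"
  have F_bound: "norm x \<le> 2 * T" if "(x, t) \<in> F" "t \<le> T" for x t
  proof (cases "x = 0")
    case False
    have "(1 / norm x) *\<^sub>R x \<in> ?S" using False by simp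
    then have "((1 / norm x) *\<^sub>R x) \<bullet> x \<le> T + T"
      using that T(2)[of "(1 / norm x) *\<^sub>R x"] unfolding F_def by fastforce
    moreover have "((1 / norm x) *\<^sub>R x) \<bullet> x = norm x"
      using False by (simp add: dot_square_norm power2_eq_square)
    ultimately show ?thesis by simp
  qed (use T in simp)
  have "closed F"
  proof -
    have "F = {p. 0 \<le> snd p} \<inter> (\<Inter>u\<in>?S. {p. u \<bullet> fst p \<le> c u + snd p})"
      by (auto simp: F_def)
    moreover have "closed \<dots>"
      by (intro closed_Int closed_INT ballI closed_Collect_le continuous_intros)
    ultimately show ?thesis by simp
  qed
  then have comp: "compact (F \<inter> (cball 0 (2 * T) \<times> {0..T}))"
    by (intro closed_Int_compact compact_Times compact_cball compact_Icc)
  have "(0, T) \<in> F \<inter> (cball 0 (2 * T) \<times> {0..T})"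
  proof -
    have "u \<bullet> 0 \<le> c u + T" if "u \<in> ?S" for u
      using T(2)[OF that] by (simp add: abs_le_iff)
    then show ?thesis using T(1) by (simp add: F_def)
  qed
  obtain x0 t0 where x0: "(x0, t0) \<in> F \<inter> (cball 0 (2 * T) \<times> {0..T})"
    and min0: "\<And>x t. (x, t) \<in> F \<inter> (cball 0 (2 * T) \<times> {0..T}) \<Longrightarrow> t0 \<le> t"
  proof -
    have "continuous_on (F \<inter> (cball 0 (2 * T) \<times> {0..T})) snd" by (intro continuous_intros)
    then obtain p where p: "p \<in> F \<inter> (cball 0 (2 * T) \<times> {0..T})"
      "\<forall>q\<in>F \<inter> (cball 0 (2 * T) \<times> {0..T}). snd p \<le> snd q"
      using continuous_attains_inf[OF comp] \<open>(0, T) \<in> _\<close> by blast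
    show thesis
    proof (rule that[of "fst p" "snd p"])
      show "(fst p, snd p) \<in> F \<inter> (cball 0 (2 * T) \<times> {0..T})" using p(1) by simp
      show "snd p \<le> t" if "(x, t) \<in> F \<inter> (cball 0 (2 * T) \<times> {0..T})" for x t
        using bspec[OF p(2) that] by simp
    qed
  qed
  have F0: "(x0, t0) \<in> F" "0 \<le> t0" "t0 \<le> T" using x0 by auto
  have min: "t0 \<le> t" if "(x, t) \<in> F" for x t
  proof (cases "t \<le> T")
    case True
    have "0 \<le> t" using that by (simp add: F_def)
    then show ?thesis using min0[of x t] that F_bound[OF that True] True by auto
  qed (use F0 in simp)
  have x0_le: "u \<bullet> x0 \<le> c u + t0" if "u \<in> ?S" for u using F0(1) that by (simp add: F_def)
  have "t0 = 0"
  proof (rule ccontr)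
    assume "t0 \<noteq> 0"
    then have t0: "t0 > 0" using F0 by simp
    define U where "U = {u \<in> ?S. u \<bullet> x0 = c u + t0}"
    have "compact U"
    proof -
      have "closed {u. u \<bullet> x0 = c u + t0}"
        by (intro closed_Collect_eq continuous_intros cont)
      moreover have "U = ?S \<inter> {u. u \<bullet> x0 = c u + t0}" by (auto simp: U_def)
      ultimately show ?thesis by (simp add: compact_Int_closed)
    qed
    then have hull: "closed (convex hull U)"
      by (simp add: compact_convex_hull compact_imp_closed)
    show False
    proof (cases "0 \<in> convex hull U")
      case True
      then obtain S where S: "finite S" "S \<subseteq> U" "card S \<le> 3" "0 \<in> convex hull S"
        unfolding caratheodory[of U] by auto
      moreover have "S \<noteq> {}" using S(4) by auto
      ultimately obtain u1 u2 u3 where u: "S = {u1, u2, u3}" using card_le_3_cases by metis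
      then obtain \<alpha> \<beta> \<gamma> where w: "0 \<le> \<alpha>" "0 \<le> \<beta>" "0 \<le> \<gamma>" "\<alpha> + \<beta> + \<gamma> = 1"
        and s0: "\<alpha> *\<^sub>R u1 + \<beta> *\<^sub>R u2 + \<gamma> *\<^sub>R u3 = 0"
        using S(4) unfolding u convex_hull_3 by force
      have act: "u1 \<bullet> x0 = c u1 + t0" "u2 \<bullet> x0 = c u2 + t0" "u3 \<bullet> x0 = c u3 + t0"
        using S(2) u by (auto simp: U_def)
      \<comment> \<open>Homogeneity absorbs the convex weights into the lengths of the directions,
        which then sum to 0.\<close>
      have "0 \<le> c (\<alpha> *\<^sub>R u1) + c (\<beta> *\<^sub>R u2) + c (\<gamma> *\<^sub>R u3)"
        using triples[OF s0] by (simp add: c_def)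
      also have "\<dots> = \<alpha> * (u1 \<bullet> x0 - t0) + \<beta> * (u2 \<bullet> x0 - t0) + \<gamma> * (u3 \<bullet> x0 - t0)"
        using w act by (simp add: c_scale)
      also have "\<dots> = (\<alpha> *\<^sub>R u1 + \<beta> *\<^sub>R u2 + \<gamma> *\<^sub>R u3) \<bullet> x0 - (\<alpha> + \<beta> + \<gamma>) * t0"
        by (simp add: inner_add_left algebra_simps)
      also have "\<dots> = - t0" using s0 w by simp
      finally show False using t0 by simp
    next
      case False
      then obtain a b where ab: "0 < b" "\<And>u. u \<in> convex hull U \<Longrightarrow> a \<bullet> u > b"
        using separating_hyperplane_closed_point[OF convex_convex_hull hull False] by auto
      have aU: "a \<bullet> u > b" if "u \<in> U" for u using ab(2) hull_inc[OF that] by blast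
      define V where "V = ?S \<inter> {u. a \<bullet> u \<le> b}"
      have "compact V" unfolding V_def by (intro compact_Int_closed closed_halfspace_le) simp
      \<comment> \<open>On \<open>V\<close>, away from the active directions, there is a uniform
        slack \<mu>. Shifting \<open>x0\<close> by \<open>- e a\<close> costs at most
        \<open>e * norm a\<close> there, which \<open>e\<close> keeps to half the slack, and gains
        at least \<open>e * b\<close> in the other directions.\<close>
      have "\<exists>\<mu>>0. \<forall>u\<in>V. \<mu> \<le> c u + t0 - u \<bullet> x0"
      proof (cases "V = {}")
        case False
        have "continuous_on V (\<lambda>u. c u + t0 - u \<bullet> x0)" by (intro continuous_intros cont)
        then obtain v where v: "v \<in> V" "\<And>u. u \<in> V \<Longrightarrow> c v + t0 - v \<bullet> x0 \<le> c u + t0 - u \<bullet> x0"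
          using continuous_attains_inf[OF \<open>compact V\<close> False] by blast
        have "v \<notin> U" using aU[of v] v(1) by (auto simp: V_def)
        then have "c v + t0 - v \<bullet> x0 > 0" using v(1) x0_le[of v] by (auto simp: U_def V_def)
        then show ?thesis using v(2) by blast
      qed (auto intro: exI[of _ 1])
      then obtain \<mu> where \<mu>: "\<mu> > 0" "\<And>u. u \<in> V \<Longrightarrow> \<mu> \<le> c u + t0 - u \<bullet> x0" by blast
      define e where "e = \<mu> / (2 * (norm a + 1))"
      have e: "e > 0" using \<mu> by (simp add: e_def add_nonneg_pos)
      have ea: "e * norm a \<le> \<mu> / 2"
      proof -
        have "e * norm a \<le> e * (norm a + 1)" using e by simp
        also have "\<dots> = \<mu> / 2" by (simp add: e_def add_nonneg_eq_0_iff field_simps)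
          
        finally show ?thesis .
      qed
      define t1 where "t1 = max 0 (max (t0 - \<mu> / 2) (t0 - e * b))"
      have "(x0 - e *\<^sub>R a, t1) \<in> F"
      proof -
        have "u \<bullet> (x0 - e *\<^sub>R a) \<le> c u + t1" if u: "u \<in> ?S" for u
        proof (cases "u \<in> V")
          case True
          have "- (u \<bullet> a) \<le> norm a"
            using Cauchy_Schwarz_ineq2[of u a] u by (simp add: abs_le_iff)
          then have "e * (- (u \<bullet> a)) \<le> e * norm a" using e by (intro mult_left_mono) auto
          then have "u \<bullet> (x0 - e *\<^sub>R a) \<le> u \<bullet> x0 + e * norm a"
            by (simp add: inner_diff_right)
          also have "\<dots> \<le> c u + (t0 - \<mu> / 2)" using \<mu>(2)[OF True] ea by linarith
          finally show ?thesis by (simp add: t1_def le_max_iff_disj)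
        next
          case False
          then have "b \<le> u \<bullet> a" using u by (auto simp: V_def inner_commute)
          then have "e * b \<le> e * (u \<bullet> a)" using e by (intro mult_left_mono) auto
          then have "u \<bullet> (x0 - e *\<^sub>R a) \<le> c u + (t0 - e * b)"
            using x0_le[OF u] by (simp add: inner_diff_right)
          then show ?thesis by (simp add: t1_def le_max_iff_disj)
        qed
        then show ?thesis by (auto simp: F_def t1_def)
      qed
      then have "t0 \<le> t1" by (rule min)
      moreover have "t1 < t0" using t0 \<mu> e ab(1) by (simp add: t1_def)
      ultimately show False by simp
    qed
  qed
  then have "{x0} + B \<subseteq> M"
    using x0_le by (intro translate_subset_if_supp_le[OF B M]) (force simp: c_def)
  then show thesis by (rule that)
qed

text \<open>The directions are outer normals of the sides of \<open>tri\<close> and sum to 0, so the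
  value is invariant under translation: it is the scaling factor of the copy of \<open>tri\<close>
  circumscribed about \<open>K\<close>.\<close>

definition tri_width :: "(real^2) set \<Rightarrow> real" where
  "tri_width K = supp K (pt (- 1) 0) + supp K (pt 0 (- 1)) + supp K (pt 1 1)"

lemma scaled_inscribed:
  assumes K: "K \<in> K2"
  obtains a b c k K' where "inscribed a b c K'" "K = {k} + (*\<^sub>R) (tri_width K) ` K'" "0 \<le> tri_width K"
proof -
  obtain p1 where p1: "p1 \<in> K" "supp K (pt (- 1) 0) = pt (- 1) 0 \<bullet> p1" "\<And>x. x \<in> K \<Longrightarrow> pt (- 1) 0 \<bullet> x \<le> pt (- 1) 0 \<bullet> p1"
    by (rule supp_attained[OF K]) (rule that)
  obtain p2 where p2: "p2 \<in> K" "supp K (pt 0 (- 1)) = pt 0 (- 1) \<bullet> p2" "\<And>x. x \<in> K \<Longrightarrow> pt 0 (- 1) \<bullet> x \<le> pt 0 (- 1) \<bullet> p2"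
    by (rule supp_attained[OF K]) (rule that)
  obtain p3 where p3: "p3 \<in> K" "supp K (pt 1 1) = pt 1 1 \<bullet> p3" "\<And>x. x \<in> K \<Longrightarrow> pt 1 1 \<bullet> x \<le> pt 1 1 \<bullet> p3"
    by (rule supp_attained[OF K]) (rule that)
  \<comment> \<open>The right-angled vertex of the circumscribed copy of \<open>tri\<close>.\<close>
  define k where "k = pt (p1$1) (p2$2)"
  define L where "L = {- k} + K"
  have KL: "K = {k} + L" by (simp add: L_def singleton_plus image_image)
  have L: "L \<in> K2" using K by (simp add: L_def body_plus)
  have in_L: "x - k \<in> L" if "x \<in> K" for x using that by (auto simp: L_def singleton_plus)
  have Lx: "\<exists>x\<in>K. l = x - k" if "l \<in> L" for l using that by (auto simp: L_def singleton_plus)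
  have nn: "0 \<le> l$1 \<and> 0 \<le> l$2" if l: "l \<in> L" for l
  proof -
    obtain x where "x \<in> K" "l = x - k" using Lx[OF l] by blast
    then show ?thesis using p1(3)[of x] p2(3)[of x] by (simp add: k_def inner_pt)
  qed
  have w: "tri_width K = (p3 - k)$1 + (p3 - k)$2"
    by (simp add: tri_width_def p1 p2 p3 k_def inner_pt)
  have top: "l$1 + l$2 \<le> (p3 - k)$1 + (p3 - k)$2" if l: "l \<in> L" for l
  proof -
    obtain x where "x \<in> K" "l = x - k" using Lx[OF l] by blast
    then show ?thesis using p3(3)[of x] by (simp add: inner_pt)
  qed
  obtain a b c K' where K': "inscribed a b c K'" "L = (*\<^sub>R) ((p3 - k)$1 + (p3 - k)$2) ` K'"
    by (rule quadrant_body_scaled_inscribed[OF L nn in_L[OF p1(1)] _ in_L[OF p2(1)] _ in_L[OF p3(1)] top])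
       (simp_all add: k_def that)
  moreover have "0 \<le> tri_width K" using nn[OF in_L[OF p3(1)]] by (simp add: w)
  ultimately show thesis using that[of a b c K' k] KL w by simp
qed

lemma dmv_tri_width:
  assumes B: "B \<in> K2" and C: "C \<in> K2" and D: "D \<in> K2"
  shows "dmv C D * tri_width B \<le> dmv B D * tri_width C + dmv B C * tri_width D"
proof -
  obtain a b c k B' where B': "inscribed a b c B'" "B = {k} + (*\<^sub>R) (tri_width B) ` B'" "0 \<le> tri_width B"
    by (rule scaled_inscribed[OF B]) (rule that)
  obtain a' b' c' k' C' where C': "inscribed a' b' c' C'" "C = {k'} + (*\<^sub>R) (tri_width C) ` C'" "0 \<le> tri_width C"
    by (rule scaled_inscribed[OF C]) (rule that)
  obtain a'' b'' c'' k'' D' where D': "inscribed a'' b'' c'' D'" "D = {k''} + (*\<^sub>R) (tri_width D) ` D'" "0 \<le> tri_width D"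
    by (rule scaled_inscribed[OF D]) (rule that)
  have bodies: "B' \<in> K2" "C' \<in> K2" "D' \<in> K2" using B' C' D' by (auto simp: inscribed_def)
  have red: "dmv ({x} + (*\<^sub>R) r ` K) ({y} + (*\<^sub>R) s ` L) = r * s * dmv K L"
    if "K \<in> K2" "L \<in> K2" "0 \<le> r" "0 \<le> s" for x y r s K L
    using that by (simp add: dmv_scaleR_left dmv_scaleR_right body_scaleR)
  have BC: "dmv B C = tri_width B * tri_width C * dmv B' C'"
    by (subst B'(2), subst C'(2)) (rule red; fact bodies B'(3) C'(3))
  have BD: "dmv B D = tri_width B * tri_width D * dmv B' D'"
    by (subst B'(2), subst D'(2)) (rule red; fact bodies B'(3) D'(3))
  have CD: "dmv C D = tri_width C * tri_width D * dmv C' D'"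
    by (subst C'(2), subst D'(2)) (rule red; fact bodies D'(3) C'(3))
  have "(tri_width B * tri_width C * tri_width D) * dmv C' D'
    \<le> (tri_width B * tri_width C * tri_width D) * (dmv B' C' + dmv B' D')"
    using dmv_inscribed_triangle_inequality[OF B'(1) C'(1) D'(1)] B'(3) C'(3) D'(3)
    by (intro mult_left_mono) auto
  then show ?thesis unfolding BC BD CD by (simp add: algebra_simps)
qed

text \<open>Under the linear map with rows \<open>- a1\<close> and \<open>- a2\<close>, support
  values in the three directions become those of the image in the normals of \<open>tri\<close>; the
  determinant appears once in each term.\<close>

lemma dmv_supp_triple_proper:
  assumes B: "B \<in> K2" and C: "C \<in> K2" and D: "D \<in> K2" and a: "cr a1 a2 \<noteq> 0" "a3 = - (a1 + a2)"
  shows "dmv C D * (supp B a1 + supp B a2 + supp B a3)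
    \<le> dmv B D * (supp C a1 + supp C a2 + supp C a3) + dmv B C * (supp D a1 + supp D a2 + supp D a3)"
proof -
  define f where "f = (\<lambda>x::real^2. pt (- (a1 \<bullet> x)) (- (a2 \<bullet> x)))"
  have lin: "linear f" by (auto intro!: linearI simp: f_def vec2_eq_iff inner_add_right)
  have "det (matrix f) = cr a1 a2"
    by (simp add: det_2 matrix_def f_def cr_def inner_axis)
  then have det: "\<bar>det (matrix f)\<bar> > 0" using a by simp
  have sf: "supp (f ` K) u = supp K v" if "\<And>x. u \<bullet> f x = v \<bullet> x" for K u v
    unfolding supp_def image_image by (simp add: that)
  have "supp (f ` K) (pt (- 1) 0) = supp K a1" "supp (f ` K) (pt 0 (- 1)) = supp K a2"
    "supp (f ` K) (pt 1 1) = supp K a3" for K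
    by (rule sf; simp add: f_def inner_pt a inner_add_left inner_diff_left)+
  then have w: "tri_width (f ` K) = supp K a1 + supp K a2 + supp K a3" for K
    by (simp add: tri_width_def)
  have "\<bar>det (matrix f)\<bar> * (dmv C D * (supp B a1 + supp B a2 + supp B a3))
    \<le> \<bar>det (matrix f)\<bar> * (dmv B D * (supp C a1 + supp C a2 + supp C a3) + dmv B C * (supp D a1 + supp D a2 + supp D a3))"
    using dmv_tri_width[of "f ` B" "f ` C" "f ` D"] B C D lin
    by (simp add: body_linear_image dmv_linear_image w distrib_left mult.assoc)
  then show ?thesis using det by simp
qed

text \<open>Dependent directions are limits of independent ones, and support functions are
  continuous.\<close>

lemma dmv_supp_triple:
  assumes B: "B \<in> K2" and C: "C \<in> K2" and D: "D \<in> K2" and a: "a1 + a2 + a3 = 0"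
  shows "dmv C D * (supp B a1 + supp B a2 + supp B a3)
    \<le> dmv B D * (supp C a1 + supp C a2 + supp C a3) + dmv B C * (supp D a1 + supp D a2 + supp D a3)"
proof -
  define b1 where "b1 e = a1 + e *\<^sub>R pt 1 0" for e
  define b2 where "b2 e = a2 + e *\<^sub>R pt 0 1" for e
  define b3 where "b3 e = - (b1 e + b2 e)" for e
  define X where "X = a1$1 + a2$2"
  have a3: "a3 = - (a1 + a2)" using a by (metis add.commute eq_neg_iff_add_eq_0)
  have "\<exists>d>0. \<forall>e>0. e < d \<longrightarrow> cr (b1 e) (b2 e) \<noteq> 0"
  proof (cases "cr a1 a2 = 0")
    case True
    have eq: "cr (b1 e) (b2 e) = e * (X + e)" for e
      using True by (simp add: b1_def b2_def X_def cr_def algebra_simps)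
    \<comment> \<open>For \<open>e > 0\<close> the determinant vanishes only at
      \<open>e = - X\<close>, which is a restriction only if \<open>X < 0\<close>.\<close>
    show ?thesis
      by (rule exI[of _ "if X < 0 then - X else 1"]) (auto simp: eq)
  next
    case False
    show ?thesis
    proof -
      have "((\<lambda>e. cr (b1 e) (b2 e)) \<longlongrightarrow> cr (b1 0) (b2 0)) (at_right 0)"
        unfolding b1_def b2_def cr_def by (intro tendsto_eq_intros) auto
      moreover have "cr (b1 0) (b2 0) \<noteq> 0" using False by (simp add: b1_def b2_def)
      ultimately have "eventually (\<lambda>e. cr (b1 e) (b2 e) \<noteq> 0) (at_right 0)"
        by (rule tendsto_imp_eventually_ne)
      then show ?thesis by (simp add: eventually_at_right_field)
    qed
  qed
  then have ev: "eventually (\<lambda>e. cr (b1 e) (b2 e) \<noteq> 0) (at_right 0)"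
    by (simp add: eventually_at_right_field)
  have lim: "((\<lambda>e. supp K (b1 e)) \<longlongrightarrow> supp K a1) (at_right 0)"
    "((\<lambda>e. supp K (b2 e)) \<longlongrightarrow> supp K a2) (at_right 0)"
    "((\<lambda>e. supp K (b3 e)) \<longlongrightarrow> supp K a3) (at_right 0)" if "K \<in> K2" for K
  proof -
    have b: "(b1 \<longlongrightarrow> a1) (at_right 0)" "(b2 \<longlongrightarrow> a2) (at_right 0)" "(b3 \<longlongrightarrow> a3) (at_right 0)"
      unfolding b3_def b1_def b2_def a3 by (auto intro!: tendsto_eq_intros)
    have "isCont (supp K) u" for u
      using continuous_on_supp[OF that] by (simp add: continuous_on_eq_continuous_at)
    then show "((\<lambda>e. supp K (b1 e)) \<longlongrightarrow> supp K a1) (at_right 0)"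
      "((\<lambda>e. supp K (b2 e)) \<longlongrightarrow> supp K a2) (at_right 0)"
      "((\<lambda>e. supp K (b3 e)) \<longlongrightarrow> supp K a3) (at_right 0)"
      using b by (auto intro: isCont_tendsto_compose)
  qed
  show ?thesis
  proof (rule tendsto_le[OF trivial_limit_at_right_real])
    show "((\<lambda>e. dmv B D * (supp C (b1 e) + supp C (b2 e) + supp C (b3 e)) + dmv B C * (supp D (b1 e) + supp D (b2 e) + supp D (b3 e)))
      \<longlongrightarrow> dmv B D * (supp C a1 + supp C a2 + supp C a3) + dmv B C * (supp D a1 + supp D a2 + supp D a3)) (at_right 0)"
      by (intro tendsto_intros lim C D)
    show "((\<lambda>e. dmv C D * (supp B (b1 e) + supp B (b2 e) + supp B (b3 e)))
      \<longlongrightarrow> dmv C D * (supp B a1 + supp B a2 + supp B a3)) (at_right 0)"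
      by (intro tendsto_intros lim B)
    show "eventually (\<lambda>e. dmv C D * (supp B (b1 e) + supp B (b2 e) + supp B (b3 e))
      \<le> dmv B D * (supp C (b1 e) + supp C (b2 e) + supp C (b3 e)) + dmv B C * (supp D (b1 e) + supp D (b2 e) + supp D (b3 e))) (at_right 0)"
      using ev by eventually_elim (intro dmv_supp_triple_proper B C D; simp add: b3_def)
  qed
qed

theorem dmv_plucker:
  assumes A: "A \<in> K2" and B: "B \<in> K2" and C: "C \<in> K2" and D: "D \<in> K2"
  shows "dmv A B * dmv C D \<le> dmv A C * dmv B D + dmv A D * dmv B C"
proof -
  let ?M = "(*\<^sub>R) (dmv B D) ` C + (*\<^sub>R) (dmv B C) ` D" and ?B = "(*\<^sub>R) (dmv C D) ` B"
  have nn: "0 \<le> dmv B D" "0 \<le> dmv B C" "0 \<le> dmv C D" using B C D by (simp_all add: dmv_nonneg)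
  have bodies: "?B \<in> K2" "?M \<in> K2" using B C D by (simp_all add: body_scaleR body_plus)
  obtain x where "{x} + ?B \<subseteq> ?M"
  proof (rule translate_contained_if_triples[OF bodies])
    fix a1 a2 a3 :: "real^2" assume "a1 + a2 + a3 = 0"
    from dmv_supp_triple[OF B C D this]
    show "supp ?B a1 + supp ?B a2 + supp ?B a3 \<le> supp ?M a1 + supp ?M a2 + supp ?M a3"
      using B C D nn by (simp add: supp_plus supp_scaleR_body body_scaleR algebra_simps)
  qed
  then have "dmv ({x} + ?B) A \<le> dmv ?M A"
    by (rule dmv_mono_left[OF body_plus[OF body_singleton bodies(1)] bodies(2) _ A])
  then show ?thesis
    using A B C D nn by (simp add: dmv_plus_right dmv_scaleR_right body_scaleR dmv_commute[of _ A] mult.commute)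
qed

section \<open>Realisation\<close>

lemma dmv_segments_0: "dmv (closed_segment 0 d) (closed_segment 0 e) = \<bar>cr d e\<bar>"
  using dmv_segments[of d 0 e] by simp

lemma realize_mixed_areas:
  fixes m12 m13 m14 m23 m24 m34 :: real
  assumes pos: "0 < m12" and nn: "0 \<le> m13" "0 \<le> m14" "0 \<le> m23" "0 \<le> m24"
    and up: "m12 * m34 \<le> m13 * m24 + m14 * m23"
    and lo: "m13 * m24 \<le> m12 * m34 + m14 * m23" "m14 * m23 \<le> m12 * m34 + m13 * m24"
  obtains K1 K2' K3 K4 where "K1 \<in> K2" "K2' \<in> K2" "K3 \<in> K2" "K4 \<in> K2"
    "dmv K1 K2' = m12" "dmv K1 K3 = m13" "dmv K1 K4 = m14" "dmv K2' K3 = m23" "dmv K2' K4 = m24" "dmv K3 K4 = m34"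
proof -
  \<comment> \<open>\<open>K1\<close> is horizontal of length \<open>m12\<close> and
    \<open>K2'\<close> vertical of length 1, so mixed areas with \<open>K1\<close> fix heights and
    those with \<open>K2'\<close> fix widths: \<open>K3\<close> gets the box \<open>m23\<close> by
    \<open>h3\<close>, \<open>K4\<close> the diagonal of the box \<open>m24\<close> by
    \<open>h4\<close>.\<close>
  define h3 where "h3 = m13 / m12"
  define h4 where "h4 = m14 / m12"
  \<comment> \<open>Two diagonals have \<open>dmv\<close> equal to \<open>\<bar>P - Q\<bar>\<close>,
    box and diagonal \<open>P + Q\<close>. Divided by \<open>m12\<close>, the three inequalities
    place \<open>m34\<close> between these values.\<close>
  define P where "P = m23 * h4"
  define Q where "Q = h3 * m24"
  have PQ: "0 \<le> P" "0 \<le> Q" using pos nn by (simp_all add: P_def Q_def h3_def h4_def)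
  have m: "\<bar>P - Q\<bar> \<le> m34" "m34 \<le> P + Q"
  proof -
    have "m12 * P = m14 * m23" "m12 * Q = m13 * m24"
      using pos by (simp_all add: P_def Q_def h3_def h4_def)
    then have "m12 * m34 \<le> m12 * (P + Q)" "m12 * (P - Q) \<le> m12 * m34" "m12 * (Q - P) \<le> m12 * m34"
      using up lo by (simp_all add: distrib_left right_diff_distrib)
    then show "\<bar>P - Q\<bar> \<le> m34" "m34 \<le> P + Q" using pos by (simp_all add: abs_le_iff)
  qed
  obtain t where t: "0 \<le> t" "t \<le> 1" "(1 - t) * \<bar>P - Q\<bar> + t * (P + Q) = m34"
  proof (cases "P + Q = \<bar>P - Q\<bar>")
    case True
    then show thesis using that[of 0] m by simp
  next
    case False
    define t where "t = (m34 - \<bar>P - Q\<bar>) / (P + Q - \<bar>P - Q\<bar>)"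
    have pq: "P + Q - \<bar>P - Q\<bar> > 0" using False PQ by (simp add: abs_if split: if_splits)
    then have "t * (P + Q - \<bar>P - Q\<bar>) = m34 - \<bar>P - Q\<bar>" by (simp add: t_def)
    then have "(1 - t) * \<bar>P - Q\<bar> + t * (P + Q) = m34" by (simp add: algebra_simps)
    moreover have "0 \<le> t" "t \<le> 1" using pq m by (simp_all add: t_def)
    ultimately show thesis using that by blast
  qed
  let ?seg = "\<lambda>a b. closed_segment 0 (pt a b)"
  \<comment> \<open>A Minkowski mixture of diagonal and box: its width and height do not depend on
    \<open>t\<close>, and its \<open>dmv\<close> with \<open>K4\<close> is affine in
    \<open>t\<close>.\<close>
  define K3 where "K3 = (*\<^sub>R) (1 - t) ` ?seg m23 h3 + (*\<^sub>R) t ` (?seg m23 0 + ?seg 0 h3)"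
  have K3: "K3 \<in> K2" unfolding K3_def by (intro body_plus body_scaleR body_segment)
  have dK3: "dmv (?seg a b) K3 = (1 - t) * \<bar>a * h3 - b * m23\<bar> + t * (\<bar>b * m23\<bar> + \<bar>a * h3\<bar>)" for a b
    using t by (simp add: K3_def dmv_plus_right dmv_scaleR_right body_scaleR body_plus dmv_segments_0 cr_def)
  have h: "0 \<le> h3" "0 \<le> h4" using nn pos by (simp_all add: h3_def h4_def)
  have "dmv (?seg m24 h4) K3 = (1 - t) * \<bar>P - Q\<bar> + t * (P + Q)"
    using nn h by (simp add: dK3 P_def Q_def mult.commute abs_minus_commute)
  then have "dmv K3 (?seg m24 h4) = m34" using t by (simp add: dmv_commute)
  moreover have "dmv (?seg m12 0) K3 = m13"
    using pos nn by (simp add: dK3 h3_def algebra_simps)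
  moreover have "dmv (?seg 0 1) K3 = m23"
    using nn by (simp add: dK3 algebra_simps)
  moreover have "dmv (?seg m12 0) (?seg 0 1) = m12" "dmv (?seg m12 0) (?seg m24 h4) = m14"
    "dmv (?seg 0 1) (?seg m24 h4) = m24"
    using pos nn by (simp_all add: dmv_segments_0 cr_def h4_def)
  ultimately show thesis
    using that[of "?seg m12 0" "?seg 0 1" K3 "?seg m24 h4"] K3 by simp
qed

lemma pair_in_pairs:
  assumes "i \<in> {1..n}" "j \<in> {1..n}" "i \<noteq> j"
  shows "{i, j} \<in> pairs n"
proof (cases "i < j")
  case True
  then show ?thesis unfolding pairs_def using assms by (intro CollectI exI[of _ i] exI[of _ j]) auto
next
  case False
  then show ?thesis unfolding pairs_def using assms by (intro CollectI exI[of _ j] exI[of _ i]) auto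
qed

lemma mixed_area_Min_Max: "mixed_area (K (Min {i, j})) (K (Max {i, j})) = dmv (K i) (K j) / 2" for i j :: nat
  by (cases "i \<le> j") (simp_all add: mixed_area_dmv dmv_commute min_def max_def)

text \<open>Symmetry of \<open>dmv\<close> removes the ordering by \<open>Min\<close> and
  \<open>Max\<close>; the factor 2 accounts for \<open>dmv\<close> being twice the mixed
  area.\<close>

lemma in_PMV2_iff:
  "v \<in> PMV2 n \<longleftrightarrow> (\<forall>S. S \<notin> pairs n \<longrightarrow> v S = 0) \<and>
    (\<exists>K. (\<forall>i\<in>{1..n}. K i \<in> K2) \<and> (\<forall>i\<in>{1..n}. \<forall>j\<in>{1..n}. i \<noteq> j \<longrightarrow> dmv (K i) (K j) = 2 * v {i, j}))"
proof safe
  fix S assume "v \<in> PMV2 n" "S \<notin> pairs n"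
  then show "v S = 0" by (auto simp: PMV2_def)
next
  assume "v \<in> PMV2 n"
  then obtain K where K: "\<forall>i\<in>{1..n}. K i \<in> K2"
    and v: "v = (\<lambda>S. if S \<in> pairs n then mixed_area (K (Min S)) (K (Max S)) else 0)"
    by (auto simp: PMV2_def)
  have "dmv (K i) (K j) = 2 * v {i, j}" if "i \<in> {1..n}" "j \<in> {1..n}" "i \<noteq> j" for i j
    using pair_in_pairs[OF that] by (simp add: v mixed_area_Min_Max del: Min_insert Max_insert)
  then show "\<exists>K. (\<forall>i\<in>{1..n}. K i \<in> K2) \<and> (\<forall>i\<in>{1..n}. \<forall>j\<in>{1..n}. i \<noteq> j \<longrightarrow> dmv (K i) (K j) = 2 * v {i, j})"
    using K by blast
next
  fix K assume off: "\<forall>S. S \<notin> pairs n \<longrightarrow> v S = 0" and K: "\<forall>i\<in>{1..n}. K i \<in> K2"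
    and d: "\<forall>i\<in>{1..n}. \<forall>j\<in>{1..n}. i \<noteq> j \<longrightarrow> dmv (K i) (K j) = 2 * v {i, j}"
  have "v S = mixed_area (K (Min S)) (K (Max S))" if "S \<in> pairs n" for S
  proof -
    obtain i j where ij: "1 \<le> i" "i < j" "j \<le> n" "S = {i, j}" using \<open>S \<in> pairs n\<close> by (auto simp: pairs_def)
    then have "dmv (K i) (K j) = 2 * v {i, j}" using d by auto
    then show ?thesis unfolding ij(4) mixed_area_Min_Max by simp
  qed
  then have "v = (\<lambda>S. if S \<in> pairs n then mixed_area (K (Min S)) (K (Max S)) else 0)"
    using off by auto
  then show "v \<in> PMV2 n" unfolding PMV2_def using K by blast
qed

lemma four_distinct:
  assumes "{i, j, k, l} = {1, 2, 3, 4::nat}"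
  shows "i \<noteq> j" "i \<noteq> k" "i \<noteq> l" "j \<noteq> k" "j \<noteq> l" "k \<noteq> l"
proof -
  have "card {i, j, k, l} = 4" using assms by simp
  then show "i \<noteq> j" "i \<noteq> k" "i \<noteq> l" "j \<noteq> k" "j \<noteq> l" "k \<noteq> l"
    by (auto simp: card_insert_if split: if_splits)
qed

lemma complete_to_four:
  assumes "i \<in> {1..4}" "j \<in> {1..4}" "i \<noteq> j"
  obtains k l where "{i, j, k, l} = {1, 2, 3, 4::nat}"
proof -
  have "card ({1, 2, 3, 4} - {i, j}) = 2"
    using assms by (subst card_Diff_subset) auto
  then obtain k l where kl: "{1, 2, 3, 4} - {i, j} = {k, l}" by (auto simp: card_2_iff)
  have "{i, j} \<subseteq> {1, 2, 3, 4}" using assms by auto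
  then have "{i, j, k, l} = {1, 2, 3, 4}" using kl by blast
  then show thesis by (rule that)
qed

theorem mainTheorem3:
  shows "PMV2 4 = {v. (\<forall>S. S \<notin> pairs 4 \<longrightarrow> v S = 0) \<and>
            (\<forall>S\<in>pairs 4. v S \<ge> 0) \<and>
            (\<forall>i j k l. {i, j, k, l} = {1, 2, 3, 4::nat} \<longrightarrow>
               v {i, j} * v {k, l} \<le> v {i, k} * v {j, l} + v {i, l} * v {j, k})}"
proof (intro set_eqI iffI)
  fix v assume "v \<in> PMV2 4"
  then obtain K where off: "\<forall>S. S \<notin> pairs 4 \<longrightarrow> v S = 0" and K: "\<And>i. i \<in> {1..4} \<Longrightarrow> K i \<in> K2"
    and d: "\<And>i j. i \<in> {1..4} \<Longrightarrow> j \<in> {1..4} \<Longrightarrow> i \<noteq> j \<Longrightarrow> dmv (K i) (K j) = 2 * v {i, j}"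
    unfolding in_PMV2_iff by blast
  have "0 \<le> v S" if "S \<in> pairs 4" for S
  proof -
    obtain i j where ij: "1 \<le> i" "i < j" "j \<le> 4" "S = {i, j}" using \<open>S \<in> pairs 4\<close> by (auto simp: pairs_def)
    then show ?thesis using d[of i j] dmv_nonneg[OF K K, of i j] by simp
  qed
  moreover have "v {i, j} * v {k, l} \<le> v {i, k} * v {j, l} + v {i, l} * v {j, k}"
    if ijkl: "{i, j, k, l} = {1, 2, 3, 4}" for i j k l
  proof -
    note dist = four_distinct[OF ijkl]
    have "{i, j, k, l} \<subseteq> {1..4}" unfolding ijkl by simp
    then have mem: "i \<in> {1..4}" "j \<in> {1..4}" "k \<in> {1..4}" "l \<in> {1..4}" by simp_all
    show ?thesis
      using dmv_plucker[OF K[OF mem(1)] K[OF mem(2)] K[OF mem(3)] K[OF mem(4)]] dist mem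
      by (simp add: d)
  qed
  ultimately show "v \<in> {v. (\<forall>S. S \<notin> pairs 4 \<longrightarrow> v S = 0) \<and> (\<forall>S\<in>pairs 4. v S \<ge> 0) \<and>
            (\<forall>i j k l. {i, j, k, l} = {1, 2, 3, 4::nat} \<longrightarrow>
               v {i, j} * v {k, l} \<le> v {i, k} * v {j, l} + v {i, l} * v {j, k})}"
    using off by blast
next
  fix v :: "nat set \<Rightarrow> real"
  assume "v \<in> {v. (\<forall>S. S \<notin> pairs 4 \<longrightarrow> v S = 0) \<and> (\<forall>S\<in>pairs 4. v S \<ge> 0) \<and>
            (\<forall>i j k l. {i, j, k, l} = {1, 2, 3, 4::nat} \<longrightarrow>
               v {i, j} * v {k, l} \<le> v {i, k} * v {j, l} + v {i, l} * v {j, k})}"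
  then have off: "\<forall>S. S \<notin> pairs 4 \<longrightarrow> v S = 0" and nn: "\<And>S. S \<in> pairs 4 \<Longrightarrow> 0 \<le> v S"
    and pl: "\<And>i j k l. {i, j, k, l} = {1, 2, 3, 4} \<Longrightarrow>
               v {i, j} * v {k, l} \<le> v {i, k} * v {j, l} + v {i, l} * v {j, k}"
    by blast+
  have "\<exists>K. (\<forall>i\<in>{1..4}. K i \<in> K2) \<and> (\<forall>i\<in>{1..4}. \<forall>j\<in>{1..4}. i \<noteq> j \<longrightarrow> dmv (K i) (K j) = 2 * v {i, j})"
  \<comment> \<open>The realisation divides by one coordinate, so a positive one is relabelled to
    play the role of \<open>m12\<close>; if there is none, points realise the zero vector.\<close>
  proof (cases "\<exists>S\<in>pairs 4. v S > 0")
    case False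
    have "v {i, j} = 0" if "i \<in> {1..4}" "j \<in> {1..4}" "i \<noteq> j" for i j
      using nn[OF pair_in_pairs[OF that]] False pair_in_pairs[OF that] by force
    then show ?thesis by (intro exI[of _ "\<lambda>_. {0}"]) simp
  next
    case True
    then obtain S where S: "S \<in> pairs 4" "v S > 0" by blast
    then obtain i j where "1 \<le> i" "i < j" "j \<le> 4" "S = {i, j}" by (auto simp: pairs_def)
    then have ij: "i \<in> {1..4}" "j \<in> {1..4}" "i \<noteq> j" and pos: "v {i, j} > 0" using S(2) by auto
    obtain k l where ijkl: "{i, j, k, l} = {1, 2, 3, 4}" by (rule complete_to_four[OF ij])
    note dist = four_distinct[OF ijkl]
    have "{i, j, k, l} \<subseteq> {1..4}" unfolding ijkl by simp
    then have mem: "i \<in> {1..4}" "j \<in> {1..4}" "k \<in> {1..4}" "l \<in> {1..4}" by simp_all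
    have p: "0 \<le> v {i, k}" "0 \<le> v {i, l}" "0 \<le> v {j, k}" "0 \<le> v {j, l}"
      using dist mem by (auto intro!: nn pair_in_pairs)
    have "v {i, k} * v {j, l} \<le> v {i, j} * v {k, l} + v {i, l} * v {j, k}"
      using pl[of i k j l] ijkl by (simp add: insert_commute)
    then have lo1: "(2 * v {i, k}) * (2 * v {j, l}) \<le> (2 * v {i, j}) * (2 * v {k, l}) + (2 * v {i, l}) * (2 * v {j, k})"
      by simp
    have "v {i, l} * v {j, k} \<le> v {i, j} * v {k, l} + v {i, k} * v {j, l}"
      using pl[of i l j k] ijkl by (simp add: insert_commute)
    then have lo2: "(2 * v {i, l}) * (2 * v {j, k}) \<le> (2 * v {i, j}) * (2 * v {k, l}) + (2 * v {i, k}) * (2 * v {j, l})"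
      by simp
    have up: "(2 * v {i, j}) * (2 * v {k, l}) \<le> (2 * v {i, k}) * (2 * v {j, l}) + (2 * v {i, l}) * (2 * v {j, k})"
      using pl[OF ijkl] by simp
    have p2: "0 < 2 * v {i, j}" "0 \<le> 2 * v {i, k}" "0 \<le> 2 * v {i, l}" "0 \<le> 2 * v {j, k}" "0 \<le> 2 * v {j, l}"
      using pos p by simp_all
    obtain A B C D where bodies: "A \<in> K2" "B \<in> K2" "C \<in> K2" "D \<in> K2"
      and val: "dmv A B = 2 * v {i, j}" "dmv A C = 2 * v {i, k}" "dmv A D = 2 * v {i, l}"
        "dmv B C = 2 * v {j, k}" "dmv B D = 2 * v {j, l}" "dmv C D = 2 * v {k, l}"
      by (rule realize_mixed_areas[OF p2 up lo1 lo2]) (rule that)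
    define K where "K x = (if x = i then A else if x = j then B else if x = k then C else D)" for x
    have Kv: "K i = A" "K j = B" "K k = C" "K l = D" using dist by (auto simp: K_def)
    have range: "{1..4} = {i, j, k, l}" unfolding ijkl by auto
    have "dmv (K x) (K y) = 2 * v {x, y}" if "x \<in> {i, j, k, l}" "y \<in> {i, j, k, l}" "x \<noteq> y" for x y
      using that val dmv_commute[of B A] dmv_commute[of C A] dmv_commute[of D A] dmv_commute[of C B]
        dmv_commute[of D B] dmv_commute[of D C]
      by (auto simp: Kv insert_commute)
    moreover have "K x \<in> K2" if "x \<in> {i, j, k, l}" for x
      using that bodies by (auto simp: Kv)
    ultimately show ?thesis unfolding range by blast
  qed
  then show "v \<in> PMV2 4" unfolding in_PMV2_iff using off by blast
qed

end
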